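(* Let $(B,D^B)$ be an oriented three dimensional Weyl space and let $\chi$ be a shear-free geodesic congruence on $B$, with $D^B\chi=\tau(\mathrm{id}-\chi\otimes\chi)+\kappa\,{*\chi}$, where $\tau$ (divergence) and $\kappa$ (twist) are sections of $L^{-1}$. Then the Einstein-Weyl equation for $B$ is equivalent to the following special monopole equations for $\chi$: \begin{align*} (1)\qquad *D^B\tau&=-\tfrac12{*\iota_\chi F^B}-\tfrac16\mathrm{scal}^B\,{*\chi}-(\tau^2+\kappa^2)\,{*\chi}+d(\kappa\chi),\\ (2)\qquad *D^B\kappa&=\tfrac12F^B-d(\tau\chi). \end{align*} Here ``monopole equations'' means that the right hand sides are closed $2$-forms (when the equations hold). Moreover these equations are not independent: the pair (1), (2) is equivalent to the pair consisting of $D^B_\chi\tau+\tau^2-\kappa^2+\tfrac16\mathrm{scal}^B=0$ and (2), and also to the pair consisting of $D^B_\chi\kappa+2\tau\kappa+\tfrac12\langle\chi,*F^B\rangle=0$ and (1).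
   Context: For $w\in\mathbb R$, $L^w$ is the oriented real line bundle on an $n$-manifold associated to the frame bundle by $A\mapsto|\det A|^{w/n}$. A conformal structure is a positive definite symmetric bilinear form on the tangent bundle with values in $L^2$, equivalently a metric $\langle\cdot,\cdot\rangle$ on $L^{-1}TB$ (also used to identify $T^*B$ with $L^{-2}TB$; so e.g. $\tau\chi$ and $\kappa\chi$ are ordinary $1$-forms). A Weyl derivative is a covariant derivative on $L^1$; it determines a unique torsion-free connection on the tangent bundle preserving the conformal structure. A Weyl space $(B,D^B)$ is a conformal manifold with such a connection; $F^B$ denotes the curvature of $D^B$ on $L^1$. In dimension three the curvature of $D^B$ on $L^{-1}TB$ is $R_{X,Y}=-r^B(X)\triangle Y+r^B(Y)\triangle X$, where $(\gamma\triangle X)(Y)=\gamma(Y)X-\langle X,Y\rangle\gamma$ and $r^B=r^B_0+\frac1{12}\mathrm{scal}^B\,\mathrm{id}-\frac12F^B$ with $r^B_0$ symmetric trace-free (bilinear forms are identified with endomorphisms by $\Phi(X,Y)=\langle\Phi(X),Y\rangle$). The Einstein-Weyl equation is $r^B_0=0$. The Hodge star is normalised by $*1=\underline{\mathrm{or}}$ (the unit section of $L^3\Lambda^3T^*B$ given by the orientation) and $\iota_X{*\alpha}=*(X\wedge\alpha)$. A congruence is a unit section $\chi$ of $L^{-1}TB$; geodesic means $D^B_\chi\chi=0$; shear-free means that the symmetric trace-free part of $D^B\chi$ on $\chi^\perp$ vanishes. The term $*\chi$ in $D^B\chi$ is viewed as the endomorphism $X\mapsto\iota_X{*\chi}$.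 *)

theory Defs
  imports "HOL-Analysis.Analysis"
begin

section \<open>Smooth functions on open subsets of coordinate space\<close>

definition pd :: "3 \<Rightarrow> (real^3 \<Rightarrow> 'v::real_normed_vector) \<Rightarrow> real^3 \<Rightarrow> 'v" where
  "pd i f x = frechet_derivative f (at x) (axis i 1)"

primrec C_k_on :: "nat \<Rightarrow> (real^3) set \<Rightarrow> (real^3 \<Rightarrow> 'v::real_normed_vector) \<Rightarrow> bool" where
  "C_k_on 0 S f \<longleftrightarrow> continuous_on S f"
| "C_k_on (Suc k) S f \<longleftrightarrow> (\<forall>x\<in>S. f differentiable (at x)) \<and> (\<forall>i. C_k_on k S (pd i f))"

text \<open>Only used for open \<open>S\<close>.\<close>

definition smooth_on :: "(real^3) set \<Rightarrow> (real^3 \<Rightarrow> 'v::real_normed_vector) \<Rightarrow> bool" where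
  "smooth_on S f \<longleftrightarrow> (\<forall>k. C_k_on k S f)"


section \<open>Oriented smooth 3-manifolds\<close>

type_synonym 'b chart = "'b set \<times> ('b \<Rightarrow> real^3)"

definition coords :: "'b chart \<Rightarrow> (real^3) set" where
  "coords a = snd a ` fst a"

definition overlap :: "'b chart \<Rightarrow> 'b chart \<Rightarrow> (real^3) set" where
  "overlap a b = snd a ` (fst a \<inter> fst b)"

definition transition :: "'b chart \<Rightarrow> 'b chart \<Rightarrow> real^3 \<Rightarrow> real^3" where
  "transition a b = snd b \<circ> inv_into (fst a) (snd a)"

definition jac :: "'b chart \<Rightarrow> 'b chart \<Rightarrow> real^3 \<Rightarrow> real^3^3" where
  "jac a b x = matrix (frechet_derivative (transition a b) (at x))"

text \<open>The manifold is the union of the chart domains; being an open subset of a Hausdorff,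
  second countable space, it has these two properties itself.\<close>

definition oriented_atlas :: "'b::{t2_space,second_countable_topology} chart set \<Rightarrow> bool" where
  "oriented_atlas \<A> \<longleftrightarrow>
     (\<forall>a\<in>\<A>. open (fst a) \<and> open (coords a) \<and>
        homeomorphism (fst a) (coords a) (snd a) (inv_into (fst a) (snd a))) \<and>
     (\<forall>a\<in>\<A>. \<forall>b\<in>\<A>. smooth_on (overlap a b) (transition a b) \<and>
        (\<forall>x\<in>overlap a b. det (jac a b x) > 0))"


section \<open>Weyl spaces\<close>

text \<open>
  A section of a bundle associated to the frame bundle is given by its components in every
  chart, i.e. with respect to the coordinate frame, as functions of the coordinates. The
  components in two charts \<open>a\<close>, \<open>b\<close> are related by the representation evaluated at the Jacobian
  of the transition map. The coordinate frame also trivialises every \<open>L\<^sup>w\<close>, so in a chart tensors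
  of any weight have real components; the weights only enter the transformation laws and the
  covariant derivatives.
\<close>

type_synonym ('b, 'v) field = "'b chart \<Rightarrow> real^3 \<Rightarrow> 'v"

text \<open>
  \<open>conf B a x $ j $ k\<close> is the \<open>L\<^sup>2\<close>-valued inner product of the \<open>j\<close>-th and \<open>k\<close>-th coordinate
  fields; \<open>weyl B a x $ i\<close> is the connection form of the Weyl derivative on \<open>L\<^sup>1\<close>, evaluated on
  the \<open>i\<close>-th coordinate field; \<open>tconn B a x $ i\<close> is the connection matrix on the tangent bundle,
  so that \<open>tconn B a x $ i $ k $ j\<close> is the Christoffel symbol with upper index \<open>k\<close> and lower
  indices \<open>i\<close> (the direction of differentiation) and \<open>j\<close>.
\<close>

record 'b weyl_data =
  charts :: "'b chart set"
  conf :: "('b, real^3^3) field"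
  weyl :: "('b, real^3) field"
  tconn :: "('b, real^3^3^3) field"

text \<open>The representation \<open>A \<mapsto> \<bar>det A\<bar>\<^bsup>w/n\<^esup>\<close> defining \<open>L\<^sup>w\<close>, with \<open>n = 3\<close>.\<close>

definition dens :: "real \<Rightarrow> real^3^3 \<Rightarrow> real" where
  "dens w A = \<bar>det A\<bar> powr (w / 3)"

definition smooth_field :: "'b weyl_data \<Rightarrow> ('b, 'v::real_normed_vector) field \<Rightarrow> bool" where
  "smooth_field B f \<longleftrightarrow> (\<forall>a\<in>charts B. smooth_on (coords a) (f a))"

text \<open>Sections of \<open>L\<^sup>w\<close>, and of \<open>L\<^sup>w\<close> tensored with the tangent bundle.\<close>

definition density_section :: "'b weyl_data \<Rightarrow> real \<Rightarrow> ('b, real) field \<Rightarrow> bool" where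
  "density_section B w s \<longleftrightarrow> smooth_field B s \<and>
     (\<forall>a\<in>charts B. \<forall>b\<in>charts B. \<forall>x\<in>overlap a b.
        s b (transition a b x) = dens w (jac a b x) * s a x)"

definition vector_section :: "'b weyl_data \<Rightarrow> real \<Rightarrow> ('b, real^3) field \<Rightarrow> bool" where
  "vector_section B w X \<longleftrightarrow> smooth_field B X \<and>
     (\<forall>a\<in>charts B. \<forall>b\<in>charts B. \<forall>x\<in>overlap a b.
        X b (transition a b x) = dens w (jac a b x) *\<^sub>R (jac a b x *v X a x))"

definition conformal_structure :: "'b weyl_data \<Rightarrow> bool" where
  "conformal_structure B \<longleftrightarrow> smooth_field B (conf B) \<and>
     (\<forall>a\<in>charts B. \<forall>x\<in>coords a. transpose (conf B a x) = conf B a x \<and>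
        (\<forall>v. v \<noteq> 0 \<longrightarrow> v \<bullet> (conf B a x *v v) > 0)) \<and>
     (\<forall>a\<in>charts B. \<forall>b\<in>charts B. \<forall>x\<in>overlap a b.
        transpose (jac a b x) ** conf B b (transition a b x) ** jac a b x
          = dens 2 (jac a b x) *\<^sub>R conf B a x)"

text \<open>
  If components of sections of a vector bundle transform by \<open>s\<^sub>b = g s\<^sub>a\<close>, then the covariant
  derivatives \<open>\<partial>s + A s\<close> computed in the two charts agree iff
  \<open>\<partial>\<^sub>u g + A\<^sub>b(J u) g = g A\<^sub>a(u)\<close> for all vectors \<open>u\<close>, where \<open>J\<close> is the Jacobian. For \<open>L\<^sup>1\<close> the transition
  function is \<open>g = \<bar>det J\<bar>\<^bsup>1/3\<^esup>\<close>, for the tangent bundle it is \<open>g = J\<close>.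
\<close>

definition weyl_derivative :: "'b weyl_data \<Rightarrow> bool" where
  "weyl_derivative B \<longleftrightarrow> smooth_field B (weyl B) \<and>
     (\<forall>a\<in>charts B. \<forall>b\<in>charts B. \<forall>x\<in>overlap a b. \<forall>i.
        pd i (\<lambda>y. dens 1 (jac a b y)) x
          + (weyl B b (transition a b x) \<bullet> (jac a b x *v axis i 1)) * dens 1 (jac a b x)
        = dens 1 (jac a b x) * weyl B a x $ i)"

definition tangent_connection :: "'b weyl_data \<Rightarrow> bool" where
  "tangent_connection B \<longleftrightarrow> smooth_field B (tconn B) \<and>
     (\<forall>a\<in>charts B. \<forall>b\<in>charts B. \<forall>x\<in>overlap a b. \<forall>i.
        pd i (jac a b) x
          + (\<Sum>m\<in>UNIV. (jac a b x *v axis i 1) $ m *\<^sub>R tconn B b (transition a b x) $ m) ** jac a b x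
        = jac a b x ** tconn B a x $ i)"

definition torsion_free :: "'b weyl_data \<Rightarrow> bool" where
  "torsion_free B \<longleftrightarrow> (\<forall>a\<in>charts B. \<forall>x\<in>coords a. \<forall>i j.
     tconn B a x $ i *v axis j 1 = tconn B a x $ j *v axis i 1)"

text \<open>The covariant derivative of the conformal structure, as an \<open>L\<^sup>2\<close>-valued bilinear form on the
  tangent bundle, vanishes.\<close>

definition preserves_conf :: "'b weyl_data \<Rightarrow> bool" where
  "preserves_conf B \<longleftrightarrow> (\<forall>a\<in>charts B. \<forall>x\<in>coords a. \<forall>i.
     pd i (conf B a) x + (2 * weyl B a x $ i) *\<^sub>R conf B a x
       - transpose (tconn B a x $ i) ** conf B a x - conf B a x ** tconn B a x $ i = 0)"

definition oriented_weyl_space :: "'b::{t2_space,second_countable_topology} weyl_data \<Rightarrow> bool" where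
  "oriented_weyl_space B \<longleftrightarrow> oriented_atlas (charts B) \<and> conformal_structure B \<and>
     weyl_derivative B \<and> tangent_connection B \<and> torsion_free B \<and> preserves_conf B"


section \<open>Covariant derivatives and exterior derivative in a chart\<close>

text \<open>\<open>D\<^sup>B\<close> on sections of \<open>L\<^sup>w\<close>, as a (weighted) 1-form.\<close>

definition D_dens :: "'b weyl_data \<Rightarrow> real \<Rightarrow> ('b, real) field \<Rightarrow> ('b, real^3) field" where
  "D_dens B w s a x = (\<chi> i. pd i (s a) x + w * weyl B a x $ i * s a x)"

definition conn :: "'b weyl_data \<Rightarrow> real \<Rightarrow> ('b, real^3^3^3) field" where
  "conn B w a x = (\<chi> i. tconn B a x $ i + (w * weyl B a x $ i) *\<^sub>R mat 1)"

text \<open>\<open>D\<^sup>B\<close> on sections of \<open>L\<^sup>w\<close> tensored with the tangent bundle; the result is the matrix of the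
  (weighted) endomorphism sending \<open>u\<close> to the derivative in direction \<open>u\<close>.\<close>

definition D_vec :: "'b weyl_data \<Rightarrow> real \<Rightarrow> ('b, real^3) field \<Rightarrow> ('b, real^3^3) field" where
  "D_vec B w X a x = (\<chi> k i. (pd i (X a) x + conn B w a x $ i *v X a x) $ k)"

text \<open>Bilinear forms and 2-forms are given by the matrix of their values on pairs of coordinate
  fields; no factors \<open>1/2\<close> enter the exterior derivative.\<close>

definition ext_d :: "(real^3 \<Rightarrow> real^3) \<Rightarrow> real^3 \<Rightarrow> real^3^3" where
  "ext_d \<alpha> x = (\<chi> i j. pd i \<alpha> x $ j - pd j \<alpha> x $ i)"

definition closed_2form :: "'b weyl_data \<Rightarrow> ('b, real^3^3) field \<Rightarrow> bool" where
  "closed_2form B \<omega> \<longleftrightarrow> (\<forall>a\<in>charts B. \<forall>x\<in>coords a.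
     \<omega> a differentiable (at x) \<and> transpose (\<omega> a x) = - \<omega> a x \<and>
     (\<forall>i j k. pd i (\<omega> a) x $ j $ k + pd j (\<omega> a) x $ k $ i + pd k (\<omega> a) x $ i $ j = 0))"


section \<open>Metric algebra and the Hodge star\<close>

definition cinner :: "'b weyl_data \<Rightarrow> 'b chart \<Rightarrow> real^3 \<Rightarrow> real^3 \<Rightarrow> real^3 \<Rightarrow> real" where
  "cinner B a x u v = u \<bullet> (conf B a x *v v)"

definition flat :: "'b weyl_data \<Rightarrow> 'b chart \<Rightarrow> real^3 \<Rightarrow> real^3 \<Rightarrow> real^3" where
  "flat B a x v = conf B a x *v v"

definition sharp :: "'b weyl_data \<Rightarrow> 'b chart \<Rightarrow> real^3 \<Rightarrow> real^3 \<Rightarrow> real^3" where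
  "sharp B a x \<alpha> = matrix_inv (conf B a x) *v \<alpha>"

text \<open>The endomorphism \<open>\<Phi>\<close> corresponding to a bilinear form by \<open>\<Phi>(X,Y) = \<langle>\<Phi>(X),Y\<rangle>\<close>.\<close>

definition endo :: "'b weyl_data \<Rightarrow> 'b chart \<Rightarrow> real^3 \<Rightarrow> real^3^3 \<Rightarrow> real^3^3" where
  "endo B a x M = matrix_inv (conf B a x) ** transpose M"

text \<open>The unit section of \<open>L\<^sup>3\<close>-valued 3-forms given by the orientation; the coordinate frames of
  the charts are positively oriented.\<close>

definition orf :: "'b weyl_data \<Rightarrow> 'b chart \<Rightarrow> real^3 \<Rightarrow> real^3 \<Rightarrow> real^3 \<Rightarrow> real^3 \<Rightarrow> real" where
  "orf B a x u v w = sqrt (det (conf B a x)) * det (vector [u, v, w] :: real^3^3)"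

text \<open>
  The Hodge star with the normalisation \<open>*1 = or\<close> and \<open>\<iota>\<^sub>X *\<alpha> = *(X \<and> \<alpha>)\<close>. With \<open>\<alpha> = 1\<close> this says
  that \<open>*X = \<iota>\<^sub>X or\<close>, which is \<open>star1\<close>. With \<open>\<alpha> = Y\<close> it says that \<open>*(X \<and> Y) = or(Y,X,\<cdot>)\<close>; hence the
  order of the arguments of \<open>or\<close> in \<open>star2\<close>, where \<open>\<omega>\<close> is expanded in wedge products of coordinate
  fields by raising its indices. In this normalisation \<open>** = -1\<close> in dimension three. The
  normalisation identity for \<open>star2\<close> is \<open>star2_wedge\<close> below.
\<close>

definition star1 :: "'b weyl_data \<Rightarrow> 'b chart \<Rightarrow> real^3 \<Rightarrow> real^3 \<Rightarrow> real^3^3" where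
  "star1 B a x \<alpha> = (\<chi> i j. orf B a x (sharp B a x \<alpha>) (axis i 1) (axis j 1))"

definition star2 :: "'b weyl_data \<Rightarrow> 'b chart \<Rightarrow> real^3 \<Rightarrow> real^3^3 \<Rightarrow> real^3" where
  "star2 B a x \<omega> = (let G' = matrix_inv (conf B a x) in
     \<chi> m. (1/2) * (\<Sum>k\<in>UNIV. \<Sum>l\<in>UNIV.
       (G' ** \<omega> ** transpose G') $ k $ l * orf B a x (axis l 1) (axis k 1) (axis m 1)))"


section \<open>Curvature and the Einstein-Weyl equation\<close>

text \<open>The curvature of \<open>D\<^sup>B\<close> on \<open>L\<^sup>1\<close>; there the connection form is just \<open>weyl B a\<close>.\<close>

definition F_curv :: "'b weyl_data \<Rightarrow> ('b, real^3^3) field" where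
  "F_curv B a x = ext_d (weyl B a) x"

text \<open>The curvature endomorphism of \<open>D\<^sup>B\<close> on \<open>L\<^sup>-\<^sup>1TB\<close>, evaluated on the \<open>i\<close>-th and \<open>j\<close>-th coordinate
  fields.\<close>

definition R_curv :: "'b weyl_data \<Rightarrow> 'b chart \<Rightarrow> real^3 \<Rightarrow> 3 \<Rightarrow> 3 \<Rightarrow> real^3^3" where
  "R_curv B a x i j = (let A = conn B (-1) a in
     pd i (\<lambda>y. A y $ j) x - pd j (\<lambda>y. A y $ i) x + A x $ i ** A x $ j - A x $ j ** A x $ i)"

text \<open>\<open>(\<gamma> \<triangle> X)(Y) = \<gamma>(Y) X - \<langle>X,Y\<rangle> \<gamma>\<close> for a 1-form \<open>\<gamma>\<close>.\<close>

definition tri :: "'b weyl_data \<Rightarrow> 'b chart \<Rightarrow> real^3 \<Rightarrow> real^3 \<Rightarrow> real^3 \<Rightarrow> real^3 \<Rightarrow> real^3" where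
  "tri B a x \<gamma> X Y = (\<gamma> \<bullet> Y) *\<^sub>R X - cinner B a x X Y *\<^sub>R sharp B a x \<gamma>"

text \<open>
  The decomposition \<open>R\<^bsub>X,Y\<^esub> = - r(X) \<triangle> Y + r(Y) \<triangle> X\<close> with
  \<open>r = r\<^sub>0 + (1/12) scal id - (1/2) F\<close> and \<open>r\<^sub>0\<close> symmetric trace-free, in terms of bilinear forms.
  In dimension three the curvature determines \<open>r\<close>, and by the first Bianchi identity its skew part
  is \<open>- F/2\<close>; so \<open>r0\<close> and \<open>s\<close> exist and are unique at every point of a Weyl space.
\<close>

definition curv_parts :: "'b weyl_data \<Rightarrow> 'b chart \<Rightarrow> real^3 \<Rightarrow> real^3^3 \<Rightarrow> real \<Rightarrow> bool" where
  "curv_parts B a x r0 s \<longleftrightarrow>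
     transpose r0 = r0 \<and> trace (endo B a x r0) = 0 \<and>
     (let r = r0 + (s / 12) *\<^sub>R conf B a x - (1/2) *\<^sub>R F_curv B a x in
      \<forall>i j Y. R_curv B a x i j *v Y =
        - tri B a x (axis i 1 v* r) (axis j 1) Y + tri B a x (axis j 1 v* r) (axis i 1) Y)"

definition scal :: "'b weyl_data \<Rightarrow> ('b, real) field" where
  "scal B a x = (THE s. \<exists>r0. curv_parts B a x r0 s)"

definition r0_curv :: "'b weyl_data \<Rightarrow> ('b, real^3^3) field" where
  "r0_curv B a x = (THE r0. \<exists>s. curv_parts B a x r0 s)"

definition einstein_weyl :: "'b weyl_data \<Rightarrow> bool" where
  "einstein_weyl B \<longleftrightarrow> (\<forall>a\<in>charts B. \<forall>x\<in>coords a. r0_curv B a x = 0)"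


section \<open>Shear-free geodesic congruences\<close>

definition congruence :: "'b weyl_data \<Rightarrow> ('b, real^3) field \<Rightarrow> bool" where
  "congruence B X \<longleftrightarrow> vector_section B (-1) X \<and>
     (\<forall>a\<in>charts B. \<forall>x\<in>coords a. cinner B a x (X a x) (X a x) = 1)"

definition geodesic :: "'b weyl_data \<Rightarrow> ('b, real^3) field \<Rightarrow> bool" where
  "geodesic B X \<longleftrightarrow> (\<forall>a\<in>charts B. \<forall>x\<in>coords a. D_vec B (-1) X a x *v X a x = 0)"

text \<open>The endomorphism sending \<open>u\<close> to \<open>\<langle>X,u\<rangle> X\<close>.\<close>

definition tensor_sq :: "'b weyl_data \<Rightarrow> ('b, real^3) field \<Rightarrow> ('b, real^3^3) field" where
  "tensor_sq B X a x = (\<chi> k i. X a x $ k * flat B a x (X a x) $ i)"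

text \<open>\<open>t\<close> is the trace of the endomorphism induced by the derivative of \<open>X\<close> on the orthogonal
  complement of \<open>X\<close>, which has rank two.\<close>

definition shear_free :: "'b weyl_data \<Rightarrow> ('b, real^3) field \<Rightarrow> bool" where
  "shear_free B X \<longleftrightarrow> (\<forall>a\<in>charts B. \<forall>x\<in>coords a.
     let M = D_vec B (-1) X a x; P = mat 1 - tensor_sq B X a x; t = trace (P ** M ** P) in
     \<forall>u v. cinner B a x (X a x) u = 0 \<and> cinner B a x (X a x) v = 0 \<longrightarrow>
       (cinner B a x (M *v u) v + cinner B a x (M *v v) u) / 2 - (t / 2) * cinner B a x u v = 0)"

definition star_vec :: "'b weyl_data \<Rightarrow> ('b, real^3) field \<Rightarrow> ('b, real^3^3) field" where
  "star_vec B X a x = star1 B a x (flat B a x (X a x))"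

definition div_twist_eq :: "'b weyl_data \<Rightarrow> ('b, real^3) field \<Rightarrow>
    ('b, real) field \<Rightarrow> ('b, real) field \<Rightarrow> bool" where
  "div_twist_eq B X \<tau> \<kappa> \<longleftrightarrow> (\<forall>a\<in>charts B. \<forall>x\<in>coords a.
     D_vec B (-1) X a x
       = \<tau> a x *\<^sub>R (mat 1 - tensor_sq B X a x) + \<kappa> a x *\<^sub>R endo B a x (star_vec B X a x))"


section \<open>The special monopole equations\<close>

text \<open>The ordinary 1-form \<open>sX\<close>, for \<open>s\<close> a section of \<open>L\<^sup>-\<^sup>1\<close>.\<close>

definition one_form :: "'b weyl_data \<Rightarrow> ('b, real) field \<Rightarrow> ('b, real^3) field \<Rightarrow> ('b, real^3) field" where
  "one_form B s X a x = s a x *\<^sub>R flat B a x (X a x)"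

definition monopole1_rhs :: "'b weyl_data \<Rightarrow> ('b, real^3) field \<Rightarrow>
    ('b, real) field \<Rightarrow> ('b, real) field \<Rightarrow> ('b, real^3^3) field" where
  "monopole1_rhs B X \<tau> \<kappa> a x =
     - (1/2) *\<^sub>R star1 B a x (X a x v* F_curv B a x)
     - (1/6 * scal B a x) *\<^sub>R star_vec B X a x
     - ((\<tau> a x)\<^sup>2 + (\<kappa> a x)\<^sup>2) *\<^sub>R star_vec B X a x
     + ext_d (one_form B \<kappa> X a) x"

definition monopole2_rhs :: "'b weyl_data \<Rightarrow> ('b, real^3) field \<Rightarrow>
    ('b, real) field \<Rightarrow> ('b, real^3^3) field" where
  "monopole2_rhs B X \<tau> a x = (1/2) *\<^sub>R F_curv B a x - ext_d (one_form B \<tau> X a) x"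

definition monopole1 :: "'b weyl_data \<Rightarrow> ('b, real^3) field \<Rightarrow>
    ('b, real) field \<Rightarrow> ('b, real) field \<Rightarrow> bool" where
  "monopole1 B X \<tau> \<kappa> \<longleftrightarrow> (\<forall>a\<in>charts B. \<forall>x\<in>coords a.
     star1 B a x (D_dens B (-1) \<tau> a x) = monopole1_rhs B X \<tau> \<kappa> a x)"

definition monopole2 :: "'b weyl_data \<Rightarrow> ('b, real^3) field \<Rightarrow>
    ('b, real) field \<Rightarrow> ('b, real) field \<Rightarrow> bool" where
  "monopole2 B X \<tau> \<kappa> \<longleftrightarrow> (\<forall>a\<in>charts B. \<forall>x\<in>coords a.
     star1 B a x (D_dens B (-1) \<kappa> a x) = monopole2_rhs B X \<tau> a x)"

text \<open>\<open>v* F\<close> above is the contraction with the first argument of the 2-form; the pairing of a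
  vector with a 1-form is \<open>\<bullet>\<close>.\<close>


section \<open>The normalisation of the Hodge star\<close>

definition wedge :: "real^3 \<Rightarrow> real^3 \<Rightarrow> real^3^3" where
  "wedge \<alpha> \<beta> = (\<chi> i j. \<alpha> $ i * \<beta> $ j - \<alpha> $ j * \<beta> $ i)"

lemma star1_interior:
  "(v v* star1 B a x \<alpha>) \<bullet> w = orf B a x (sharp B a x \<alpha>) v w"
  by (simp add: star1_def orf_def inner_vec_def vector_matrix_mult_def sum_3 det_3 axis_def
      algebra_simps)

lemma wedge_congruence:
  "A ** wedge \<alpha> \<beta> ** transpose A = wedge (A *v \<alpha>) (A *v \<beta>)"
  by (simp add: vec_eq_iff wedge_def matrix_matrix_mult_def matrix_vector_mult_def transpose_def
      sum_3 algebra_simps)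

lemma star2_wedge:
  assumes "invertible (conf B a x)"
  shows "star2 B a x (wedge (flat B a x X) \<alpha>) = X v* star1 B a x \<alpha>"
proof -
  let ?G = "conf B a x"
  have "matrix_inv ?G *v flat B a x X = X"
    using assms someI_ex[of "\<lambda>A'. ?G ** A' = mat 1 \<and> A' ** ?G = mat 1"]
    by (simp add: flat_def matrix_vector_mul_assoc invertible_def matrix_inv_def)
  then have *: "matrix_inv ?G ** wedge (flat B a x X) \<alpha> ** transpose (matrix_inv ?G)
      = wedge X (sharp B a x \<alpha>)"
    by (simp add: wedge_congruence sharp_def)
  show ?thesis
    unfolding star2_def Let_def *
    by (simp add: vec_eq_iff forall_3 wedge_def star1_def orf_def vector_matrix_mult_def sum_3
        det_3 axis_def algebra_simps)
qed

end

theory Submission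
  imports Defs
begin

text \<open>
  \<^bold>\<open>Reduction to vector algebra.\<close> All assertions are local, so they are proved in one chart. There the
  Cholesky factor \<open>P\<close> of the conformal metric is a smooth orthonormal trivialisation of
  \<open>L\<^sup>-\<^sup>1TB\<close> by Euclidean \<open>\<real>\<^sup>3\<close>. The coordinate fields become vectors \<open>\<theta> j\<close>, the metric connection
  becomes the cross product with vectors \<open>a i\<close>, and every 2-form \<open>\<psi>\<close> becomes a vector \<open>q\<close> with
  \<open>\<psi> i j = q \<bullet> (\<theta> i \<times> \<theta> j)\<close>; the Hodge star of a 1-form is then the same vector. The curvature of
  \<open>L\<^sup>-\<^sup>1TB\<close> is the cross product with
  \<open>\<Omega> S = Q S - (scal/6) S + (1/2) \<phi> \<times> S\<close>, where \<open>S = \<theta> i \<times> \<theta> j\<close>, \<open>\<phi>\<close> represents \<open>F\<^sup>B\<close>, and \<open>Q\<close> is the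
  endomorphism \<open>r\<^sub>0\<close>: that the skew part is determined by \<open>F\<^sup>B\<close> is the first Bianchi identity
  (\<open>curvature_parts_exists\<close>, \<open>curv_parts_coframe\<close>).

  \<^bold>\<open>The equivalence.\<close> Let \<open>V\<close> be the congruence in the coframe and let \<open>t\<close>, \<open>k\<close> be the gradients of \<open>\<tau>\<close>, \<open>\<kappa>\<close>.
  Differentiating the formula for \<open>D\<^sup>B\<chi>\<close> and skew-symmetrising gives \<open>\<Omega> S \<times> V\<close> in terms of \<open>t\<close>, \<open>k\<close>,
  \<open>\<tau>\<close>, \<open>\<kappa>\<close> (\<open>ricci_congruence_area\<close>). Put
  \<open>c = V \<bullet> t + \<tau>\<^sup>2 - \<kappa>\<^sup>2 + scal/6\<close> and \<open>m = k - (1/2) \<phi> + t \<times> V + 2 \<tau> \<kappa> V\<close>. Reading off components in an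
  orthonormal basis that contains \<open>V\<close> yields \<open>V \<bullet> m = 0\<close>, \<open>m = - (Q V) \<times> V\<close>, and \<open>Q S \<bullet> S = c\<close>,
  \<open>Q S \<bullet> (V \<times> S) = 0\<close> for unit \<open>S\<close> orthogonal to \<open>V\<close>. As \<open>Q\<close> is symmetric and trace-free, \<open>Q = 0\<close> if and only if
  \<open>c = 0\<close> and \<open>m = 0\<close> (\<open>congruence_curvature\<close>). The second monopole equation is \<open>m = 0\<close> and the first
  is \<open>c V = m \<times> V\<close>, which is equivalent to \<open>c = 0\<close> and \<open>m = 0\<close> because \<open>m\<close> is orthogonal to \<open>V\<close>. The
  divergence equation is \<open>c = 0\<close>, and the twist equation is the identity \<open>V \<bullet> m = 0\<close>.

  \<^bold>\<open>Closedness.\<close> In the chart the right hand side of the second equation is the differential of a 1-form. For the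
  first one the term \<open>d(\<kappa>\<chi>)\<close> is removed; the exterior derivative of what remains consists
  of derivatives of curvature, which cancel by the second Bianchi identity with \<open>Q = 0\<close> contracted with
  \<open>V\<close>, and of terms of first order, which cancel by \<open>c = 0\<close> and \<open>V \<bullet> m = 0\<close> (\<open>monopole1_closed\<close>).
\<close>

section \<open>Calculus of smooth functions in coordinates\<close>

lemma pd_eq: "(f has_derivative f') (at x) \<Longrightarrow> pd i f x = f' (axis i 1)"
  by (simp add: pd_def frechet_derivative_at[symmetric])

lemma pd_cong_open:
  assumes "open S" "x \<in> S" "\<And>y. y \<in> S \<Longrightarrow> f y = g y"
  shows "pd i f x = pd i g x"
proof -
  have "(f has_derivative f') (at x) \<longleftrightarrow> (g has_derivative f') (at x)" for f'
    using assms has_derivative_transform_within_open[of f f' x UNIV S g]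
      has_derivative_transform_within_open[of g f' x UNIV S f] by auto
  then show ?thesis by (simp add: pd_def frechet_derivative_def)
qed

lemma differentiable_cong_open:
  assumes "open S" "x \<in> S" "\<And>y. y \<in> S \<Longrightarrow> f y = g y" "g differentiable (at x)"
  shows "f differentiable (at x)"
  using assms has_derivative_transform_within_open[of g _ x UNIV S f]
  unfolding differentiable_def by metis

lemma pd_const [simp]: "pd i (\<lambda>x. c) x = 0"
  by (rule pd_eq[where f'="\<lambda>_. 0", simplified]) simp

lemma pd_linear:
  assumes "bounded_linear h" "f differentiable (at x)"
  shows "pd i (\<lambda>x. h (f x)) x = h (pd i f x)"
  using pd_eq[OF bounded_linear.has_derivative[OF assms(1) assms(2)[unfolded frechet_derivative_works]]]
  by (simp add: pd_def)

lemma pd_bilinear: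
  assumes "bounded_bilinear h" "f differentiable (at x)" "g differentiable (at x)"
  shows "pd i (\<lambda>x. h (f x) (g x)) x = h (f x) (pd i g x) + h (pd i f x) (g x)"
  using pd_eq[OF bounded_bilinear.FDERIV[OF assms(1) assms(2,3)[unfolded frechet_derivative_works]]]
  by (simp add: pd_def)

lemma differentiable_bilinear:
  assumes "bounded_bilinear h" "f differentiable (at x)" "g differentiable (at x)"
  shows "(\<lambda>x. h (f x) (g x)) differentiable (at x)"
  using bounded_bilinear.FDERIV[OF assms(1) assms(2,3)[unfolded frechet_derivative_works]]
  unfolding differentiable_def by blast

lemma differentiable_linear:
  assumes "bounded_linear h" "f differentiable (at x)"
  shows "(\<lambda>x. h (f x)) differentiable (at x)"
  using bounded_linear.has_derivative[OF assms(1) assms(2)[unfolded frechet_derivative_works]]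
  unfolding differentiable_def by blast

lemma pd_add:
  assumes "f differentiable (at x)" "g differentiable (at x)"
  shows "pd i (\<lambda>x. f x + g x) x = pd i f x + pd i g x"
  using pd_eq[OF has_derivative_add[OF assms[unfolded frechet_derivative_works]]]
  by (simp add: pd_def)

lemma pd_diff:
  assumes "f differentiable (at x)" "g differentiable (at x)"
  shows "pd i (\<lambda>x. f x - g x) x = pd i f x - pd i g x"
  using pd_eq[OF has_derivative_diff[OF assms[unfolded frechet_derivative_works]]]
  by (simp add: pd_def)

lemma pd_minus:
  assumes "f differentiable (at x)"
  shows "pd i (\<lambda>x. - f x) x = - pd i f x"
  using pd_linear[OF bounded_linear_minus[OF bounded_linear_ident] assms] by simp

lemma C_k_on_cong:
  assumes "open S" "\<And>y. y \<in> S \<Longrightarrow> f y = g y"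
  shows "C_k_on k S f \<longleftrightarrow> C_k_on k S g"
  using assms(2)
proof (induction k arbitrary: f g)
  case 0
  then show ?case by (simp cong: continuous_on_cong)
next
  case (Suc k)
  have "C_k_on k S (pd i f) \<longleftrightarrow> C_k_on k S (pd i g)" for i
    by (intro Suc.IH pd_cong_open[OF assms(1)] Suc.prems)
  moreover have "f differentiable (at x) \<longleftrightarrow> g differentiable (at x)" if "x \<in> S" for x
    using differentiable_cong_open[OF assms(1) that, of f g]
      differentiable_cong_open[OF assms(1) that, of g f] Suc.prems by auto
  ultimately show ?case by simp
qed

lemma C_k_on_Suc_imp: "C_k_on (Suc k) S f \<Longrightarrow> C_k_on k S f"
proof (induction k arbitrary: f)
  case 0
  then show ?case
    by (simp add: continuous_at_imp_continuous_on differentiable_imp_continuous_within)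
next
  case (Suc k)
  then show ?case by (metis C_k_on.simps(2))
qed

lemma C_k_on_subset: "C_k_on k S f \<Longrightarrow> T \<subseteq> S \<Longrightarrow> C_k_on k T f"
  by (induction k arbitrary: f) (auto intro: continuous_on_subset)

lemma C_k_on_const: "C_k_on k S (\<lambda>x. c)"
proof (induction k arbitrary: c)
  case (Suc k)
  have "pd i (\<lambda>x. c) = (\<lambda>x. 0)" for i by (rule ext) simp
  with Suc show ?case by simp
qed simp

lemma C_k_on_add:
  assumes "open S" "C_k_on k S f" "C_k_on k S g"
  shows "C_k_on k S (\<lambda>x. f x + g x)"
  using assms(2,3)
proof (induction k arbitrary: f g)
  case 0
  then show ?case by (simp add: continuous_on_add)
next
  case (Suc k)
  have "C_k_on k S (pd i (\<lambda>x. f x + g x)) \<longleftrightarrow> C_k_on k S (\<lambda>x. pd i f x + pd i g x)" for i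
    using Suc.prems by (intro C_k_on_cong assms(1)) (simp add: pd_add)
  with Suc show ?case by simp
qed

lemma C_k_on_linear:
  assumes "open S" "bounded_linear h" "C_k_on k S f"
  shows "C_k_on k S (\<lambda>x. h (f x))"
  using assms(3)
proof (induction k arbitrary: f)
  case 0
  then show ?case using bounded_linear.continuous_on[OF assms(2)] by simp
next
  case (Suc k)
  have "C_k_on k S (pd i (\<lambda>x. h (f x))) \<longleftrightarrow> C_k_on k S (\<lambda>x. h (pd i f x))" for i
    using Suc.prems by (intro C_k_on_cong assms(1)) (simp add: pd_linear assms(2))
  with Suc show ?case by (simp add: differentiable_linear assms(2))
qed

lemma C_k_on_bilinear:
  assumes "open S" "bounded_bilinear h" "C_k_on k S f" "C_k_on k S g"
  shows "C_k_on k S (\<lambda>x. h (f x) (g x))"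
  using assms(3,4)
proof (induction k arbitrary: f g)
  case 0
  then show ?case using bounded_bilinear.continuous_on[OF assms(2)] by simp
next
  case (Suc k)
  have "C_k_on k S (pd i (\<lambda>x. h (f x) (g x)))
      \<longleftrightarrow> C_k_on k S (\<lambda>x. h (f x) (pd i g x) + h (pd i f x) (g x))" for i
    using Suc.prems by (intro C_k_on_cong assms(1)) (simp add: pd_bilinear assms(2))
  moreover have "C_k_on k S (\<lambda>x. h (f x) (pd i g x) + h (pd i f x) (g x))" for i
    using Suc.prems C_k_on_Suc_imp[OF Suc.prems(1)] C_k_on_Suc_imp[OF Suc.prems(2)]
    by (intro C_k_on_add assms(1) Suc.IH) auto
  ultimately show ?case using Suc.prems by (simp add: differentiable_bilinear assms(2))
qed

text \<open>The derivatives of the reciprocal and of the square root of \<open>f\<close> are products of \<open>pd i f\<close> with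
  expressions in that same reciprocal or square root. Hence the induction on the order of
  differentiability needs only the stability of \<open>C_k_on k\<close> under products and, for the square root,
  under reciprocals.\<close>

lemma C_k_on_inverse:
  fixes f :: "real^3 \<Rightarrow> real"
  assumes "open S" "C_k_on k S f" "\<And>x. x \<in> S \<Longrightarrow> f x \<noteq> 0"
  shows "C_k_on k S (\<lambda>x. inverse (f x))"
  using assms(2)
proof (induction k)
  case 0
  then show ?case by (simp add: continuous_on_inverse assms(3))
next
  case (Suc k)
  have der: "((\<lambda>x. inverse (f x)) has_derivative
      (\<lambda>u. - (inverse (f x) * frechet_derivative f (at x) u * inverse (f x)))) (at x)"
    if "x \<in> S" for x
    using that Suc.prems assms(3) frechet_derivative_works
    by (intro Deriv.has_derivative_inverse) auto
  have "C_k_on k S (pd i (\<lambda>x. inverse (f x)))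
      \<longleftrightarrow> C_k_on k S (\<lambda>x. - (inverse (f x) * pd i f x * inverse (f x)))" for i
    using pd_eq[OF der] by (intro C_k_on_cong assms(1)) (simp add: pd_def)
  moreover have "C_k_on k S (\<lambda>x. - (inverse (f x) * pd i f x * inverse (f x)))" for i
    using Suc C_k_on_Suc_imp[OF Suc.prems]
    by (intro C_k_on_linear[OF _ bounded_linear_minus[OF bounded_linear_ident]]
        C_k_on_bilinear[OF _ bounded_bilinear_mult] assms(1)) auto
  ultimately show ?case using der unfolding C_k_on.simps differentiable_def by blast
qed

lemma C_k_on_sqrt:
  fixes f :: "real^3 \<Rightarrow> real"
  assumes "open S" "C_k_on k S f" "\<And>x. x \<in> S \<Longrightarrow> f x > 0"
  shows "C_k_on k S (\<lambda>x. sqrt (f x))"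
  using assms(2)
proof (induction k)
  case 0
  then show ?case by (simp add: continuous_on_real_sqrt)
next
  case (Suc k)
  have der: "((\<lambda>x. sqrt (f x)) has_derivative
      (\<lambda>u. frechet_derivative f (at x) u * (inverse (sqrt (f x)) / 2))) (at x)"
    if "x \<in> S" for x
    using that Suc.prems assms(3) frechet_derivative_works
    by (auto intro!: derivative_eq_intros simp: field_simps)
  have "C_k_on k S (pd i (\<lambda>x. sqrt (f x)))
      \<longleftrightarrow> C_k_on k S (\<lambda>x. pd i f x * (inverse (sqrt (f x)) / 2))" for i
    using pd_eq[OF der] by (intro C_k_on_cong assms(1)) (simp add: pd_def)
  moreover have "C_k_on k S (\<lambda>x. pd i f x * (inverse (sqrt (f x)) / 2))" for i
  proof -
    have "C_k_on k S (\<lambda>x. inverse (sqrt (f x)))"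
      using assms(3) Suc.IH[OF C_k_on_Suc_imp[OF Suc.prems]]
      by (intro C_k_on_inverse assms(1)) force+
    then show ?thesis
      using Suc.prems
      by (intro C_k_on_bilinear[OF _ bounded_bilinear_mult]
          C_k_on_linear[OF _ bounded_linear_divide] assms(1)) auto
  qed
  ultimately show ?case using der unfolding C_k_on.simps differentiable_def by blast
qed

lemma smooth_on_differentiable: "smooth_on S f \<Longrightarrow> x \<in> S \<Longrightarrow> f differentiable (at x)"
  unfolding smooth_on_def using C_k_on.simps(2) by blast

lemma smooth_on_pd: "smooth_on S f \<Longrightarrow> smooth_on S (pd i f)"
  unfolding smooth_on_def using C_k_on.simps(2) by blast

lemma smooth_on_const: "smooth_on S (\<lambda>x. c)"
  by (simp add: smooth_on_def C_k_on_const)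

context
  fixes S :: "(real^3) set"
  assumes S: "open S"
begin

lemma smooth_on_cong: "(\<And>y. y \<in> S \<Longrightarrow> f y = g y) \<Longrightarrow> smooth_on S g \<Longrightarrow> smooth_on S f"
  unfolding smooth_on_def using C_k_on_cong[OF S] by blast

lemma smooth_on_add: "smooth_on S f \<Longrightarrow> smooth_on S g \<Longrightarrow> smooth_on S (\<lambda>x. f x + g x)"
  by (simp add: smooth_on_def C_k_on_add S)

lemma smooth_on_linear: "bounded_linear h \<Longrightarrow> smooth_on S f \<Longrightarrow> smooth_on S (\<lambda>x. h (f x))"
  by (simp add: smooth_on_def C_k_on_linear S)

lemma smooth_on_bilinear:
  "bounded_bilinear h \<Longrightarrow> smooth_on S f \<Longrightarrow> smooth_on S g \<Longrightarrow> smooth_on S (\<lambda>x. h (f x) (g x))"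
  by (simp add: smooth_on_def C_k_on_bilinear S)

lemma smooth_on_minus: "smooth_on S f \<Longrightarrow> smooth_on S (\<lambda>x. - f x)"
  by (rule smooth_on_linear[OF bounded_linear_minus[OF bounded_linear_ident]])

lemma smooth_on_diff: "smooth_on S f \<Longrightarrow> smooth_on S g \<Longrightarrow> smooth_on S (\<lambda>x. f x - g x)"
  using smooth_on_add[of f "\<lambda>x. - g x"] smooth_on_minus[of g] by simp

lemma smooth_on_inverse:
  "smooth_on S (f :: real^3 \<Rightarrow> real) \<Longrightarrow> (\<And>x. x \<in> S \<Longrightarrow> f x \<noteq> 0) \<Longrightarrow> smooth_on S (\<lambda>x. inverse (f x))"
  by (simp add: smooth_on_def C_k_on_inverse S)

lemma smooth_on_sqrt:
  "smooth_on S f \<Longrightarrow> (\<And>x. x \<in> S \<Longrightarrow> f x > 0) \<Longrightarrow> smooth_on S (\<lambda>x. sqrt (f x))"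
  by (simp add: smooth_on_def C_k_on_sqrt S)

lemma smooth_on_mult:
  "smooth_on S (f :: real^3 \<Rightarrow> real) \<Longrightarrow> smooth_on S g \<Longrightarrow> smooth_on S (\<lambda>x. f x * g x)"
  by (rule smooth_on_bilinear[OF bounded_bilinear_mult])

lemma smooth_on_divide:
  "smooth_on S (f :: real^3 \<Rightarrow> real) \<Longrightarrow> smooth_on S g \<Longrightarrow> (\<And>x. x \<in> S \<Longrightarrow> g x \<noteq> 0) \<Longrightarrow>
    smooth_on S (\<lambda>x. f x / g x)"
  unfolding divide_inverse by (intro smooth_on_mult smooth_on_inverse)

lemma smooth_on_scaleR: "smooth_on S f \<Longrightarrow> smooth_on S g \<Longrightarrow> smooth_on S (\<lambda>x. f x *\<^sub>R g x)"
  by (rule smooth_on_bilinear[OF bounded_bilinear_scaleR])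

lemma smooth_on_inner: "smooth_on S f \<Longrightarrow> smooth_on S g \<Longrightarrow> smooth_on S (\<lambda>x. f x \<bullet> g x)"
  by (rule smooth_on_bilinear[OF bounded_bilinear_inner])

lemma smooth_on_nth: "smooth_on S f \<Longrightarrow> smooth_on S (\<lambda>x. f x $ i)"
  by (rule smooth_on_linear[OF bounded_linear_vec_nth])

lemma smooth_on_sum:
  "(\<And>j. j \<in> I \<Longrightarrow> smooth_on S (f j)) \<Longrightarrow> smooth_on S (\<lambda>x. \<Sum>j\<in>I. f j x)"
  by (induction I rule: infinite_finite_induct) (auto intro: smooth_on_const smooth_on_add)

end

lemma vec_eq_sum_axis: "v = (\<Sum>j\<in>UNIV. axis j (v $ j))" for v :: "'a::real_normed_vector^'n"
  by (auto simp: vec_eq_iff axis_def if_distrib cong: if_cong)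

lemma bounded_linear_axis: "bounded_linear (axis j :: 'a::real_normed_vector \<Rightarrow> 'a^'n)"
  by (rule bounded_linear_intro[where K=1])
    (auto simp: vec_eq_iff axis_def norm_vec_def L2_set_def if_distrib if_distribR
      power_0_left cong: if_cong)

lemma smooth_on_vec:
  fixes f :: "real^3 \<Rightarrow> 'a::real_normed_vector^'n"
  assumes "open S" "\<And>j. smooth_on S (\<lambda>x. f x $ j)"
  shows "smooth_on S f"
proof -
  have "smooth_on S (\<lambda>x. \<Sum>j\<in>UNIV. axis j (f x $ j) :: 'a^'n)"
    by (intro smooth_on_sum smooth_on_linear[OF _ bounded_linear_axis] assms)
  then show ?thesis by (simp flip: vec_eq_sum_axis)
qed

lemma pd_nth: "f differentiable (at x) \<Longrightarrow> pd i (\<lambda>x. f x $ j) x = pd i f x $ j"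
  by (rule pd_linear[OF bounded_linear_vec_nth])

text \<open>Mixed partial derivatives commute: the second difference quotient of \<open>f\<close> over a small square
  equals, by two applications of the mean value theorem, a value of either mixed derivative near
  the corner, and both are continuous.\<close>

lemma mixed_difference:
  fixes f :: "real^3 \<Rightarrow> real"
  assumes C: "C_k_on 2 (ball x r) f" and h: "0 < h" "2 * h < r"
  shows "\<exists>s t. 0 < s \<and> s < h \<and> 0 < t \<and> t < h \<and>
    f (x + h *\<^sub>R axis i 1 + h *\<^sub>R axis j 1) - f (x + h *\<^sub>R axis i 1) - f (x + h *\<^sub>R axis j 1) + f x
      = h * h * pd j (pd i f) (x + s *\<^sub>R axis i 1 + t *\<^sub>R axis j 1)"
proof -
  let ?e = "\<lambda>k. axis k (1::real) :: real^3"
  have in_ball: "x + s *\<^sub>R ?e i + t *\<^sub>R ?e j \<in> ball x r" if "0 \<le> s" "s \<le> h" "0 \<le> t" "t \<le> h" for s t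
  proof -
    have "norm (s *\<^sub>R ?e i + t *\<^sub>R ?e j) \<le> s + t"
      using that norm_triangle_ineq[of "s *\<^sub>R ?e i" "t *\<^sub>R ?e j"] by simp
    then show ?thesis using that h by (simp add: dist_norm add.assoc flip: norm_minus_cancel[of "s *\<^sub>R ?e i + _"])
  qed
  have diff: "g differentiable (at y)" if "y \<in> ball x r" "g = f \<or> g = pd i f" for y g
    using C that by (auto simp: numeral_2_eq_2)
  have line: "((\<lambda>s. g (p + s *\<^sub>R ?e k)) has_real_derivative pd k g (p + s *\<^sub>R ?e k)) (at s)"
    if "g differentiable (at (p + s *\<^sub>R ?e k))" for g :: "real^3 \<Rightarrow> real" and p s k
  proof -
    have g: "(g has_derivative frechet_derivative g (at (p + s *\<^sub>R ?e k))) (at (p + s *\<^sub>R ?e k))"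
      using that by (simp add: frechet_derivative_works)
    have "((\<lambda>s. g (p + s *\<^sub>R ?e k)) has_derivative
        (\<lambda>u. frechet_derivative g (at (p + s *\<^sub>R ?e k)) (u *\<^sub>R ?e k))) (at s)"
      by (rule has_derivative_compose[where f="\<lambda>s. p + s *\<^sub>R ?e k" and g=g, OF _ g]) (auto intro!: derivative_eq_intros)
    then show ?thesis
      by (simp add: has_field_derivative_def pd_def linear_cmul[OF linear_frechet_derivative[OF that]] mult_commute_abs)
  qed
  define \<phi> where "\<phi> s = f (x + h *\<^sub>R ?e j + s *\<^sub>R ?e i) - f (x + s *\<^sub>R ?e i)" for s
  have d\<phi>: "(\<phi> has_real_derivative
      pd i f (x + h *\<^sub>R ?e j + s *\<^sub>R ?e i) - pd i f (x + s *\<^sub>R ?e i)) (at s)" if "0 \<le> s" "s \<le> h" for s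
    unfolding \<phi>_def using that h in_ball[of s h] in_ball[of s 0]
    by (intro DERIV_diff line diff) (auto simp: algebra_simps)
  then obtain s where s: "0 < s" "s < h"
    and \<phi>: "\<phi> h - \<phi> 0 = h * (pd i f (x + h *\<^sub>R ?e j + s *\<^sub>R ?e i) - pd i f (x + s *\<^sub>R ?e i))"
    using MVT2[OF h(1) d\<phi>] by auto
  have dp: "((\<lambda>t. pd i f (x + s *\<^sub>R ?e i + t *\<^sub>R ?e j)) has_real_derivative
      pd j (pd i f) (x + s *\<^sub>R ?e i + t *\<^sub>R ?e j)) (at t)" if "0 \<le> t" "t \<le> h" for t
    using that s in_ball[of s t] by (intro line diff) auto
  then obtain t where t: "0 < t" "t < h" and
    "pd i f (x + s *\<^sub>R ?e i + h *\<^sub>R ?e j) - pd i f (x + s *\<^sub>R ?e i)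
      = h * pd j (pd i f) (x + s *\<^sub>R ?e i + t *\<^sub>R ?e j)"
    using MVT2[OF h(1) dp] by auto
  then have "\<phi> h - \<phi> 0 = h * (h * pd j (pd i f) (x + s *\<^sub>R ?e i + t *\<^sub>R ?e j))"
    using \<phi> by (simp add: algebra_simps)
  then show ?thesis
    using s t by (intro exI[of _ s] exI[of _ t]) (simp add: \<phi>_def algebra_simps)
qed

lemma pd_commute_real:
  fixes f :: "real^3 \<Rightarrow> real"
  assumes "open S" "x \<in> S" "C_k_on 2 S f"
  shows "pd i (pd j f) x = pd j (pd i f) x"
proof (rule ccontr)
  assume ne: "pd i (pd j f) x \<noteq> pd j (pd i f) x"
  define d where "d = \<bar>pd i (pd j f) x - pd j (pd i f) x\<bar> / 2"
  have "d > 0" using ne by (simp add: d_def)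
  have cont: "continuous_on S (pd k (pd l f))" for k l
    using assms(3) by (simp add: numeral_2_eq_2)
  have near: "\<exists>r>0. \<forall>y. dist y x < r \<longrightarrow> dist (pd k (pd l f) y) (pd k (pd l f) x) < d" for k l
  proof -
    have "isCont (pd k (pd l f)) x"
      using cont[of k l] assms(1,2) by (simp add: continuous_on_eq_continuous_at)
    then show ?thesis using \<open>d > 0\<close> by (simp add: continuous_at_eps_delta dist_commute)
  qed
  obtain r1 where r1: "r1 > 0" "\<And>y. dist y x < r1 \<Longrightarrow> dist (pd i (pd j f) y) (pd i (pd j f) x) < d"
    using near by blast
  obtain r2 where r2: "r2 > 0" "\<And>y. dist y x < r2 \<Longrightarrow> dist (pd j (pd i f) y) (pd j (pd i f) x) < d"
    using near by blast
  obtain r3 where r3: "r3 > 0" "ball x r3 \<subseteq> S" using assms(1,2) open_contains_ball by blast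
  have C: "C_k_on 2 (ball x r3) f"
    using assms(3) r3(2) by (rule C_k_on_subset)
  define h where "h = min (min r1 r2) r3 / 4"
  have h: "0 < h" "2 * h < r1" "2 * h < r2" "2 * h < r3" using r1(1) r2(1) r3(1) by (auto simp: h_def)
  have small: "dist (x + s *\<^sub>R axis k 1 + t *\<^sub>R axis l 1) x < 2 * h"
    if "0 < s" "s < h" "0 < t" "t < h" for s t and k l :: 3
    using that norm_triangle_ineq[of "s *\<^sub>R axis k (1::real)" "t *\<^sub>R axis l (1::real)"]
    by (simp add: dist_norm add.assoc)
  obtain s t where st: "0 < s" "s < h" "0 < t" "t < h" and 1:
    "f (x + h *\<^sub>R axis i 1 + h *\<^sub>R axis j 1) - f (x + h *\<^sub>R axis i 1) - f (x + h *\<^sub>R axis j 1) + f x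
      = h * h * pd j (pd i f) (x + s *\<^sub>R axis i 1 + t *\<^sub>R axis j 1)"
    using mixed_difference[OF C h(1,4), of i j] by blast
  obtain s' t' where st': "0 < s'" "s' < h" "0 < t'" "t' < h" and 2:
    "f (x + h *\<^sub>R axis j 1 + h *\<^sub>R axis i 1) - f (x + h *\<^sub>R axis j 1) - f (x + h *\<^sub>R axis i 1) + f x
      = h * h * pd i (pd j f) (x + s' *\<^sub>R axis j 1 + t' *\<^sub>R axis i 1)"
    using mixed_difference[OF C h(1,4), of j i] by blast
  have swap: "x + h *\<^sub>R axis i 1 + h *\<^sub>R axis j 1 = x + h *\<^sub>R axis j 1 + h *\<^sub>R axis i 1"
    by (simp add: algebra_simps)
  have "h * h * pd j (pd i f) (x + s *\<^sub>R axis i 1 + t *\<^sub>R axis j 1)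
      = h * h * pd i (pd j f) (x + s' *\<^sub>R axis j 1 + t' *\<^sub>R axis i 1)"
    using 1[unfolded swap] 2 by linarith
  then have "pd j (pd i f) (x + s *\<^sub>R axis i 1 + t *\<^sub>R axis j 1)
      = pd i (pd j f) (x + s' *\<^sub>R axis j 1 + t' *\<^sub>R axis i 1)"
    using h(1) by simp
  moreover have "dist (pd j (pd i f) (x + s *\<^sub>R axis i 1 + t *\<^sub>R axis j 1)) (pd j (pd i f) x) < d"
    using small[OF st, of i j] h by (intro r2) linarith
  moreover have "dist (pd i (pd j f) (x + s' *\<^sub>R axis j 1 + t' *\<^sub>R axis i 1)) (pd i (pd j f) x) < d"
    using small[OF st', of j i] h by (intro r1) linarith
  ultimately show False
    unfolding d_def dist_real_def by argo
qed

lemma pd_commute: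
  fixes f :: "real^3 \<Rightarrow> 'v::euclidean_space"
  assumes "open S" "x \<in> S" "smooth_on S f"
  shows "pd i (pd j f) x = pd j (pd i f) x"
proof (rule euclidean_eqI)
  fix b :: 'v assume "b \<in> Basis"
  have lin: "bounded_linear (\<lambda>v::'v. v \<bullet> b)" by (rule bounded_linear_inner_left)
  have sm: "smooth_on S (\<lambda>y. f y \<bullet> b)" by (rule smooth_on_linear[OF assms(1) lin assms(3)])
  have "pd k (pd l (\<lambda>y. f y \<bullet> b)) x = pd k (pd l f) x \<bullet> b" for k l
  proof -
    have "pd k (pd l (\<lambda>y. f y \<bullet> b)) x = pd k (\<lambda>y. pd l f y \<bullet> b) x"
      using assms smooth_on_differentiable by (intro pd_cong_open[OF assms(1,2)] pd_linear[OF lin]) blast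
    also have "\<dots> = pd k (pd l f) x \<bullet> b"
      using assms smooth_on_differentiable smooth_on_pd by (intro pd_linear[OF lin]) blast
    finally show ?thesis .
  qed
  moreover have "pd i (pd j (\<lambda>y. f y \<bullet> b)) x = pd j (pd i (\<lambda>y. f y \<bullet> b)) x"
    using sm by (intro pd_commute_real[OF assms(1,2)]) (simp add: smooth_on_def)
  ultimately show "pd i (pd j f) x \<bullet> b = pd j (pd i f) x \<bullet> b" by simp
qed

lemma pd_entry:
  fixes M :: "real^3 \<Rightarrow> real^3^3"
  assumes "M differentiable (at x)"
  shows "pd i M x $ j $ k = pd i (\<lambda>y. M y $ j $ k) x"
proof -
  have "bounded_linear (\<lambda>M :: real^3^3. M $ j $ k)"
    by (rule bounded_linear_compose[OF bounded_linear_vec_nth bounded_linear_vec_nth])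
  from pd_linear[OF this assms] show ?thesis by simp
qed

lemma ext_d_closed:
  assumes "open S" "x \<in> S" "smooth_on S \<alpha>"
  shows "ext_d \<alpha> differentiable (at x)"
    and "pd i (ext_d \<alpha>) x $ j $ k + pd j (ext_d \<alpha>) x $ k $ i + pd k (ext_d \<alpha>) x $ i $ j = 0"
proof -
  note d = smooth_on_differentiable[OF smooth_on_pd[OF assms(3)] assms(2)]
  have sm: "smooth_on S (ext_d \<alpha>)"
    by (intro smooth_on_vec assms(1))
      (simp add: ext_d_def, intro smooth_on_diff smooth_on_nth smooth_on_pd assms)
  then show diff: "ext_d \<alpha> differentiable (at x)" using assms(2) smooth_on_differentiable by blast
  have e: "pd l (ext_d \<alpha>) x $ m $ n = pd l (pd m \<alpha>) x $ n - pd l (pd n \<alpha>) x $ m" for l m n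
    unfolding pd_entry[OF diff]
    by (simp add: ext_d_def pd_diff pd_nth d differentiable_linear[OF bounded_linear_vec_nth])
  have c: "pd l (pd m \<alpha>) x = pd m (pd l \<alpha>) x" for l m by (rule pd_commute[OF assms])
  show "pd i (ext_d \<alpha>) x $ j $ k + pd j (ext_d \<alpha>) x $ k $ i + pd k (ext_d \<alpha>) x $ i $ j = 0"
    unfolding e c[of j i] c[of k j] c[of i k] by simp
qed


unbundle cross3_syntax

section \<open>Vector algebra in three dimensions\<close>

lemmas coords3 = vec_eq_iff forall_3 cross_components inner_vec_def sum_3

lemma bounded_bilinear_cross3: "bounded_bilinear cross3"
  using bilinear_conv_bounded_bilinear bilinear_cross by blast

lemmas differentiable_cross3 = differentiable_bilinear[OF bounded_bilinear_cross3]
lemmas pd_cross3 = pd_bilinear[OF bounded_bilinear_cross3]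
lemmas pd_scaleR = pd_bilinear[OF bounded_bilinear_scaleR]
lemmas pd_inner = pd_bilinear[OF bounded_bilinear_inner]
lemmas pd_mult = pd_bilinear[OF bounded_bilinear_mult]
lemmas differentiable_inner = differentiable_bilinear[OF bounded_bilinear_inner]
lemmas smooth_on_cross3 = smooth_on_bilinear[OF _ bounded_bilinear_cross3]

lemma cross_cross: "(a \<times> b) \<times> c = (a \<bullet> c) *\<^sub>R b - (b \<bullet> c) *\<^sub>R a"
  by (simp add: coords3 algebra_simps)

lemma inner_cross_cross: "(a \<times> b) \<bullet> (c \<times> d) = (a \<bullet> c) * (b \<bullet> d) - (a \<bullet> d) * (b \<bullet> c)"
  by (simp add: coords3 algebra_simps)

lemma cross_all_eq_0: "(\<And>y. u \<times> y = 0) \<Longrightarrow> u = 0"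
  using cross_basis_nonzero by blast

text \<open>Cramer's rule for the basis \<open>p\<close>, \<open>q\<close>, \<open>r\<close>: up to the factor \<open>p \<bullet> (q \<times> r)\<close>, the cross products
  are its dual basis. The three identities replace sums over dual bases.\<close>

lemma frame_expand_cross:
  "(p \<bullet> v) *\<^sub>R (q \<times> r) + (q \<bullet> v) *\<^sub>R (r \<times> p) + (r \<bullet> v) *\<^sub>R (p \<times> q) = (p \<bullet> (q \<times> r)) *\<^sub>R v"
  by (simp add: coords3 algebra_simps)

lemma frame_expand:
  "((q \<times> r) \<bullet> v) *\<^sub>R p + ((r \<times> p) \<bullet> v) *\<^sub>R q + ((p \<times> q) \<bullet> v) *\<^sub>R r = (p \<bullet> (q \<times> r)) *\<^sub>R v"
  by (simp add: coords3 algebra_simps)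

lemma frame_contract:
  "(p \<bullet> v) * ((q \<times> r) \<bullet> w) + (q \<bullet> v) * ((r \<times> p) \<bullet> w) + (r \<bullet> v) * ((p \<times> q) \<bullet> w)
    = (p \<bullet> (q \<times> r)) * (v \<bullet> w)"
  by (simp add: coords3 algebra_simps)

text \<open>The derivation of \<open>\<Lambda>\<^sup>2\<real>\<^sup>3\<close> induced by \<open>M\<close>, after identifying \<open>\<Lambda>\<^sup>2\<real>\<^sup>3\<close> with \<open>\<real>\<^sup>3\<close>. For symmetric
  trace-free \<open>M\<close> it is \<open>- M\<close>, which is why \<open>r\<^sub>0\<close> acts on area vectors as an endomorphism.\<close>

lemma symmetric_area_map:
  "(M *v p) \<times> q + p \<times> (M *v q) = trace M *\<^sub>R (p \<times> q) - transpose M *v (p \<times> q)"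
  by (simp add: coords3 matrix_vector_mult_def transpose_def trace_def algebra_simps)

section \<open>Weyl connections in an orthonormal coframe\<close>

text \<open>
  In an orthonormal frame of \<open>L\<^sup>-\<^sup>1TB\<close> the coordinate fields become vectors \<open>\<theta> j\<close> in Euclidean
  \<open>\<real>\<^sup>3\<close>, the connection becomes a cross product with vectors \<open>a i\<close>, and 2-forms become vectors
  paired with the area vectors \<open>\<theta> i \<times> \<theta> j\<close>. The function \<open>w i\<close> is the connection form on \<open>L\<^sup>1\<close>;
  since the \<open>\<theta> j\<close> have weight 1, it enters the torsion equation.
\<close>

locale weyl_coframe =
  fixes U :: "(real^3) set" and \<theta> a :: "3 \<Rightarrow> real^3 \<Rightarrow> real^3" and w :: "3 \<Rightarrow> real^3 \<Rightarrow> real"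
  assumes U: "open U"
    and smooth_coframe: "\<And>j. smooth_on U (\<theta> j)"
    and smooth_conn: "\<And>i. smooth_on U (a i)"
    and smooth_weyl: "\<And>i. smooth_on U (w i)"
    and torsion: "\<And>x i j. x \<in> U \<Longrightarrow>
      pd i (\<theta> j) x + a i x \<times> \<theta> j x + w i x *\<^sub>R \<theta> j x
        = pd j (\<theta> i) x + a j x \<times> \<theta> i x + w j x *\<^sub>R \<theta> i x"
    and vol_pos: "\<And>x. x \<in> U \<Longrightarrow> \<theta> 1 x \<bullet> (\<theta> 2 x \<times> \<theta> 3 x) > 0"
begin

definition area :: "real^3 \<Rightarrow> 3 \<Rightarrow> 3 \<Rightarrow> real^3" where
  "area x i j = \<theta> i x \<times> \<theta> j x"

text \<open>The curvature endomorphism of \<open>L\<^sup>-\<^sup>1TB\<close> is the cross product with \<open>\<Omega> x i j\<close>.\<close>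

definition \<Omega> :: "real^3 \<Rightarrow> 3 \<Rightarrow> 3 \<Rightarrow> real^3" where
  "\<Omega> x i j = pd i (a j) x - pd j (a i) x + a i x \<times> a j x"

definition F :: "real^3 \<Rightarrow> 3 \<Rightarrow> 3 \<Rightarrow> real" where
  "F x i j = pd i (w j) x - pd j (w i) x"

text \<open>The vector with \<open>F x i j = \<phi> x \<bullet> area x i j\<close>. The explicit formula inverts this relation by
  Cramer's rule and shows that \<open>\<phi>\<close> is smooth.\<close>

definition \<phi> :: "real^3 \<Rightarrow> real^3" where
  "\<phi> x = inverse (\<theta> 1 x \<bullet> (\<theta> 2 x \<times> \<theta> 3 x)) *\<^sub>R
    (F x 2 3 *\<^sub>R \<theta> 1 x + F x 3 1 *\<^sub>R \<theta> 2 x + F x 1 2 *\<^sub>R \<theta> 3 x)"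

lemma diff_coframe: "x \<in> U \<Longrightarrow> \<theta> j differentiable (at x)"
  and diff_conn: "x \<in> U \<Longrightarrow> a j differentiable (at x)"
  and diff_weyl: "x \<in> U \<Longrightarrow> w j differentiable (at x)"
  using smooth_on_differentiable smooth_coframe smooth_conn smooth_weyl by blast+

lemma area_skew: "area x j i = - area x i j"
  by (simp add: area_def cross_skew[of "\<theta> j x"])

lemma \<Omega>_skew: "\<Omega> x j i = - \<Omega> x i j"
  by (simp add: \<Omega>_def cross_skew[of "a j x"])

lemma area_nondegenerate:
  assumes "x \<in> U" "\<And>i j. v \<bullet> area x i j = 0"
  shows "v = 0"
  using frame_expand[of "\<theta> 2 x" "\<theta> 3 x" v "\<theta> 1 x"] assms(2)[unfolded area_def] vol_pos[OF assms(1)]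
  by (simp add: inner_commute)

lemma coframe_nondegenerate:
  assumes "x \<in> U" "\<And>i. v \<bullet> \<theta> i x = 0"
  shows "v = 0"
  using frame_expand_cross[of "\<theta> 1 x" v "\<theta> 2 x" "\<theta> 3 x"] assms(2) vol_pos[OF assms(1)]
  by (simp add: inner_commute)

lemma area_vector:
  assumes "x \<in> U" "\<And>i j. f i j = - f j i"
  shows "(inverse (\<theta> 1 x \<bullet> (\<theta> 2 x \<times> \<theta> 3 x)) *\<^sub>R
    (f 2 3 *\<^sub>R \<theta> 1 x + f 3 1 *\<^sub>R \<theta> 2 x + f 1 2 *\<^sub>R \<theta> 3 x)) \<bullet> area x i j = f i j"
proof -
  have z: "f 1 1 = 0" "f 2 2 = 0" "f 3 3 = 0" using assms(2) by (metis eq_neg_iff_add_eq_0 mult_2 mult_eq_0_iff zero_neq_numeral)+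
  have p: "\<theta> 1 x \<bullet> (\<theta> 2 x \<times> \<theta> 3 x) \<noteq> 0" using vol_pos[OF assms(1)] by simp
  have s: "f 2 1 = - f 1 2" "f 3 2 = - f 2 3" "f 1 3 = - f 3 1" using assms(2) by blast+
  have "\<forall>i j. (f 2 3 *\<^sub>R \<theta> 1 x + f 3 1 *\<^sub>R \<theta> 2 x + f 1 2 *\<^sub>R \<theta> 3 x) \<bullet> area x i j
      = (\<theta> 1 x \<bullet> (\<theta> 2 x \<times> \<theta> 3 x)) * f i j"
    unfolding forall_3 by (simp add: z s area_def coords3 algebra_simps)
  then show ?thesis using p by (simp add: divide_inverse[symmetric] nonzero_divide_eq_eq mult.commute)
qed

lemma F_eq: "x \<in> U \<Longrightarrow> F x i j = \<phi> x \<bullet> area x i j"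
  unfolding \<phi>_def by (rule area_vector[symmetric]) (auto simp: F_def)

lemma smooth_\<phi>: "smooth_on U \<phi>"
  unfolding \<phi>_def F_def
  by (intro smooth_on_scaleR smooth_on_add smooth_on_inverse smooth_on_inner smooth_on_cross3
      smooth_on_diff smooth_on_pd smooth_coframe smooth_weyl U) (use vol_pos in force)

text \<open>The Ricci identity for sections of weight \<open>c\<close>: express the second partial derivatives of \<open>V\<close>
  through \<open>W\<close> and use that they commute.\<close>

lemma ricci_identity:
  fixes c :: real
  assumes "x \<in> U" and V: "smooth_on U V" and W: "\<And>i. smooth_on U (W i)"
    and DV: "\<And>y i. y \<in> U \<Longrightarrow> pd i V y + a i y \<times> V y + (c * w i y) *\<^sub>R V y = W i y"
  shows "\<Omega> x i j \<times> V x + (c * F x i j) *\<^sub>R V x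
    = (pd i (W j) x + a i x \<times> W j x + (c * w i x) *\<^sub>R W j x)
    - (pd j (W i) x + a j x \<times> W i x + (c * w j x) *\<^sub>R W i x)"
proof -
  note d = diff_conn[OF assms(1)] diff_weyl[OF assms(1)] smooth_on_differentiable[OF V assms(1)]
    smooth_on_differentiable[OF W assms(1)]
  have first: "pd l V y = W l y - a l y \<times> V y - (c * w l y) *\<^sub>R V y" if "y \<in> U" for y l
    using DV[OF that, of l] by (simp add: algebra_simps)
  have dcw: "pd k (\<lambda>y. (c * w l y) *\<^sub>R V y) x = (c * w l x) *\<^sub>R pd k V x + (c * pd k (w l) x) *\<^sub>R V x"
    and cw: "(\<lambda>y. (c * w l y) *\<^sub>R V y) differentiable (at x)" for k l
  proof -
    have cw: "(\<lambda>y. c * w l y) differentiable (at x)" by (intro differentiable_linear[OF bounded_linear_mult_right] d)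
    show "pd k (\<lambda>y. (c * w l y) *\<^sub>R V y) x = (c * w l x) *\<^sub>R pd k V x + (c * pd k (w l) x) *\<^sub>R V x"
      by (subst pd_scaleR[OF cw d(3)]) (simp add: pd_linear[OF bounded_linear_mult_right d(2)])
    show "(\<lambda>y. (c * w l y) *\<^sub>R V y) differentiable (at x)"
      by (intro differentiable_bilinear[OF bounded_bilinear_scaleR] cw d)
  qed
  have second: "pd k (pd l V) x = pd k (W l) x - (a l x \<times> pd k V x + pd k (a l) x \<times> V x)
      - ((c * w l x) *\<^sub>R pd k V x + (c * pd k (w l) x) *\<^sub>R V x)" for k l
  proof -
    have "pd k (pd l V) x = pd k (\<lambda>y. W l y - a l y \<times> V y - (c * w l y) *\<^sub>R V y) x"
      by (intro pd_cong_open[OF U assms(1)] first)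
    also have "\<dots> = pd k (W l) x - (a l x \<times> pd k V x + pd k (a l) x \<times> V x)
      - ((c * w l x) *\<^sub>R pd k V x + (c * pd k (w l) x) *\<^sub>R V x)"
      by (simp add: pd_diff pd_cross3 d dcw cw differentiable_cross3)
    finally show ?thesis .
  qed
  have "pd i (pd j V) x = pd j (pd i V) x" by (rule pd_commute[OF U assms(1) V])
  then show ?thesis
    unfolding second first[OF assms(1)] \<Omega>_def F_def
    by (simp add: coords3 algebra_simps)
qed

text \<open>The Ricci identity for \<open>\<theta> k\<close>, which has weight 1. In the cyclic sum the second covariant
  derivatives cancel, because the first ones are symmetric.\<close>

lemma first_bianchi:
  assumes "x \<in> U"
  shows "(\<Omega> x i j \<times> \<theta> k x + F x i j *\<^sub>R \<theta> k x) + (\<Omega> x j k \<times> \<theta> i x + F x j k *\<^sub>R \<theta> i x)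
    + (\<Omega> x k i \<times> \<theta> j x + F x k i *\<^sub>R \<theta> j x) = 0"
proof -
  define W where "W j i y = pd i (\<theta> j) y + a i y \<times> \<theta> j y + (1 * w i y) *\<^sub>R \<theta> j y" for i j y
  have smW: "smooth_on U (W j i)" for i j
    unfolding W_def[abs_def]
    by (simp, intro smooth_on_add smooth_on_scaleR smooth_on_cross3 smooth_on_pd smooth_coframe smooth_conn
        smooth_weyl U)
  have sym: "W j i y = W i j y" if "y \<in> U" for i j y
    using torsion[OF that] by (simp add: W_def)
  have pdW: "pd l (W j i) x = pd l (W i j) x" for i j l
    by (rule pd_cong_open[OF U assms sym])
  have "\<Omega> x i j \<times> \<theta> k x + (1 * F x i j) *\<^sub>R \<theta> k x
    = (pd i (W k j) x + a i x \<times> W k j x + (1 * w i x) *\<^sub>R W k j x)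
    - (pd j (W k i) x + a j x \<times> W k i x + (1 * w j x) *\<^sub>R W k i x)" for i j k
    by (rule ricci_identity[OF assms smooth_coframe smW]) (simp add: W_def)
  then show ?thesis
    using pdW[of i j k] pdW[of j k i] pdW[of k i j] sym[OF assms, of i j] sym[OF assms, of j k]
      sym[OF assms, of k i]
    by simp
qed

lemma second_bianchi:
  assumes "x \<in> U"
  shows "(pd i (\<lambda>y. \<Omega> y j k) x + a i x \<times> \<Omega> x j k) + (pd j (\<lambda>y. \<Omega> y k i) x + a j x \<times> \<Omega> x k i)
    + (pd k (\<lambda>y. \<Omega> y i j) x + a k x \<times> \<Omega> x i j) = 0"
proof -
  note d = diff_conn[OF assms] smooth_on_differentiable[OF smooth_on_pd[OF smooth_conn] assms]
  have e: "pd l (\<lambda>y. \<Omega> y m n) x = pd l (pd m (a n)) x - pd l (pd n (a m)) x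
      + (a m x \<times> pd l (a n) x + pd l (a m) x \<times> a n x)" for l m n
    unfolding \<Omega>_def by (simp add: pd_add pd_diff pd_cross3 d differentiable_cross3 differentiable_diff)
  have c: "pd l (pd m (a n)) x = pd m (pd l (a n)) x" for l m n
    by (rule pd_commute[OF U assms smooth_conn])
  show ?thesis
    unfolding e unfolding c[of j i k] c[of k j i] c[of i k j] \<Omega>_def
    by (simp add: coords3 algebra_simps)
qed

text \<open>The covariant derivative of the coframe, symmetric because there is no torsion; its symmetry
  makes it drop out of all exterior derivatives.\<close>

definition D\<theta> :: "real^3 \<Rightarrow> 3 \<Rightarrow> 3 \<Rightarrow> real^3" where
  "D\<theta> x i j = pd i (\<theta> j) x + a i x \<times> \<theta> j x + w i x *\<^sub>R \<theta> j x"

lemma D\<theta>_sym: "x \<in> U \<Longrightarrow> D\<theta> x j i = D\<theta> x i j"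
  using torsion by (simp add: D\<theta>_def)

lemma pd_coframe: "pd i (\<theta> j) x = D\<theta> x i j - a i x \<times> \<theta> j x - w i x *\<^sub>R \<theta> j x"
  by (simp add: D\<theta>_def)

text \<open>The exterior derivative of the 2-form \<open>V \<bullet> area\<close>, for \<open>V\<close> of weight \<open>-2\<close>: by the torsion
  equation the derivatives of the area vectors cancel.\<close>

lemma ext_d_area:
  assumes "x \<in> U" and V: "smooth_on U V"
  shows "pd i (\<lambda>y. V y \<bullet> area y j k) x + pd j (\<lambda>y. V y \<bullet> area y k i) x + pd k (\<lambda>y. V y \<bullet> area y i j) x
    = (pd i V x + a i x \<times> V x - (2 * w i x) *\<^sub>R V x) \<bullet> area x j k
    + (pd j V x + a j x \<times> V x - (2 * w j x) *\<^sub>R V x) \<bullet> area x k i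
    + (pd k V x + a k x \<times> V x - (2 * w k x) *\<^sub>R V x) \<bullet> area x i j"
proof -
  note d = diff_coframe[OF assms(1)] smooth_on_differentiable[OF V assms(1)]
  have e: "pd l (\<lambda>y. V y \<bullet> area y m n) x
      = V x \<bullet> (\<theta> m x \<times> pd l (\<theta> n) x + pd l (\<theta> m) x \<times> \<theta> n x) + pd l V x \<bullet> area x m n" for l m n
    unfolding area_def by (simp add: pd_inner pd_cross3 d differentiable_cross3)
  show ?thesis
    unfolding e unfolding pd_coframe area_def
      D\<theta>_sym[OF assms(1), of i j] D\<theta>_sym[OF assms(1), of j k] D\<theta>_sym[OF assms(1), of k i]
    by (simp add: coords3 algebra_simps)
qed

text \<open>Identities that are linear in an area vector hold for all vectors; this allows evaluation on
  orthonormal bases instead of the coframe.\<close>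

lemma area_span:
  assumes "x \<in> U" "linear f" "\<And>i j. f (area x i j) = 0"
  shows "f v = 0"
proof -
  let ?p = "\<theta> 1 x \<bullet> (\<theta> 2 x \<times> \<theta> 3 x)"
  have "?p *\<^sub>R f v = f (?p *\<^sub>R v)" by (simp add: linear_cmul[OF assms(2)])
  also have "\<dots> = 0"
    unfolding frame_expand_cross[of "\<theta> 1 x" v "\<theta> 2 x" "\<theta> 3 x", symmetric]
    using assms(3)[unfolded area_def] by (simp add: linear_add[OF assms(2)] linear_cmul[OF assms(2)])
  finally show ?thesis using vol_pos[OF assms(1)] by simp
qed

lemma matrix_eq_on_areas:
  assumes "x \<in> U" "\<And>i j. M *v area x i j = M' *v area x i j"
  shows "M = M'"
proof -
  have "(M - M') *v v = 0" for v
    using assms(2) area_span[OF assms(1) matrix_vector_mul_linear, of "M - M'" v]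
    by (simp add: matrix_vector_mult_diff_rdistrib)
  then show ?thesis by (simp add: matrix_eq matrix_vector_mult_diff_rdistrib)
qed

text \<open>In the coframe \<open>Q\<close> is the endomorphism \<open>r\<^sub>0\<close> and \<open>s\<close> is the scalar curvature.\<close>

definition curvature_parts :: "real^3 \<Rightarrow> real^3^3 \<Rightarrow> real \<Rightarrow> bool" where
  "curvature_parts x Q s \<longleftrightarrow> transpose Q = Q \<and> trace Q = 0 \<and>
    (\<forall>i j. \<Omega> x i j = Q *v area x i j - (s / 6) *\<^sub>R area x i j + (1/2) *\<^sub>R (\<phi> x \<times> area x i j))"

text \<open>Extend \<open>\<Omega>\<close> to a matrix \<open>L\<close> by Cramer's rule. The first Bianchi identity says that the skew part
  of \<open>L\<close> is half of the cross product with \<open>\<phi>\<close>, and the symmetric part splits into trace and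
  trace-free part.\<close>

lemma curvature_parts_exists:
  assumes "x \<in> U"
  shows "\<exists>Q s. curvature_parts x Q s"
proof -
  let ?p = "\<theta> 1 x \<bullet> (\<theta> 2 x \<times> \<theta> 3 x)"
  define L :: "real^3^3" where
    "L = (\<chi> m. inverse ?p *\<^sub>R (\<Omega> x 2 3 $ m *\<^sub>R \<theta> 1 x + \<Omega> x 3 1 $ m *\<^sub>R \<theta> 2 x + \<Omega> x 1 2 $ m *\<^sub>R \<theta> 3 x))"
  have p: "?p \<noteq> 0" using vol_pos[OF assms] by simp
  have "L *v area x i j = \<Omega> x i j" for i j
  proof -
    have "\<Omega> x i j $ m = - \<Omega> x j i $ m" for i j m by (subst \<Omega>_skew) simp
    from area_vector[OF assms, of "\<lambda>i j. \<Omega> x i j $ _", OF this] show ?thesis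
      unfolding vec_eq_iff L_def matrix_vector_mul_component vec_lambda_beta by blast
  qed
  moreover have skew: "L $ 1 $ 2 - L $ 2 $ 1 = - \<phi> x $ 3 \<and> L $ 2 $ 3 - L $ 3 $ 2 = - \<phi> x $ 1
      \<and> L $ 3 $ 1 - L $ 1 $ 3 = - \<phi> x $ 2"
  proof -
    have Fp: "F x 2 3 *\<^sub>R \<theta> 1 x + F x 3 1 *\<^sub>R \<theta> 2 x + F x 1 2 *\<^sub>R \<theta> 3 x = ?p *\<^sub>R \<phi> x"
      using p by (simp add: \<phi>_def)
    define N where "N = \<Omega> x 2 3 \<times> \<theta> 1 x + \<Omega> x 3 1 \<times> \<theta> 2 x + \<Omega> x 1 2 \<times> \<theta> 3 x"
    have "N + ?p *\<^sub>R \<phi> x = 0"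
      using first_bianchi[OF assms, of 1 2 3] unfolding Fp[symmetric] N_def
      by (simp add: add_ac)
    then have "N = - (?p *\<^sub>R \<phi> x)" by (simp add: eq_neg_iff_add_eq_0)
    then have "inverse ?p *\<^sub>R N = - \<phi> x" using p by simp
    moreover have "L $ 1 $ 2 - L $ 2 $ 1 = inverse ?p * N $ 3"
      "L $ 2 $ 3 - L $ 3 $ 2 = inverse ?p * N $ 1" "L $ 3 $ 1 - L $ 1 $ 3 = inverse ?p * N $ 2"
      unfolding L_def N_def vec_lambda_beta vector_add_component cross_components vector_scaleR_component
        real_scaleR_def right_diff_distrib[symmetric] by (rule arg_cong[where f="(*) _"], algebra)+
    ultimately show ?thesis by (simp add: vec_eq_iff)
  qed
  moreover define Q :: "real^3^3" where
    "Q = (\<chi> m n. (L $ m $ n + L $ n $ m) / 2 - (if m = n then trace L / 3 else 0))"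
  have "Q *v v - (- 2 * trace L / 6) *\<^sub>R v + (1/2) *\<^sub>R (\<phi> x \<times> v) = L *v v" for v
  proof -
    have "\<phi> x $ 3 = L $ 2 $ 1 - L $ 1 $ 2" "\<phi> x $ 1 = L $ 3 $ 2 - L $ 2 $ 3" "\<phi> x $ 2 = L $ 1 $ 3 - L $ 3 $ 1"
      using skew by auto
    then show ?thesis
      by (simp add: coords3 Q_def matrix_vector_mult_def trace_def) (simp add: field_simps)
  qed
  moreover have "transpose Q = Q" "trace Q = 0"
    by (auto simp: Q_def transpose_def vec_eq_iff add.commute) (simp add: trace_def sum_3 field_simps)
  ultimately have "curvature_parts x Q (- 2 * trace L)"
    by (simp add: curvature_parts_def)
  then show ?thesis by blast
qed

lemma curvature_parts_unique:
  assumes "x \<in> U" and Q: "curvature_parts x Q s" and Q': "curvature_parts x Q' s'"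
  shows "Q = Q' \<and> s = s'"
proof -
  have 1: "\<Omega> x i j = Q *v area x i j - (s / 6) *\<^sub>R area x i j + (1/2) *\<^sub>R (\<phi> x \<times> area x i j)"
    and 2: "\<Omega> x i j = Q' *v area x i j - (s' / 6) *\<^sub>R area x i j + (1/2) *\<^sub>R (\<phi> x \<times> area x i j)"
    for i j
    using Q Q' unfolding curvature_parts_def by blast+
  have "Q *v area x i j - (s / 6) *\<^sub>R area x i j = Q' *v area x i j - (s' / 6) *\<^sub>R area x i j" for i j
    using trans[OF 1[symmetric] 2, of i j] by (rule add_right_imp_eq)
  then have eq: "Q - (s / 6) *\<^sub>R mat 1 = Q' - (s' / 6) *\<^sub>R mat 1"
    by (intro matrix_eq_on_areas[OF assms(1)])
      (simp add: matrix_vector_mult_diff_rdistrib scaleR_matrix_vector_assoc[symmetric])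
  then have "trace (Q - (s / 6) *\<^sub>R mat 1) = trace (Q' - (s' / 6) *\<^sub>R mat 1)" by simp
  then have "s = s'"
    using Q Q' by (simp add: curvature_parts_def trace_def sum_3 mat_def)
  with eq show ?thesis by simp
qed

text \<open>For \<open>s\<close> of weight \<open>-1\<close> this is the vector dual to the weighted 1-form \<open>Ds\<close>, by Cramer's rule.\<close>

definition grad :: "(real^3 \<Rightarrow> real) \<Rightarrow> real^3 \<Rightarrow> real^3" where
  "grad s x = inverse (\<theta> 1 x \<bullet> (\<theta> 2 x \<times> \<theta> 3 x)) *\<^sub>R
    ((pd 1 s x - w 1 x * s x) *\<^sub>R (\<theta> 2 x \<times> \<theta> 3 x) + (pd 2 s x - w 2 x * s x) *\<^sub>R (\<theta> 3 x \<times> \<theta> 1 x)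
      + (pd 3 s x - w 3 x * s x) *\<^sub>R (\<theta> 1 x \<times> \<theta> 2 x))"

lemma grad_coframe:
  assumes "x \<in> U"
  shows "grad s x \<bullet> \<theta> i x = pd i s x - w i x * s x"
proof -
  have "(u1 *\<^sub>R (\<theta> 2 x \<times> \<theta> 3 x) + u2 *\<^sub>R (\<theta> 3 x \<times> \<theta> 1 x) + u3 *\<^sub>R (\<theta> 1 x \<times> \<theta> 2 x)) \<bullet> \<theta> i x
      = (\<theta> 1 x \<bullet> (\<theta> 2 x \<times> \<theta> 3 x)) * (if i = 1 then u1 else if i = 2 then u2 else u3)" for u1 u2 u3
    using exhaust_3[of i] by (auto simp: coords3 algebra_simps)
  then show ?thesis
    using vol_pos[OF assms] exhaust_3[of i] by (auto simp: grad_def divide_inverse[symmetric])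
qed

lemma smooth_grad:
  assumes "smooth_on U s"
  shows "smooth_on U (grad s)"
  unfolding grad_def
  by (intro smooth_on_scaleR smooth_on_add smooth_on_inverse smooth_on_inner smooth_on_cross3
      smooth_on_diff smooth_on_mult smooth_on_pd assms smooth_coframe smooth_weyl U) (use vol_pos in force)

end

section \<open>Shear-free geodesic congruences in a coframe\<close>

lemma exists_unit_orthogonal:
  fixes V :: "real^3"
  assumes "V \<noteq> 0"
  obtains S where "S \<bullet> V = 0" "S \<bullet> S = 1"
proof -
  obtain e where e: "V \<times> e \<noteq> 0" using cross_basis_nonzero[OF assms] by blast
  have "(V \<times> e /\<^sub>R norm (V \<times> e)) \<bullet> V = 0" by (simp add: dot_cross_self inner_commute)
  moreover have "(V \<times> e /\<^sub>R norm (V \<times> e)) \<bullet> (V \<times> e /\<^sub>R norm (V \<times> e)) = 1"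
    using e by (simp add: dot_square_norm power2_eq_square)
  ultimately show thesis by (rule that)
qed

text \<open>
  The pointwise content of the theorem. The hypothesis \<open>curv\<close> is the Ricci identity for a unit
  vector \<open>V\<close> with divergence \<open>\<tau>\<close> and twist \<open>\<kappa>\<close>, where \<open>t\<close> and \<open>k\<close> are the gradients of \<open>\<tau>\<close> and
  \<open>\<kappa>\<close>. Evaluating it on \<open>V\<close> and on an orthonormal basis \<open>S\<close>, \<open>V \<times> S\<close> of the complement shows that
  the only components of \<open>Q\<close> that it leaves free are those of \<open>Q *v V\<close>, and these are the two
  quantities whose vanishing the monopole equations express.
\<close>

lemma congruence_curvature:
  fixes V t k \<phi> :: "real^3" and Q :: "real^3^3"
  assumes V: "V \<bullet> V = 1" and Q: "transpose Q = Q" "trace Q = 0"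
    and curv: "\<And>S. (Q *v S - (s / 6) *\<^sub>R S + (1/2) *\<^sub>R (\<phi> \<times> S)) \<times> V
      = S \<times> t - (S \<bullet> (t \<times> V)) *\<^sub>R V + V \<times> (S \<times> k)
        + (2 * \<tau> * \<kappa>) *\<^sub>R (V \<times> (S \<times> V)) + (\<tau>\<^sup>2 - \<kappa>\<^sup>2) *\<^sub>R (S \<times> V)"
  defines "m \<equiv> k - (1/2) *\<^sub>R \<phi> + t \<times> V + (2 * \<tau> * \<kappa>) *\<^sub>R V"
  shows "V \<bullet> m = 0"
    and "Q = 0 \<longleftrightarrow> V \<bullet> t + \<tau>\<^sup>2 - \<kappa>\<^sup>2 + s / 6 = 0 \<and> m = 0"
proof -
  have adj: "u \<bullet> (Q *v v) = v \<bullet> (Q *v u)" for u v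
    using dot_lmul_matrix[of u Q v] transpose_matrix_vector[of Q u] Q(1) by (simp add: inner_commute)
  have "V \<noteq> 0" using V by auto
  then obtain S where S: "S \<bullet> V = 0" "S \<bullet> S = 1" by (rule exists_unit_orthogonal)
  define c where "c = V \<bullet> t + \<tau>\<^sup>2 - \<kappa>\<^sup>2 + s / 6"
  have basis: "S \<bullet> (Q *v S) = c" "(V \<times> S) \<bullet> (Q *v S) = V \<bullet> k + 2 * \<tau> * \<kappa> - (1/2) * (V \<bullet> \<phi>)"
    if S: "S \<bullet> V = 0" "S \<bullet> S = 1" for S
  proof -
    have VS: "V \<bullet> S = 0" using S(1) by (simp add: inner_commute)
    define Y where "Y = Q *v S - (s / 6) *\<^sub>R S + (1/2) *\<^sub>R (\<phi> \<times> S)"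
    define R where "R = S \<times> t - (S \<bullet> (t \<times> V)) *\<^sub>R V + V \<times> (S \<times> k)
        + (2 * \<tau> * \<kappa>) *\<^sub>R (V \<times> (S \<times> V)) + (\<tau>\<^sup>2 - \<kappa>\<^sup>2) *\<^sub>R (S \<times> V)"
    have YR: "Y \<times> V = R" by (simp only: Y_def R_def curv)
    have VSV: "V \<times> (S \<times> V) = S" by (simp add: Lagrange V VS)
    have "(Y \<times> V) \<bullet> (S \<times> V) = Y \<bullet> S" by (simp add: inner_cross_cross V VS)
    moreover have "Y \<bullet> S = S \<bullet> (Q *v S) - s / 6"
      by (simp add: Y_def inner_add inner_diff S dot_cross_self inner_commute)
    moreover have "R \<bullet> (S \<times> V) = V \<bullet> t + (\<tau>\<^sup>2 - \<kappa>\<^sup>2)"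
      unfolding R_def inner_add_left inner_diff_left inner_scaleR_left VSV
      by (simp add: inner_cross_cross V VS S dot_cross_self inner_commute)
    ultimately show "S \<bullet> (Q *v S) = c" using YR by (simp add: c_def)
    have "(Y \<times> V) \<bullet> S = Y \<bullet> (V \<times> S)" using cross_triple[of Y V S] by (simp add: inner_commute)
    moreover have "Y \<bullet> (V \<times> S) = (V \<times> S) \<bullet> (Q *v S) + (1/2) * (V \<bullet> \<phi>)"
      by (simp add: Y_def inner_add inner_diff inner_cross_cross V VS S dot_cross_self inner_commute)
    moreover have "R \<bullet> S = V \<bullet> k + 2 * \<tau> * \<kappa>"
      unfolding R_def inner_add_left inner_diff_left inner_scaleR_left VSV
      by (simp add: Lagrange inner_diff V VS S dot_cross_self)
    ultimately show "(V \<times> S) \<bullet> (Q *v S) = V \<bullet> k + 2 * \<tau> * \<kappa> - (1/2) * (V \<bullet> \<phi>)"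
      using YR by simp
  qed
  define N where "N = V \<times> S"
  have VS: "V \<bullet> S = 0" using S(1) by (simp add: inner_commute)
  have N: "N \<bullet> V = 0" "N \<bullet> N = 1" "V \<times> N = - S" "S \<times> N = V" "N \<times> V = S"
    by (simp_all add: N_def dot_cross_self inner_cross_cross Lagrange cross_cross V S VS)
  have SS: "S \<bullet> (Q *v S) = c" and NN: "N \<bullet> (Q *v N) = c"
    using basis(1)[OF S] basis(1)[OF N(1,2)] by auto
  have "N \<bullet> (Q *v S) = V \<bullet> k + 2 * \<tau> * \<kappa> - (1/2) * (V \<bullet> \<phi>)"
    "- (S \<bullet> (Q *v N)) = V \<bullet> k + 2 * \<tau> * \<kappa> - (1/2) * (V \<bullet> \<phi>)"
    using basis(2)[OF S] basis(2)[OF N(1,2)] by (simp_all add: N(3) flip: N_def)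
  then have NS: "N \<bullet> (Q *v S) = 0" and kV: "V \<bullet> k + 2 * \<tau> * \<kappa> - (1/2) * (V \<bullet> \<phi>) = 0"
    using adj[of N S] by linarith+
  show Vm: "V \<bullet> m = 0"
    using kV by (simp add: m_def inner_add_right inner_diff_right dot_cross_self V)
  have VV: "V \<bullet> (Q *v V) = - 2 * c"
  proof -
    have "((Q *v S) \<times> N + S \<times> (Q *v N)) \<bullet> V = - (V \<bullet> (Q *v V))"
      unfolding symmetric_area_map by (simp add: N Q inner_commute)
    moreover have "((Q *v S) \<times> N) \<bullet> V = S \<bullet> (Q *v S)"
      using cross_triple[of "Q *v S" N V] by (simp add: N)
    moreover have "(S \<times> (Q *v N)) \<bullet> V = N \<bullet> (Q *v N)"
      using cross_triple[of V S "Q *v N"] by (simp add: N_def inner_commute)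
    ultimately show ?thesis using SS NN by (simp add: inner_add_left)
  qed
  have m: "m = - ((Q *v V) \<times> V)"
  proof -
    have "(Q *v V) \<times> V + (1/2) *\<^sub>R ((\<phi> \<times> V) \<times> V) = V \<times> t + V \<times> (V \<times> k)"
      using curv[of V] by (simp add: cross_add_left Cross3.left_diff_distrib cross_mult_left dot_cross_self)
    then have "(Q *v V) \<times> V = V \<times> t + (V \<bullet> k) *\<^sub>R V - k - (1/2) *\<^sub>R ((V \<bullet> \<phi>) *\<^sub>R V - \<phi>)"
      by (simp add: Lagrange cross_cross V inner_commute algebra_simps)
    then have "m = (V \<bullet> k + 2 * \<tau> * \<kappa> - (1/2) * (V \<bullet> \<phi>)) *\<^sub>R V - (Q *v V) \<times> V"
      using cross_skew[of t V] by (simp add: m_def algebra_simps)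
    then show ?thesis using kV by simp
  qed
  have "Q = 0" if c: "c = 0" and m0: "m = 0"
  proof -
    have "V \<times> ((Q *v V) \<times> V) = 0" using m m0 by simp
    then have QV: "Q *v V = 0" using VV c by (simp add: Lagrange V)
    have zero: "Q *v u = 0" if "V \<bullet> (Q *v u) = 0" "S \<bullet> (Q *v u) = 0" "N \<bullet> (Q *v u) = 0" for u
      using frame_expand_cross[of V "Q *v u" S N] that by (simp add: N V)
    have QS: "Q *v S = 0" using adj[of V S] SS NS c QV by (intro zero) auto
    have QN: "Q *v N = 0" using adj[of V N] adj[of S N] NN c QV QS by (intro zero) auto
    have "Q *v u = 0" for u
    proof -
      have "(V \<bullet> (S \<times> N)) *\<^sub>R u = (V \<bullet> u) *\<^sub>R (S \<times> N) + (S \<bullet> u) *\<^sub>R (N \<times> V) + (N \<bullet> u) *\<^sub>R (V \<times> S)"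
        by (rule frame_expand_cross[symmetric])
      then have "u = (V \<bullet> u) *\<^sub>R V + (S \<bullet> u) *\<^sub>R S + (N \<bullet> u) *\<^sub>R N"
        by (simp add: N V flip: N_def)
      then have "Q *v u = Q *v ((V \<bullet> u) *\<^sub>R V + (S \<bullet> u) *\<^sub>R S + (N \<bullet> u) *\<^sub>R N)" by simp
      then show ?thesis
        by (simp add: matrix_vector_right_distrib matrix_vector_mult_scaleR QV QS QN)
    qed
    then show ?thesis by (simp add: matrix_eq)
  qed
  moreover have "c = 0 \<and> m = 0" if "Q = 0"
    using SS m that by simp
  ultimately show "Q = 0 \<longleftrightarrow> V \<bullet> t + \<tau>\<^sup>2 - \<kappa>\<^sup>2 + s / 6 = 0 \<and> m = 0"
    unfolding c_def by blast
qed


text \<open>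
  The first order terms in the exterior derivative of the first monopole equation. Here \<open>W u\<close> is the
  derivative of \<open>V\<close> in direction \<open>u\<close>, and the cyclic sum over \<open>p\<close>, \<open>q\<close>, \<open>r\<close> is the trace of \<open>g\<close> times the
  volume: \<open>W\<close> has trace \<open>2 \<tau>\<close>, and the skew part of \<open>W\<close>, the cross product with \<open>\<kappa> V\<close>, pairs with
  the cross product with \<open>\<phi>\<close>.
\<close>

lemma congruence_divergence:
  fixes V \<phi> t k p q r :: "real^3" and \<tau> \<kappa> c :: real
  assumes "V \<bullet> V = 1"
  defines "W \<equiv> \<lambda>u. \<tau> *\<^sub>R (u - (V \<bullet> u) *\<^sub>R V) + \<kappa> *\<^sub>R (V \<times> u)"
  defines "g \<equiv> \<lambda>u. - (1/2) *\<^sub>R (\<phi> \<times> W u) - (2 * \<tau> * (t \<bullet> u) + 2 * \<kappa> * (k \<bullet> u)) *\<^sub>R V - c *\<^sub>R W u"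
  shows "g p \<bullet> (q \<times> r) + g q \<bullet> (r \<times> p) + g r \<bullet> (p \<times> q)
    = (p \<bullet> (q \<times> r)) * (\<kappa> * (V \<bullet> \<phi>) - 2 * \<tau> * (V \<bullet> t) - 2 * \<kappa> * (V \<bullet> k) - 2 * \<tau> * c)"
proof -
  have g: "g u = (- \<tau> / 2) *\<^sub>R (\<phi> \<times> u) + (\<tau> / 2 * (u \<bullet> V)) *\<^sub>R (\<phi> \<times> V) - (\<kappa> / 2 * (u \<bullet> \<phi>)) *\<^sub>R V
    + (\<kappa> / 2 * (\<phi> \<bullet> V)) *\<^sub>R u - (2 * \<tau> * (u \<bullet> t) + 2 * \<kappa> * (u \<bullet> k)) *\<^sub>R V
    - (c * \<tau>) *\<^sub>R u + (c * \<tau> * (u \<bullet> V)) *\<^sub>R V - (c * \<kappa>) *\<^sub>R (V \<times> u)" for u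
    unfolding g_def W_def
    by (simp add: cross_add_right Cross3.right_diff_distrib cross_mult_right Lagrange inner_commute[of _ u]
        algebra_simps)
  have z: "(v \<times> p) \<bullet> (q \<times> r) + (v \<times> q) \<bullet> (r \<times> p) + (v \<times> r) \<bullet> (p \<times> q) = 0" for v
    by (simp add: inner_cross_cross inner_commute algebra_simps)
  have three: "p \<bullet> (q \<times> r) + q \<bullet> (r \<times> p) + r \<bullet> (p \<times> q) = 3 * (p \<bullet> (q \<times> r))"
    by (simp add: coords3 algebra_simps)
  have con: "(p \<bullet> v) * (u \<bullet> (q \<times> r)) + (q \<bullet> v) * (u \<bullet> (r \<times> p)) + (r \<bullet> v) * (u \<bullet> (p \<times> q))
    = (p \<bullet> (q \<times> r)) * (u \<bullet> v)" for u v
    using frame_contract[of p v q r u] by (simp add: inner_commute)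
  have "g p \<bullet> (q \<times> r) + g q \<bullet> (r \<times> p) + g r \<bullet> (p \<times> q)
    = (- \<tau> / 2) * ((\<phi> \<times> p) \<bullet> (q \<times> r) + (\<phi> \<times> q) \<bullet> (r \<times> p) + (\<phi> \<times> r) \<bullet> (p \<times> q))
    + \<tau> / 2 * ((p \<bullet> V) * ((\<phi> \<times> V) \<bullet> (q \<times> r)) + (q \<bullet> V) * ((\<phi> \<times> V) \<bullet> (r \<times> p)) + (r \<bullet> V) * ((\<phi> \<times> V) \<bullet> (p \<times> q)))
    - \<kappa> / 2 * ((p \<bullet> \<phi>) * (V \<bullet> (q \<times> r)) + (q \<bullet> \<phi>) * (V \<bullet> (r \<times> p)) + (r \<bullet> \<phi>) * (V \<bullet> (p \<times> q)))
    + (\<kappa> / 2 * (\<phi> \<bullet> V) - c * \<tau>) * (p \<bullet> (q \<times> r) + q \<bullet> (r \<times> p) + r \<bullet> (p \<times> q))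
    - 2 * \<tau> * ((p \<bullet> t) * (V \<bullet> (q \<times> r)) + (q \<bullet> t) * (V \<bullet> (r \<times> p)) + (r \<bullet> t) * (V \<bullet> (p \<times> q)))
    - 2 * \<kappa> * ((p \<bullet> k) * (V \<bullet> (q \<times> r)) + (q \<bullet> k) * (V \<bullet> (r \<times> p)) + (r \<bullet> k) * (V \<bullet> (p \<times> q)))
    + c * \<tau> * ((p \<bullet> V) * (V \<bullet> (q \<times> r)) + (q \<bullet> V) * (V \<bullet> (r \<times> p)) + (r \<bullet> V) * (V \<bullet> (p \<times> q)))
    - c * \<kappa> * ((V \<times> p) \<bullet> (q \<times> r) + (V \<times> q) \<bullet> (r \<times> p) + (V \<times> r) \<bullet> (p \<times> q))"
    unfolding g inner_add_left inner_diff_left inner_scaleR_left by algebra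
  then show ?thesis
    unfolding z con three by (simp add: assms(1) dot_cross_self inner_commute algebra_simps)
qed

locale coframe_congruence = weyl_coframe U \<theta> a w
  for U \<theta> a w +
  fixes V :: "real^3 \<Rightarrow> real^3" and \<tau> \<kappa> :: "real^3 \<Rightarrow> real"
  assumes smooth_V: "smooth_on U V" and smooth_\<tau>: "smooth_on U \<tau>" and smooth_\<kappa>: "smooth_on U \<kappa>"
    and unit: "\<And>x. x \<in> U \<Longrightarrow> V x \<bullet> V x = 1"
    and DV: "\<And>x i. x \<in> U \<Longrightarrow> pd i V x + a i x \<times> V x
      = \<tau> x *\<^sub>R (\<theta> i x - (V x \<bullet> \<theta> i x) *\<^sub>R V x) + \<kappa> x *\<^sub>R (V x \<times> \<theta> i x)"
begin

text \<open>By \<open>DV\<close>, the covariant derivative of \<open>V\<close> along the \<open>i\<close>-th coordinate field. Sections of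
  \<open>L\<^sup>-\<^sup>1TB\<close> have weight 0 in the coframe, so \<open>w\<close> does not appear.\<close>

definition W :: "3 \<Rightarrow> real^3 \<Rightarrow> real^3" where
  "W i x = \<tau> x *\<^sub>R (\<theta> i x - (V x \<bullet> \<theta> i x) *\<^sub>R V x) + \<kappa> x *\<^sub>R (V x \<times> \<theta> i x)"

lemma smooth_W: "smooth_on U (W i)"
  unfolding W_def[abs_def]
  by (intro smooth_on_add smooth_on_diff smooth_on_scaleR smooth_on_inner smooth_on_cross3 smooth_V
      smooth_\<tau> smooth_\<kappa> smooth_coframe U)

lemma pd_V: "x \<in> U \<Longrightarrow> pd i V x = W i x - a i x \<times> V x"
  using DV by (simp add: W_def eq_diff_eq)

lemma diff_V: "x \<in> U \<Longrightarrow> V differentiable (at x)"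
  and diff_\<tau>: "x \<in> U \<Longrightarrow> \<tau> differentiable (at x)"
  and diff_\<kappa>: "x \<in> U \<Longrightarrow> \<kappa> differentiable (at x)"
  using smooth_on_differentiable smooth_V smooth_\<tau> smooth_\<kappa> by blast+

lemma pd_density: "x \<in> U \<Longrightarrow> pd i s x = grad s x \<bullet> \<theta> i x + w i x * s x"
  by (simp add: grad_coframe)

lemma ext_d_one_form:
  assumes "x \<in> U" "s differentiable (at x)"
  shows "pd i (\<lambda>y. s y * (V y \<bullet> \<theta> j y)) x - pd j (\<lambda>y. s y * (V y \<bullet> \<theta> i y)) x
    = (grad s x \<times> V x + (2 * s x * \<kappa> x) *\<^sub>R V x) \<bullet> area x i j"
proof -
  note d = assms(2) diff_V[OF assms(1)] diff_coframe[OF assms(1)]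
  have e: "pd i (\<lambda>y. s y * (V y \<bullet> \<theta> j y)) x
      = (grad s x \<bullet> \<theta> i x) * (V x \<bullet> \<theta> j x) + s x * (W i x \<bullet> \<theta> j x + V x \<bullet> D\<theta> x i j)" for i j
  proof -
    have "pd i (\<lambda>y. s y * (V y \<bullet> \<theta> j y)) x
        = s x * (V x \<bullet> pd i (\<theta> j) x + pd i V x \<bullet> \<theta> j x) + pd i s x * (V x \<bullet> \<theta> j x)"
      by (simp add: pd_mult pd_inner d differentiable_inner)
    then show ?thesis
      unfolding pd_V[OF assms(1)] pd_coframe pd_density[OF assms(1)]
      using cross_triple[of "a i x" "V x" "\<theta> j x"] cross_triple[of "V x" "\<theta> j x" "a i x"]
      by (simp add: inner_diff inner_add inner_commute algebra_simps) (simp add: coords3 algebra_simps)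
  qed
  show ?thesis
    unfolding e D\<theta>_sym[OF assms(1), of j i] area_def W_def
    by (simp add: inner_add inner_diff inner_cross_cross inner_commute algebra_simps)
      (simp add: coords3 algebra_simps)
qed

text \<open>The Ricci identity for the congruence. The right hand side is a function of \<open>S\<close> alone because
  the derivatives of the coframe are symmetric and drop out.\<close>

lemma ricci_congruence_area:
  assumes "x \<in> U"
  defines "t \<equiv> grad \<tau> x" and "k \<equiv> grad \<kappa> x"
  shows "\<Omega> x i j \<times> V x = (\<lambda>S. S \<times> t - (S \<bullet> (t \<times> V x)) *\<^sub>R V x + V x \<times> (S \<times> k)
    + (2 * \<tau> x * \<kappa> x) *\<^sub>R (V x \<times> (S \<times> V x)) + ((\<tau> x)\<^sup>2 - (\<kappa> x)\<^sup>2) *\<^sub>R (S \<times> V x)) (area x i j)"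
proof -
  note d = diff_V[OF assms(1)] diff_\<tau>[OF assms(1)] diff_\<kappa>[OF assms(1)] diff_coframe[OF assms(1)]
  have dW: "pd i (W j) x + a i x \<times> W j x = (t \<bullet> \<theta> i x) *\<^sub>R (\<theta> j x - (V x \<bullet> \<theta> j x) *\<^sub>R V x)
      + \<tau> x *\<^sub>R (D\<theta> x i j - (W i x \<bullet> \<theta> j x + V x \<bullet> D\<theta> x i j) *\<^sub>R V x - (V x \<bullet> \<theta> j x) *\<^sub>R W i x)
      + (k \<bullet> \<theta> i x) *\<^sub>R (V x \<times> \<theta> j x) + \<kappa> x *\<^sub>R (W i x \<times> \<theta> j x + V x \<times> D\<theta> x i j)" for i j
  proof -
    have "pd i (W j) x = \<tau> x *\<^sub>R (pd i (\<theta> j) x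
        - ((V x \<bullet> \<theta> j x) *\<^sub>R pd i V x + (V x \<bullet> pd i (\<theta> j) x + pd i V x \<bullet> \<theta> j x) *\<^sub>R V x))
      + pd i \<tau> x *\<^sub>R (\<theta> j x - (V x \<bullet> \<theta> j x) *\<^sub>R V x)
      + (\<kappa> x *\<^sub>R (V x \<times> pd i (\<theta> j) x + pd i V x \<times> \<theta> j x) + pd i \<kappa> x *\<^sub>R (V x \<times> \<theta> j x))"
      unfolding W_def[abs_def]
      by (simp add: pd_add pd_scaleR pd_diff pd_inner pd_cross3 d differentiable_inner
          differentiable_cross3 differentiable_bilinear[OF bounded_bilinear_scaleR] differentiable_diff)
    moreover have "a i x \<times> W j x = \<tau> x *\<^sub>R (a i x \<times> \<theta> j x - (V x \<bullet> \<theta> j x) *\<^sub>R (a i x \<times> V x))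
      + \<kappa> x *\<^sub>R (a i x \<times> (V x \<times> \<theta> j x))"
      by (simp add: W_def cross_add_right Cross3.right_diff_distrib cross_mult_right)
    moreover have "V x \<times> (a i x \<times> \<theta> j x) + (a i x \<times> V x) \<times> \<theta> j x = a i x \<times> (V x \<times> \<theta> j x)"
      by (simp add: Lagrange cross_cross inner_commute algebra_simps)
    moreover have "V x \<bullet> (a i x \<times> \<theta> j x) + (a i x \<times> V x) \<bullet> \<theta> j x = 0"
      by (simp add: coords3 algebra_simps)
    ultimately show ?thesis
      unfolding pd_V[OF assms(1)] pd_coframe pd_density[OF assms(1)] t_def k_def
      by (simp only:) (simp add: coords3 algebra_simps)
  qed
  define S where "S = area x i j"
  have S: "\<theta> i x \<times> \<theta> j x = S" by (simp add: S_def area_def)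
  have 1: "(u \<bullet> \<theta> i x) *\<^sub>R \<theta> j x - (u \<bullet> \<theta> j x) *\<^sub>R \<theta> i x = S \<times> u" for u
    by (simp add: S[symmetric] cross_cross inner_commute)
  have 2: "(t \<bullet> \<theta> i x) * (V x \<bullet> \<theta> j x) - (t \<bullet> \<theta> j x) * (V x \<bullet> \<theta> i x) = S \<bullet> (t \<times> V x)"
    by (simp add: S[symmetric] inner_cross_cross inner_commute)
  have 3: "W i x \<bullet> \<theta> j x - W j x \<bullet> \<theta> i x = 2 * \<kappa> x * (V x \<bullet> S)"
    unfolding S[symmetric] W_def by (simp add: coords3 algebra_simps)
  have 4: "(V x \<bullet> \<theta> i x) *\<^sub>R W j x - (V x \<bullet> \<theta> j x) *\<^sub>R W i x
      = \<tau> x *\<^sub>R (S \<times> V x) + \<kappa> x *\<^sub>R (V x \<times> (S \<times> V x))"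
    unfolding S[symmetric] W_def
    by (simp add: cross_cross cross_add_right Cross3.right_diff_distrib cross_mult_right inner_commute algebra_simps)
  have 5: "W i x \<times> \<theta> j x - W j x \<times> \<theta> i x
      = (2 * \<tau> x) *\<^sub>R S - \<tau> x *\<^sub>R (V x \<times> (S \<times> V x)) - \<kappa> x *\<^sub>R (S \<times> V x)"
    unfolding S[symmetric] W_def by (simp add: coords3 algebra_simps)
  have 6: "S = V x \<times> (S \<times> V x) + (V x \<bullet> S) *\<^sub>R V x"
    by (simp add: Lagrange unit[OF assms(1)])
  have "(pd i (W j) x + a i x \<times> W j x) - (pd j (W i) x + a j x \<times> W i x)
    = ((t \<bullet> \<theta> i x) *\<^sub>R \<theta> j x - (t \<bullet> \<theta> j x) *\<^sub>R \<theta> i x)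
    - ((t \<bullet> \<theta> i x) * (V x \<bullet> \<theta> j x) - (t \<bullet> \<theta> j x) * (V x \<bullet> \<theta> i x)) *\<^sub>R V x
    + \<tau> x *\<^sub>R ((V x \<bullet> \<theta> i x) *\<^sub>R W j x - (V x \<bullet> \<theta> j x) *\<^sub>R W i x
      - (W i x \<bullet> \<theta> j x - W j x \<bullet> \<theta> i x) *\<^sub>R V x)
    + V x \<times> ((k \<bullet> \<theta> i x) *\<^sub>R \<theta> j x - (k \<bullet> \<theta> j x) *\<^sub>R \<theta> i x)
    + \<kappa> x *\<^sub>R (W i x \<times> \<theta> j x - W j x \<times> \<theta> i x)"
    unfolding dW D\<theta>_sym[OF assms(1), of j i]
    by (simp add: Cross3.right_diff_distrib cross_mult_right algebra_simps)
  also have "\<dots> = S \<times> t - (S \<bullet> (t \<times> V x)) *\<^sub>R V x + V x \<times> (S \<times> k)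
    + ((2 * \<tau> x * \<kappa> x) *\<^sub>R (S - (V x \<bullet> S) *\<^sub>R V x) + ((\<tau> x)\<^sup>2 - (\<kappa> x)\<^sup>2) *\<^sub>R (S \<times> V x))"
    unfolding 1 2 3 4 5 by (simp add: algebra_simps power2_eq_square)
  also have "S - (V x \<bullet> S) *\<^sub>R V x = V x \<times> (S \<times> V x)"
    using 6 by (simp add: diff_eq_eq)
  finally have final: "(pd i (W j) x + a i x \<times> W j x) - (pd j (W i) x + a j x \<times> W i x)
    = S \<times> t - (S \<bullet> (t \<times> V x)) *\<^sub>R V x + V x \<times> (S \<times> k)
    + ((2 * \<tau> x * \<kappa> x) *\<^sub>R (V x \<times> (S \<times> V x)) + ((\<tau> x)\<^sup>2 - (\<kappa> x)\<^sup>2) *\<^sub>R (S \<times> V x))" .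
  have "\<Omega> x i j \<times> V x = (pd i (W j) x + a i x \<times> W j x) - (pd j (W i) x + a j x \<times> W i x)"
    using ricci_identity[OF assms(1) smooth_V smooth_W, where c=0 and i=i and j=j] pd_V by simp
  then show ?thesis
    unfolding final S_def by (simp only: add.assoc)
qed

text \<open>The scalar and the vector whose vanishing are the divergence equation and the second monopole
  equation.\<close>

definition div_defect :: "real^3 \<Rightarrow> real \<Rightarrow> real" where
  "div_defect x s = V x \<bullet> grad \<tau> x + (\<tau> x)\<^sup>2 - (\<kappa> x)\<^sup>2 + s / 6"

definition monopole_defect :: "real^3 \<Rightarrow> real^3" where
  "monopole_defect x = grad \<kappa> x - (1/2) *\<^sub>R \<phi> x + grad \<tau> x \<times> V x + (2 * \<tau> x * \<kappa> x) *\<^sub>R V x"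

lemma curvature_congruence:
  assumes "x \<in> U" "curvature_parts x Q s"
  shows "V x \<bullet> monopole_defect x = 0" and "Q = 0 \<longleftrightarrow> div_defect x s = 0 \<and> monopole_defect x = 0"
proof -
  define f where "f S = (Q *v S - (s / 6) *\<^sub>R S + (1/2) *\<^sub>R (\<phi> x \<times> S)) \<times> V x
    - (S \<times> grad \<tau> x - (S \<bullet> (grad \<tau> x \<times> V x)) *\<^sub>R V x + V x \<times> (S \<times> grad \<kappa> x)
    + (2 * \<tau> x * \<kappa> x) *\<^sub>R (V x \<times> (S \<times> V x)) + ((\<tau> x)\<^sup>2 - (\<kappa> x)\<^sup>2) *\<^sub>R (S \<times> V x))" for S
  have "linear f"
    by (rule linearI)
      (simp_all add: f_def matrix_vector_right_distrib matrix_vector_mult_scaleR inner_add_left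
        cross_add_left cross_add_right cross_mult_left cross_mult_right Cross3.left_diff_distrib
        algebra_simps)
  moreover have "f (area x i j) = 0" for i j
    using ricci_congruence_area[OF assms(1), of i j] assms(2) by (simp add: f_def curvature_parts_def)
  ultimately have "f S = 0" for S by (rule area_span[OF assms(1)])
  then have curv: "(Q *v S - (s / 6) *\<^sub>R S + (1/2) *\<^sub>R (\<phi> x \<times> S)) \<times> V x
    = S \<times> grad \<tau> x - (S \<bullet> (grad \<tau> x \<times> V x)) *\<^sub>R V x + V x \<times> (S \<times> grad \<kappa> x)
    + (2 * \<tau> x * \<kappa> x) *\<^sub>R (V x \<times> (S \<times> V x)) + ((\<tau> x)\<^sup>2 - (\<kappa> x)\<^sup>2) *\<^sub>R (S \<times> V x)" for S
    unfolding f_def by simp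
  have Q: "transpose Q = Q" "trace Q = 0" using assms(2) by (auto simp: curvature_parts_def)
  show "V x \<bullet> monopole_defect x = 0" and "Q = 0 \<longleftrightarrow> div_defect x s = 0 \<and> monopole_defect x = 0"
    using congruence_curvature[OF unit[OF assms(1)] Q curv] by (simp_all add: div_defect_def monopole_defect_def)
qed

lemma area_form_eq_iff:
  assumes "x \<in> U" "\<And>i j. f i j - g i j = v \<bullet> area x i j"
  shows "(\<forall>i j. f i j = g i j) \<longleftrightarrow> v = 0"
proof
  assume "\<forall>i j. f i j = g i j"
  then have "v \<bullet> area x i j = 0" for i j using assms(2)[of i j] by simp
  then show "v = 0" by (rule area_nondegenerate[OF assms(1)])
next
  assume "v = 0"
  then show "\<forall>i j. f i j = g i j" using assms(2) by simp
qed

lemma monopole2_area: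
  assumes "x \<in> U"
  shows "(\<forall>i j. grad \<kappa> x \<bullet> area x i j
      = (1/2) * F x i j - (pd i (\<lambda>y. \<tau> y * (V y \<bullet> \<theta> j y)) x - pd j (\<lambda>y. \<tau> y * (V y \<bullet> \<theta> i y)) x))
    \<longleftrightarrow> monopole_defect x = 0"
  by (rule area_form_eq_iff[OF assms])
    (simp add: ext_d_one_form[OF assms diff_\<tau>[OF assms]] F_eq[OF assms] monopole_defect_def
      inner_add inner_diff algebra_simps)

text \<open>The left hand side says \<open>c V = m \<times> V\<close> for the two defects \<open>c\<close> and \<open>m\<close>. Its component along \<open>V\<close> is
  \<open>c = 0\<close>; then \<open>m \<times> V = 0\<close>, so that \<open>m\<close>, being orthogonal to \<open>V\<close>, vanishes as well.\<close>

lemma monopole1_area: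
  assumes "x \<in> U" and orth: "V x \<bullet> monopole_defect x = 0"
  shows "(\<forall>i j. grad \<tau> x \<bullet> area x i j
      = - (1/2) * ((\<phi> x \<times> V x) \<bullet> area x i j) - (s / 6) * (V x \<bullet> area x i j)
        - ((\<tau> x)\<^sup>2 + (\<kappa> x)\<^sup>2) * (V x \<bullet> area x i j)
        + (pd i (\<lambda>y. \<kappa> y * (V y \<bullet> \<theta> j y)) x - pd j (\<lambda>y. \<kappa> y * (V y \<bullet> \<theta> i y)) x))
    \<longleftrightarrow> div_defect x s = 0 \<and> monopole_defect x = 0" (is "?lhs \<longleftrightarrow> _")
proof -
  have cross_V: "monopole_defect x \<times> V x = grad \<kappa> x \<times> V x - (1/2) *\<^sub>R (\<phi> x \<times> V x)
      + (V x \<bullet> grad \<tau> x) *\<^sub>R V x - grad \<tau> x"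
    by (simp add: monopole_defect_def cross_add_left Cross3.left_diff_distrib cross_mult_left cross_cross
        unit[OF assms(1)] inner_commute)
  have "?lhs \<longleftrightarrow> div_defect x s *\<^sub>R V x - monopole_defect x \<times> V x = 0"
    unfolding ext_d_one_form[OF assms(1) diff_\<kappa>[OF assms(1)]]
    by (rule area_form_eq_iff[OF assms(1)])
      (simp add: cross_V div_defect_def inner_add inner_diff algebra_simps power2_eq_square)
  moreover have "div_defect x s *\<^sub>R V x - monopole_defect x \<times> V x = 0 \<longleftrightarrow> div_defect x s = 0 \<and> monopole_defect x = 0"
  proof
    assume 0: "div_defect x s *\<^sub>R V x - monopole_defect x \<times> V x = 0"
    then have "(div_defect x s *\<^sub>R V x - monopole_defect x \<times> V x) \<bullet> V x = 0" by simp
    then have "div_defect x s = 0" by (simp add: inner_diff unit[OF assms(1)] dot_cross_self)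
    with 0 have "V x \<times> (monopole_defect x \<times> V x) = 0" by simp
    then show "div_defect x s = 0 \<and> monopole_defect x = 0"
      using \<open>div_defect x s = 0\<close> by (simp add: Lagrange unit[OF assms(1)] orth)
  qed simp
  ultimately show ?thesis by simp
qed

text \<open>
  The vector \<open>q\<close> represents the right hand side of the first monopole equation without the exact term
  \<open>d(\<kappa>\<chi>)\<close>. Its derivative splits as \<open>b + g\<close>, where \<open>b\<close> contains the derivatives of \<open>\<phi>\<close> and \<open>s\<close> and \<open>g\<close> those
  of \<open>V\<close>, \<open>\<tau>\<close> and \<open>\<kappa>\<close>. The cyclic sum of \<open>b\<close> vanishes by the second Bianchi identity, evaluated on \<open>V\<close>;
  that of \<open>g\<close> is computed by \<open>congruence_divergence\<close> and vanishes by the equations for \<open>V \<bullet> t\<close> and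
  \<open>V \<bullet> k\<close>.
\<close>

lemma monopole1_closed:
  assumes "x \<in> U" and s: "smooth_on U s"
    and ew: "\<And>y. y \<in> U \<Longrightarrow> curvature_parts y 0 (s y)"
  defines "q \<equiv> \<lambda>y. - (1/2) *\<^sub>R (\<phi> y \<times> V y) - (s y / 6 + (\<tau> y)\<^sup>2 + (\<kappa> y)\<^sup>2) *\<^sub>R V y"
  shows "pd i (\<lambda>y. q y \<bullet> area y j k) x + pd j (\<lambda>y. q y \<bullet> area y k i) x
    + pd k (\<lambda>y. q y \<bullet> area y i j) x = 0"
proof -
  note d = diff_V[OF assms(1)] diff_\<tau>[OF assms(1)] diff_\<kappa>[OF assms(1)] diff_conn[OF assms(1)]
    smooth_on_differentiable[OF smooth_\<phi> assms(1)] smooth_on_differentiable[OF s assms(1)]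
    differentiable_cross3 differentiable_bilinear[OF bounded_bilinear_scaleR] differentiable_diff
    differentiable_linear[OF bounded_linear_divide] differentiable_linear[OF bounded_linear_scaleR_right]
    differentiable_add differentiable_power
  \<comment> \<open>In the coframe \<open>\<phi>\<close> has weight \<open>-2\<close>, like the scalar curvature, because area vectors have weight 2.\<close>
  define \<phi>' where "\<phi>' i = pd i \<phi> x + a i x \<times> \<phi> x - (2 * w i x) *\<^sub>R \<phi> x" for i
  define s' where "s' i = pd i s x - 2 * w i x * s x" for i
  define b where "b i = (1/2) *\<^sub>R (V x \<times> \<phi>' i) - (s' i / 6) *\<^sub>R V x" for i
  define c where "c = s x / 6 + (\<tau> x)\<^sup>2 + (\<kappa> x)\<^sup>2"
  define g where "g i = - (1/2) *\<^sub>R (\<phi> x \<times> W i x)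
    - (2 * \<tau> x * (grad \<tau> x \<bullet> \<theta> i x) + 2 * \<kappa> x * (grad \<kappa> x \<bullet> \<theta> i x)) *\<^sub>R V x - c *\<^sub>R W i x" for i
  have m: "div_defect x (s x) = 0" "monopole_defect x = 0"
    using curvature_congruence(2)[OF assms(1) ew[OF assms(1)]] by auto
  have smq: "smooth_on U q"
    unfolding q_def power2_eq_square divide_inverse
    by (intro smooth_on_diff smooth_on_add smooth_on_scaleR smooth_on_mult smooth_on_cross3
        smooth_on_const smooth_V smooth_\<tau> smooth_\<kappa> smooth_\<phi> s U)
  have dq: "pd i q x + a i x \<times> q x - (2 * w i x) *\<^sub>R q x = b i + g i" for i
  proof -
    have p: "pd i q x = - (1/2) *\<^sub>R (\<phi> x \<times> pd i V x + pd i \<phi> x \<times> V x) - (c *\<^sub>R pd i V x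
      + (pd i s x / 6 + 2 * \<tau> x * pd i \<tau> x + 2 * \<kappa> x * pd i \<kappa> x) *\<^sub>R V x)"
      unfolding q_def c_def power2_eq_square
      by (simp add: pd_minus pd_add pd_scaleR pd_diff pd_cross3 pd_mult pd_linear[OF bounded_linear_divide]
          pd_linear[OF bounded_linear_scaleR_right] d)
    show ?thesis
      unfolding p unfolding pd_V[OF assms(1)] pd_density[OF assms(1)] b_def g_def \<phi>'_def s'_def q_def c_def
      by (simp add: coords3 algebra_simps power2_eq_square) (simp add: field_simps)
  qed
  have bianchi: "b i \<bullet> area x j k + b j \<bullet> area x k i + b k \<bullet> area x i j = 0"
  proof -
    \<comment> \<open>\<open>V\<close> is evaluated at the fixed point \<open>x\<close>, so that only curvature is differentiated.\<close>
    define Y where "Y y = (1/2) *\<^sub>R (V x \<times> \<phi> y) - (s y / 6) *\<^sub>R V x" for y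
    have smY: "smooth_on U Y"
      unfolding Y_def divide_inverse
      by (intro smooth_on_diff smooth_on_scaleR smooth_on_mult smooth_on_cross3 smooth_on_const
          smooth_\<phi> s U)
    have dY: "pd l Y x = (1/2) *\<^sub>R (V x \<times> pd l \<phi> x) - (pd l s x / 6) *\<^sub>R V x" for l
      unfolding Y_def
      by (simp add: pd_diff pd_scaleR pd_cross3 pd_linear[OF bounded_linear_divide]
          pd_linear[OF bounded_linear_scaleR_right] d)
    have \<Omega>: "\<Omega> y m n = (1/2) *\<^sub>R (\<phi> y \<times> area y m n) - (s y / 6) *\<^sub>R area y m n" if "y \<in> U" for y m n
      using ew[OF that] by (simp add: curvature_parts_def)
    have eq: "Y y \<bullet> area y m n = V x \<bullet> \<Omega> y m n" if "y \<in> U" for y m n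
      using cross_triple[of "V x" "\<phi> y" "area y m n"]
      by (simp add: \<Omega>[OF that] Y_def inner_diff inner_commute)
    have sm\<Omega>: "smooth_on U (\<lambda>y. \<Omega> y m n)" for m n
      unfolding \<Omega>_def by (intro smooth_on_add smooth_on_diff smooth_on_pd smooth_on_cross3 smooth_conn U)
    have pdY: "pd l (\<lambda>y. Y y \<bullet> area y m n) x = V x \<bullet> pd l (\<lambda>y. \<Omega> y m n) x" for l m n
    proof -
      have "pd l (\<lambda>y. Y y \<bullet> area y m n) x = pd l (\<lambda>y. V x \<bullet> \<Omega> y m n) x"
        by (rule pd_cong_open[OF U assms(1) eq])
      also have "\<dots> = V x \<bullet> pd l (\<lambda>y. \<Omega> y m n) x"
        by (rule pd_linear[OF bounded_linear_inner_right smooth_on_differentiable[OF sm\<Omega> assms(1)]])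
      finally show ?thesis .
    qed
    have step: "(pd l Y x + a l x \<times> Y x - (2 * w l x) *\<^sub>R Y x) \<bullet> area x m n + V x \<bullet> (a l x \<times> \<Omega> x m n)
      = b l \<bullet> area x m n" for l m n
      unfolding dY Y_def b_def \<phi>'_def s'_def \<Omega>[OF assms(1)]
      by (simp add: coords3 algebra_simps) (simp add: field_simps)
    have "V x \<bullet> ((pd i (\<lambda>y. \<Omega> y j k) x + a i x \<times> \<Omega> x j k)
        + (pd j (\<lambda>y. \<Omega> y k i) x + a j x \<times> \<Omega> x k i)
        + (pd k (\<lambda>y. \<Omega> y i j) x + a k x \<times> \<Omega> x i j)) = 0"
      unfolding second_bianchi[OF assms(1)] by simp
    then show ?thesis
      using ext_d_area[OF assms(1) smY, of i j k] step[of i j k] step[of j k i] step[of k i j]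
      unfolding pdY inner_add_right by linarith
  qed
  have "g i \<bullet> area x j k + g j \<bullet> area x k i + g k \<bullet> area x i j
      = (\<theta> i x \<bullet> area x j k) * (\<kappa> x * (V x \<bullet> \<phi> x) - 2 * \<tau> x * (V x \<bullet> grad \<tau> x)
        - 2 * \<kappa> x * (V x \<bullet> grad \<kappa> x) - 2 * \<tau> x * c)"
    unfolding area_def g_def W_def by (rule congruence_divergence[OF unit[OF assms(1)]])
  also have "\<dots> = 0"
  proof -
    have t: "V x \<bullet> grad \<tau> x = (\<kappa> x)\<^sup>2 - (\<tau> x)\<^sup>2 - s x / 6" using m(1) by (simp add: div_defect_def)
    have "V x \<bullet> monopole_defect x = 0" using m(2) by simp
    then have k: "V x \<bullet> grad \<kappa> x = (1/2) * (V x \<bullet> \<phi> x) - 2 * \<tau> x * \<kappa> x"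
      by (simp add: monopole_defect_def inner_add inner_diff dot_cross_self unit[OF assms(1)])
    show ?thesis unfolding t k c_def by (simp add: algebra_simps power2_eq_square)
  qed
  finally show ?thesis
    unfolding ext_d_area[OF assms(1) smq] dq using bianchi by (simp add: inner_add_left)
qed

end


section \<open>Cholesky coframes\<close>

text \<open>A smooth orthonormal coframe is a smooth matrix function \<open>P\<close> with \<open>transpose P ** P = G\<close>. The
  triangular solution has entries that are explicit smooth functions of those of \<open>G\<close>; \<open>m\<close> is the
  second leading minor.\<close>

definition cholesky :: "real^3^3 \<Rightarrow> real^3^3" where
  "cholesky G = (let m = G $ 1 $ 1 * G $ 2 $ 2 - G $ 1 $ 2 * G $ 1 $ 2; p = sqrt (G $ 1 $ 1); q = sqrt (m / G $ 1 $ 1) in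
    vector [vector [p, G $ 1 $ 2 / p, G $ 1 $ 3 / p],
      vector [0, q, (G $ 2 $ 3 - G $ 1 $ 2 * G $ 1 $ 3 / G $ 1 $ 1) / q],
      vector [0, 0, sqrt (det G / m)]])"

lemma symmetric_entries:
  assumes "transpose (G :: real^3^3) = G"
  shows "G $ 2 $ 1 = G $ 1 $ 2" "G $ 3 $ 1 = G $ 1 $ 3" "G $ 3 $ 2 = G $ 2 $ 3"
proof -
  have "G $ i $ j = G $ j $ i" for i j
    using arg_cong[OF assms, of "\<lambda>M. M $ j $ i"] by (simp add: transpose_def)
  then show "G $ 2 $ 1 = G $ 1 $ 2" "G $ 3 $ 1 = G $ 1 $ 3" "G $ 3 $ 2 = G $ 2 $ 3" by blast+
qed

lemma positive_minors:
  assumes sym: "transpose (G :: real^3^3) = G" and pos: "\<And>v. v \<noteq> 0 \<Longrightarrow> v \<bullet> (G *v v) > 0"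
  shows "G $ 1 $ 1 > 0" and "G $ 1 $ 1 * G $ 2 $ 2 - G $ 1 $ 2 * G $ 1 $ 2 > 0" and "det G > 0"
proof -
  note G = symmetric_entries[OF sym]
  let ?m = "G $ 1 $ 1 * G $ 2 $ 2 - G $ 1 $ 2 * G $ 1 $ 2"
  have "vector [1, 0, 0] \<bullet> (G *v vector [1, 0, 0]) > 0"
    by (rule pos) (simp add: vec_eq_iff forall_3)
  then show 1: "G $ 1 $ 1 > 0" by (simp add: inner_vec_def sum_3 matrix_vector_mult_def)
  have "vector [- (G $ 1 $ 2), G $ 1 $ 1, 0] \<bullet> (G *v vector [- (G $ 1 $ 2), G $ 1 $ 1, 0]) > 0"
    using 1 by (intro pos) (simp add: vec_eq_iff forall_3)
  then have "G $ 1 $ 1 * ?m > 0"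
    by (simp add: inner_vec_def sum_3 matrix_vector_mult_def G algebra_simps)
  then show 2: "?m > 0" using 1 by (simp add: zero_less_mult_iff)
  \<comment> \<open>\<open>?v\<close> is the last column of the adjugate, which \<open>G\<close> maps to \<open>(0, 0, det G)\<close>.\<close>
  let ?v = "vector [G $ 1 $ 2 * G $ 2 $ 3 - G $ 1 $ 3 * G $ 2 $ 2, G $ 1 $ 2 * G $ 1 $ 3 - G $ 1 $ 1 * G $ 2 $ 3, ?m] :: real^3"
  have "?v \<bullet> (G *v ?v) > 0"
    using 2 by (intro pos) (simp add: vec_eq_iff forall_3)
  moreover have "?v \<bullet> (G *v ?v) = ?m * det G"
    by (simp add: inner_vec_def sum_3 matrix_vector_mult_def det_3 G algebra_simps)
  ultimately show "det G > 0" using 2 by (simp add: zero_less_mult_iff)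
qed

lemma cholesky:
  assumes sym: "transpose (G :: real^3^3) = G" and pos: "\<And>v. v \<noteq> 0 \<Longrightarrow> v \<bullet> (G *v v) > 0"
  shows "transpose (cholesky G) ** cholesky G = G" and "det (cholesky G) > 0"
proof -
  note G = symmetric_entries[OF sym]
  define m where "m = G $ 1 $ 1 * G $ 2 $ 2 - G $ 1 $ 2 * G $ 1 $ 2"
  have g: "G $ 1 $ 1 > 0" and m: "m > 0" and d: "det G > 0"
    using positive_minors(1)[OF assms] positive_minors(2)[OF assms] positive_minors(3)[OF assms]
    by (simp_all add: m_def)
  define p q r where "p = sqrt (G $ 1 $ 1)" and "q = sqrt (m / G $ 1 $ 1)" and "r = sqrt (det G / m)"
  have pos: "p > 0" "q > 0" "r > 0" using g m d by (simp_all add: p_def q_def r_def)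
  have sq: "p * p = G $ 1 $ 1" "q * q = m / G $ 1 $ 1" "r * r = det G / m"
    using g m d by (simp_all add: p_def q_def r_def)
  have C: "cholesky G = vector [vector [p, G $ 1 $ 2 / p, G $ 1 $ 3 / p],
      vector [0, q, (G $ 2 $ 3 - G $ 1 $ 2 * G $ 1 $ 3 / G $ 1 $ 1) / q], vector [0, 0, r]]"
    by (simp add: cholesky_def p_def q_def r_def m_def Let_def)
  show "det (cholesky G) > 0" using pos by (simp add: C det_3)
  have det: "det G = G $ 3 $ 3 * m - G $ 1 $ 1 * G $ 2 $ 3 * G $ 2 $ 3 + 2 * G $ 1 $ 2 * G $ 1 $ 3 * G $ 2 $ 3
      - G $ 2 $ 2 * G $ 1 $ 3 * G $ 1 $ 3"
    by (simp add: det_3 G m_def algebra_simps)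
  have m': "m = G $ 1 $ 1 * G $ 2 $ 2 - G $ 1 $ 2 * G $ 1 $ 2" by (rule m_def)
  have 22: "G $ 1 $ 2 * G $ 1 $ 2 / (p * p) + q * q = G $ 2 $ 2"
    using g by (simp add: sq m' field_simps)
  have 33: "G $ 1 $ 3 * G $ 1 $ 3 / (p * p)
      + (G $ 2 $ 3 - G $ 1 $ 2 * G $ 1 $ 3 / G $ 1 $ 1) * (G $ 2 $ 3 - G $ 1 $ 2 * G $ 1 $ 3 / G $ 1 $ 1) / (q * q)
      + r * r = G $ 3 $ 3"
  proof -
    define u where "u = G $ 1 $ 1 * G $ 2 $ 3 - G $ 1 $ 2 * G $ 1 $ 3"
    have u: "G $ 2 $ 3 - G $ 1 $ 2 * G $ 1 $ 3 / G $ 1 $ 1 = u / G $ 1 $ 1"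
      using g by (simp add: u_def field_simps)
    have "G $ 1 $ 3 * G $ 1 $ 3 * m + u * u + G $ 1 $ 1 * det G = G $ 1 $ 1 * (G $ 3 $ 3 * m)"
      unfolding det u_def m' by algebra
    then have "(G $ 1 $ 3 * G $ 1 $ 3 * m + u * u + G $ 1 $ 1 * det G) / (G $ 1 $ 1 * m) = G $ 3 $ 3"
      using g m by simp
    moreover have "G $ 1 $ 3 * G $ 1 $ 3 / (p * p) + u / G $ 1 $ 1 * (u / G $ 1 $ 1) / (q * q) + r * r
        = (G $ 1 $ 3 * G $ 1 $ 3 * m + u * u + G $ 1 $ 1 * det G) / (G $ 1 $ 1 * m)"
      using g m by (simp add: sq add_divide_distrib)
    ultimately show ?thesis unfolding u by simp
  qed
  have 23: "G $ 1 $ 2 * G $ 1 $ 3 / (p * p) = G $ 1 $ 2 * G $ 1 $ 3 / G $ 1 $ 1" by (simp add: sq)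
  show "transpose (cholesky G) ** cholesky G = G"
    unfolding C using pos 22 33 23
    by (simp add: vec_eq_iff forall_3 matrix_matrix_mult_def transpose_def sum_3 G sq(1))
qed

lemma smooth_cholesky:
  assumes U: "open U" and G: "smooth_on U G"
    and sym: "\<And>x. x \<in> U \<Longrightarrow> transpose (G x) = G x"
    and pos: "\<And>x v. x \<in> U \<Longrightarrow> v \<noteq> 0 \<Longrightarrow> v \<bullet> (G x *v v) > 0"
  shows "smooth_on U (\<lambda>x. cholesky (G x))"
proof -
  have g: "smooth_on U (\<lambda>x. G x $ i $ j)" for i j by (intro smooth_on_nth U G)
  have d: "smooth_on U (\<lambda>x. det (G x))"
    unfolding det_3 by (intro smooth_on_add smooth_on_diff smooth_on_mult g U)
  note minors = positive_minors[OF sym pos]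
  have "smooth_on U (\<lambda>x. cholesky (G x) $ i $ j)" for i j
    using exhaust_3[of i] exhaust_3[of j] minors
    by (elim disjE) (simp_all add: cholesky_def Let_def,
      (intro smooth_on_add smooth_on_diff smooth_on_mult smooth_on_divide smooth_on_sqrt
        smooth_on_const g d U; force simp: zero_less_divide_iff)+)
  then show ?thesis by (intro smooth_on_vec U)
qed


section \<open>Weyl spaces in a chart\<close>

lemma bounded_bilinear_matrix_vector: "bounded_bilinear ((*v) :: real^3^3 \<Rightarrow> real^3 \<Rightarrow> real^3)"
  by (simp add: bilinear_conv_bounded_bilinear[symmetric] bilinear_def linear_iff
      matrix_vector_mult_add_rdistrib matrix_vector_right_distrib matrix_vector_mult_scaleR
      scaleR_matrix_vector_assoc[symmetric])

lemma bounded_bilinear_matrix_mult: "bounded_bilinear ((**) :: real^3^3 \<Rightarrow> real^3^3 \<Rightarrow> real^3^3)"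
  by (simp add: bilinear_conv_bounded_bilinear[symmetric] bilinear_def linear_iff
      matrix_matrix_mult_def vec_eq_iff sum_3 algebra_simps)

lemma inner_vector_matrix: "u \<bullet> (v v* M) = (M *v u) \<bullet> v" for u v :: "real^3"
  using dot_lmul_matrix[of v M u] by (simp add: inner_commute)

lemmas pd_matrix_vector = pd_bilinear[OF bounded_bilinear_matrix_vector]
lemmas differentiable_matrix_vector = differentiable_bilinear[OF bounded_bilinear_matrix_vector]
lemmas smooth_on_matrix_vector = smooth_on_bilinear[OF _ bounded_bilinear_matrix_vector]

text \<open>The vector whose cross product is a given skew matrix.\<close>

definition axial :: "real^3^3 \<Rightarrow> real^3" where
  "axial M = vector [M $ 3 $ 2, M $ 1 $ 3, M $ 2 $ 1]"

lemma axial_cross: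
  assumes "\<And>u v. (M *v u) \<bullet> v = - (u \<bullet> (M *v v))"
  shows "axial M \<times> v = M *v v"
proof -
  have e: "M $ l $ k = - M $ k $ l" for k l
    using assms[of "axis k 1" "axis l 1"]
    by (simp add: matrix_vector_mult_basis column_def inner_axis inner_axis')
  have z: "M $ k $ k = 0" for k using e[of k k] by simp
  show ?thesis
    using e[of 1 2] e[of 1 3] e[of 2 3] z by (simp add: axial_def coords3 matrix_vector_mult_def)
qed

lemma invertible_3x3_inv:
  assumes "invertible (A :: real^3^3)"
  shows "matrix_inv A *v (A *v v) = v" "A *v (matrix_inv A *v v) = v"
  using someI_ex[of "\<lambda>A'. A ** A' = mat 1 \<and> A' ** A = mat 1"] assms
  by (simp_all add: matrix_vector_mul_assoc invertible_def matrix_inv_def)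

text \<open>The rows of the adjugate of a matrix are the cross products of its columns.\<close>

lemma smooth_matrix_inv:
  assumes U: "open U" and P: "smooth_on U P" and det: "\<And>x. x \<in> U \<Longrightarrow> det (P x :: real^3^3) \<noteq> 0"
  shows "smooth_on U (\<lambda>x. matrix_inv (P x))"
proof -
  let ?c = "\<lambda>x k. P x *v axis k 1"
  define n where "n x = (vector [?c x 2 \<times> ?c x 3, ?c x 3 \<times> ?c x 1, ?c x 1 \<times> ?c x 2] :: real^3^3)" for x
  have n: "n x ** P x = det (P x) *\<^sub>R mat 1" for x
    by (simp add: n_def vec_eq_iff forall_3 matrix_vector_mult_basis column_def cross_components
        matrix_matrix_mult_def sum_3 mat_def det_3 algebra_simps)
  have "matrix_inv (P x) = inverse (det (P x)) *\<^sub>R n x" if "x \<in> U" for x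
  proof -
    have inv: "invertible (P x)" using det[OF that] by (simp add: invertible_det_nz)
    have "matrix_inv (P x) *v v = (inverse (det (P x)) *\<^sub>R n x) *v v" for v
    proof -
      have "n x *v v = (n x ** P x) *v (matrix_inv (P x) *v v)"
        by (simp add: matrix_vector_mul_assoc[symmetric] invertible_3x3_inv[OF inv])
      then show ?thesis
        using det[OF that] by (simp add: n scaleR_matrix_vector_assoc[symmetric])
    qed
    then show ?thesis by (simp add: matrix_eq)
  qed
  moreover have "smooth_on U (\<lambda>x. inverse (det (P x)) *\<^sub>R n x)"
  proof (intro smooth_on_scaleR smooth_on_inverse U det)
    show "smooth_on U (\<lambda>x. det (P x))"
      unfolding det_3 by (intro smooth_on_add smooth_on_diff smooth_on_mult smooth_on_nth U P)
    have "smooth_on U (\<lambda>x. n x $ k)" for k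
      using exhaust_3[of k]
      by (auto simp: n_def intro!: smooth_on_cross3 smooth_on_matrix_vector smooth_on_const U P)
    then show "smooth_on U n" by (rule smooth_on_vec[OF U])
  qed
  ultimately show ?thesis by (rule smooth_on_cong[OF U])
qed

locale weyl_chart =
  fixes B :: "'b::{t2_space,second_countable_topology} weyl_data" and c :: "'b chart"
  assumes weyl_space: "oriented_weyl_space B" and chart: "c \<in> charts B"
begin

abbreviation "U \<equiv> coords c"
abbreviation "G \<equiv> conf B c"
abbreviation "A x i \<equiv> conn B (-1) c x $ i"

text \<open>\<open>P x\<close> maps components with respect to the coordinate frame to components in an orthonormal frame;
  \<open>conn_matrix\<close> is the connection \<open>A\<close> after this change of frame.\<close>

definition P :: "real^3 \<Rightarrow> real^3^3" where "P x = cholesky (G x)"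
definition E :: "real^3 \<Rightarrow> real^3^3" where "E x = matrix_inv (P x)"
definition \<theta> :: "3 \<Rightarrow> real^3 \<Rightarrow> real^3" where "\<theta> j x = P x *v axis j 1"
definition w :: "3 \<Rightarrow> real^3 \<Rightarrow> real" where "w i x = weyl B c x $ i"
definition conn_matrix :: "3 \<Rightarrow> real^3 \<Rightarrow> real^3^3" where
  "conn_matrix i x = (P x ** A x i - pd i P x) ** E x"
definition a :: "3 \<Rightarrow> real^3 \<Rightarrow> real^3" where "a i x = axial (conn_matrix i x)"

lemma open_U: "open U"
  using weyl_space chart by (simp add: oriented_weyl_space_def oriented_atlas_def)

lemma smooth_conf: "smooth_on U G"
  and smooth_weyl_form: "smooth_on U (weyl B c)"
  and smooth_tconn: "smooth_on U (tconn B c)"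
  using weyl_space chart
  by (simp_all add: oriented_weyl_space_def conformal_structure_def weyl_derivative_def
      tangent_connection_def smooth_field_def)

lemma conf_symmetric: "x \<in> U \<Longrightarrow> transpose (G x) = G x"
  and conf_positive: "x \<in> U \<Longrightarrow> v \<noteq> 0 \<Longrightarrow> v \<bullet> (G x *v v) > 0"
  using weyl_space chart by (simp_all add: oriented_weyl_space_def conformal_structure_def)

lemma conn_eq: "A x i = tconn B c x $ i - w i x *\<^sub>R mat 1"
  by (simp add: conn_def w_def)

lemma smooth_A: "smooth_on U (\<lambda>x. A x i)"
  unfolding conn_eq w_def
  by (intro smooth_on_diff smooth_on_scaleR smooth_on_nth smooth_on_const smooth_tconn
      smooth_weyl_form open_U)

lemma tconn_symmetric: "x \<in> U \<Longrightarrow> tconn B c x $ i *v axis j 1 = tconn B c x $ j *v axis i 1"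
  using weyl_space chart by (simp add: oriented_weyl_space_def torsion_free_def)

lemma pd_conf: "x \<in> U \<Longrightarrow> pd i G x = transpose (A x i) ** G x + G x ** A x i"
proof -
  assume "x \<in> U"
  then have h1: "pd i G x + (2 * w i x) *\<^sub>R G x - transpose (tconn B c x $ i) ** G x - G x ** tconn B c x $ i = 0"
    using weyl_space chart by (simp add: oriented_weyl_space_def preserves_conf_def w_def)
  have h2: "transpose (A x i) ** G x + G x ** A x i
      = transpose (tconn B c x $ i) ** G x + G x ** tconn B c x $ i - (2 * w i x) *\<^sub>R G x"
    unfolding conn_eq
    by (simp add: vec_eq_iff forall_3 matrix_matrix_mult_def transpose_def sum_3 mat_def algebra_simps)
  have h3: "D + S - Y - Z = 0 \<Longrightarrow> Y + Z - S = D" for D S Y Z :: "real^3^3"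
    by (simp add: diff_eq_eq add.commute)
  show ?thesis unfolding h2 by (rule h3[OF h1, symmetric])
qed

lemma P_conf: "x \<in> U \<Longrightarrow> transpose (P x) ** P x = G x"
  and det_P: "x \<in> U \<Longrightarrow> det (P x) > 0"
  unfolding P_def using cholesky conf_symmetric conf_positive by blast+

lemma smooth_P: "smooth_on U P"
  unfolding P_def[abs_def]
  using smooth_cholesky[OF open_U smooth_conf conf_symmetric conf_positive] .

lemma diff_P: "x \<in> U \<Longrightarrow> P differentiable (at x)"
  and diff_A: "x \<in> U \<Longrightarrow> (\<lambda>x. A x i) differentiable (at x)"
  using smooth_on_differentiable smooth_P smooth_A by blast+

lemma PE: "x \<in> U \<Longrightarrow> P x *v (E x *v v) = v" and EP: "x \<in> U \<Longrightarrow> E x *v (P x *v v) = v"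
  using det_P[of x] unfolding E_def by (simp_all add: invertible_3x3_inv invertible_det_nz)

lemma smooth_E: "smooth_on U E"
  unfolding E_def[abs_def] by (rule smooth_matrix_inv[OF open_U smooth_P]) (use det_P in force)

lemma inner_P: "x \<in> U \<Longrightarrow> (P x *v u) \<bullet> (P x *v v) = u \<bullet> (G x *v v)"
  by (simp add: P_conf[symmetric] matrix_vector_mul_assoc[symmetric] inner_vector_matrix)

lemma conn_matrix_P: "x \<in> U \<Longrightarrow> conn_matrix i x *v (P x *v v) = P x *v (A x i *v v) - pd i P x *v v"
  by (simp add: conn_matrix_def matrix_vector_mul_assoc[symmetric] EP matrix_vector_mult_diff_rdistrib)

text \<open>Differentiating \<open>P u \<bullet> P v = \<langle>u, v\<rangle>\<close> for constant \<open>u\<close>, \<open>v\<close> shows that the connection matrix is skew in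
  the orthonormal frame, hence a cross product.\<close>

lemma a_cross_P:
  assumes "x \<in> U"
  shows "a i x \<times> (P x *v v) = P x *v (A x i *v v) - pd i P x *v v"
proof -
  have "pd i (\<lambda>y. (P y *v u) \<bullet> (P y *v v)) x = pd i (\<lambda>y. u \<bullet> (G y *v v)) x" for u v
    by (rule pd_cong_open[OF open_U assms inner_P])
  moreover have "pd i (\<lambda>y. (P y *v u) \<bullet> (P y *v v)) x
      = (P x *v u) \<bullet> (pd i P x *v v) + (pd i P x *v u) \<bullet> (P x *v v)" for u v
    by (simp add: pd_inner pd_matrix_vector differentiable_matrix_vector diff_P[OF assms])
  moreover have "pd i (\<lambda>y. u \<bullet> (G y *v v)) x = u \<bullet> (pd i G x *v v)" for u v
  proof -
    have G: "G differentiable (at x)" using smooth_on_differentiable[OF smooth_conf assms] .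
    show ?thesis by (simp add: pd_inner pd_matrix_vector differentiable_matrix_vector G)
  qed
  moreover have "u \<bullet> (pd i G x *v v) = (P x *v (A x i *v u)) \<bullet> (P x *v v) + (P x *v u) \<bullet> (P x *v (A x i *v v))" for u v
    unfolding inner_P[OF assms] pd_conf[OF assms] matrix_vector_mult_add_rdistrib inner_add_right
    by (simp add: matrix_vector_mul_assoc[symmetric] inner_vector_matrix)
  ultimately have P: "(P x *v u) \<bullet> (pd i P x *v v) + (pd i P x *v u) \<bullet> (P x *v v)
    = (P x *v (A x i *v u)) \<bullet> (P x *v v) + (P x *v u) \<bullet> (P x *v (A x i *v v))" for u v
    by simp
  have "(conn_matrix i x *v u) \<bullet> v = - (u \<bullet> (conn_matrix i x *v v))" for u v
    using P[of "E x *v u" "E x *v v"] conn_matrix_P[OF assms, of i "E x *v u"]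
      conn_matrix_P[OF assms, of i "E x *v v"]
    by (simp add: PE[OF assms] inner_diff)
  from axial_cross[OF this] show ?thesis
    by (simp add: a_def conn_matrix_P[OF assms])
qed

sublocale weyl_coframe U \<theta> a w
proof
  show "open U" by (rule open_U)
  show "smooth_on U (\<theta> j)" for j
    unfolding \<theta>_def[abs_def] by (intro smooth_on_matrix_vector smooth_on_const smooth_P open_U)
  show "smooth_on U (w i)" for i
    unfolding w_def[abs_def] by (intro smooth_on_nth smooth_weyl_form open_U)
  show "smooth_on U (a i)" for i
  proof -
    have "smooth_on U (conn_matrix i)"
      unfolding conn_matrix_def[abs_def]
      by (intro smooth_on_bilinear[OF _ bounded_bilinear_matrix_mult] smooth_on_diff smooth_on_pd
          smooth_P smooth_A smooth_E open_U)
    then have "smooth_on U (\<lambda>x. conn_matrix i x $ k $ l)" for k l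
      by (intro smooth_on_nth open_U)
    then have "smooth_on U (\<lambda>x. a i x $ k)" for k
      using exhaust_3[of k] by (auto simp: a_def axial_def)
    then show ?thesis by (rule smooth_on_vec[OF open_U])
  qed
  fix x assume x: "x \<in> U"
  have "pd i (\<theta> j) x + a i x \<times> \<theta> j x + w i x *\<^sub>R \<theta> j x = P x *v (tconn B c x $ i *v axis j 1)" for i j
  proof -
    have "pd i (\<theta> j) x = pd i P x *v axis j 1"
      unfolding \<theta>_def[abs_def] by (simp add: pd_matrix_vector diff_P[OF x])
    then show ?thesis
      by (simp add: \<theta>_def a_cross_P[OF x] conn_eq matrix_vector_mult_diff_rdistrib
          matrix_vector_mult_diff_distrib matrix_vector_mult_scaleR scaleR_matrix_vector_assoc[symmetric])
  qed
  then show "pd i (\<theta> j) x + a i x \<times> \<theta> j x + w i x *\<^sub>R \<theta> j x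
    = pd j (\<theta> i) x + a j x \<times> \<theta> i x + w j x *\<^sub>R \<theta> i x" for i j
    by (simp add: tconn_symmetric[OF x, of i j])
  have "\<theta> 1 x \<bullet> (\<theta> 2 x \<times> \<theta> 3 x) = det (P x)"
    by (simp add: \<theta>_def matrix_vector_mult_basis column_def coords3 det_3 algebra_simps)
  then show "\<theta> 1 x \<bullet> (\<theta> 2 x \<times> \<theta> 3 x) > 0" using det_P[OF x] by simp
qed

text \<open>\<open>P *v v\<close> for constant \<open>v\<close> is a field whose covariant derivative is \<open>P *v (A *v v)\<close>, so its Ricci
  identity compares the curvatures in the two frames.\<close>

lemma \<Omega>_R_curv:
  assumes "x \<in> U"
  shows "\<Omega> x i j \<times> (P x *v v) = P x *v (R_curv B c x i j *v v)"
proof -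
  have W: "smooth_on U (\<lambda>y. P y *v (A y i *v v))" for i
    by (intro smooth_on_matrix_vector smooth_P smooth_A smooth_on_const open_U)
  have pW: "pd i (\<lambda>y. P y *v (A y j *v v)) x
      = P x *v (pd i (\<lambda>y. A y j) x *v v) + pd i P x *v (A x j *v v)" for i j
    by (simp add: pd_matrix_vector differentiable_matrix_vector diff_P[OF assms] diff_A[OF assms])
  have sP: "smooth_on U (\<lambda>y. P y *v v)" by (intro smooth_on_matrix_vector smooth_P smooth_on_const open_U)
  have "pd i (\<lambda>y. P y *v v) y + a i y \<times> (P y *v v) + (0 * w i y) *\<^sub>R (P y *v v) = P y *v (A y i *v v)"
    if "y \<in> U" for y i
    by (simp add: pd_matrix_vector diff_P[OF that] a_cross_P[OF that])
  from ricci_identity[OF assms sP W this, of i j]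
  show ?thesis
    unfolding pW a_cross_P[OF assms] R_curv_def Let_def
    by (simp add: matrix_vector_mult_diff_rdistrib matrix_vector_mult_add_rdistrib
        matrix_vector_right_distrib matrix_vector_mult_diff_distrib matrix_vector_mul_assoc[symmetric])
qed

section \<open>Metric algebra and curvature in the coframe\<close>

lemma G_inv: "x \<in> U \<Longrightarrow> G x *v (matrix_inv (G x) *v v) = v" "x \<in> U \<Longrightarrow> matrix_inv (G x) *v (G x *v v) = v"
proof -
  assume x: "x \<in> U"
  have "invertible (G x)"
    using positive_minors(3)[OF conf_symmetric[OF x] conf_positive[OF x]] by (simp add: invertible_det_nz)
  then show "G x *v (matrix_inv (G x) *v v) = v" "matrix_inv (G x) *v (G x *v v) = v"
    by (simp_all add: invertible_3x3_inv)
qed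

lemma P_inj: "x \<in> U \<Longrightarrow> P x *v u = P x *v v \<longleftrightarrow> u = v"
  using EP by metis

lemma coframe_eqI: "x \<in> U \<Longrightarrow> (\<And>j. u \<bullet> \<theta> j x = v \<bullet> \<theta> j x) \<Longrightarrow> u = v"
  using coframe_nondegenerate[of x "u - v"] by (simp add: inner_diff)

lemma P_expand: "P x *v v = v $ 1 *\<^sub>R \<theta> 1 x + v $ 2 *\<^sub>R \<theta> 2 x + v $ 3 *\<^sub>R \<theta> 3 x"
  by (simp add: \<theta>_def vec_eq_iff matrix_vector_mult_def axis_def sum_3 mult.commute)

lemma cinner_P: "x \<in> U \<Longrightarrow> cinner B c x u v = (P x *v u) \<bullet> (P x *v v)"
  by (simp add: cinner_def inner_P)

lemma flat_P: "x \<in> U \<Longrightarrow> flat B c x v $ j = (P x *v v) \<bullet> \<theta> j x"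
  using inner_P[of x "axis j 1" v] by (simp add: \<theta>_def flat_def inner_axis' inner_commute)

lemma inner_sharp: "x \<in> U \<Longrightarrow> (P x *v sharp B c x \<alpha>) \<bullet> (P x *v v) = \<alpha> \<bullet> v"
  using inner_P[of x v "sharp B c x \<alpha>"] by (simp add: sharp_def G_inv inner_commute)

lemma sharp_coframe: "x \<in> U \<Longrightarrow> (P x *v sharp B c x \<alpha>) \<bullet> \<theta> j x = \<alpha> $ j"
  by (simp add: \<theta>_def inner_sharp inner_axis)

lemma sharp_flat: "x \<in> U \<Longrightarrow> sharp B c x (flat B c x v) = v"
  by (simp add: sharp_def flat_def G_inv)

lemma orf_P: "x \<in> U \<Longrightarrow> orf B c x u v z = (P x *v u) \<bullet> ((P x *v v) \<times> (P x *v z))"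
proof -
  assume x: "x \<in> U"
  have "det (G x) = det (P x) * det (P x)"
    by (simp add: P_conf[OF x, symmetric] det_mul)
  then have "sqrt (det (G x)) = det (P x)"
    using det_P[OF x] by (simp add: real_sqrt_mult)
  moreover have "(P x *v u) \<bullet> ((P x *v v) \<times> (P x *v z)) = det (P x) * (u \<bullet> (v \<times> z))"
    using cross_matrix_mult[of "P x" v z] inner_vector_matrix[of u "(P x *v v) \<times> (P x *v z)" "P x"]
    by simp
  ultimately show ?thesis by (simp add: orf_def dot_cross_det)
qed

lemma star1_P: "x \<in> U \<Longrightarrow> star1 B c x \<alpha> $ i $ j = (P x *v sharp B c x \<alpha>) \<bullet> area x i j"
  by (simp add: star1_def orf_P area_def \<theta>_def)

lemma F_curv_eq: "x \<in> U \<Longrightarrow> F_curv B c x $ i $ j = F x i j"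
  using smooth_on_differentiable[OF smooth_weyl_form]
  unfolding F_def by (simp add: F_curv_def ext_d_def w_def[abs_def] pd_nth)

lemma contract_F: "x \<in> U \<Longrightarrow> P x *v sharp B c x (v v* F_curv B c x) = \<phi> x \<times> (P x *v v)"
proof (rule coframe_eqI)
  fix j assume x: "x \<in> U"
  have "(v v* F_curv B c x) $ j = v $ 1 * F x 1 j + v $ 2 * F x 2 j + v $ 3 * F x 3 j"
    using x by (simp add: vector_matrix_mult_def sum_3 F_curv_eq)
  also have "\<dots> = (\<phi> x \<times> (P x *v v)) \<bullet> \<theta> j x"
    unfolding F_eq[OF x] P_expand area_def by (simp add: coords3 algebra_simps)
  finally show "(P x *v sharp B c x (v v* F_curv B c x)) \<bullet> \<theta> j x = (\<phi> x \<times> (P x *v v)) \<bullet> \<theta> j x"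
    by (simp add: sharp_coframe[OF x])
qed

lemma grad_D_dens: "x \<in> U \<Longrightarrow> P x *v sharp B c x (D_dens B (-1) s c x) = grad (s c) x"
  by (rule coframe_eqI, assumption, simp add: sharp_coframe grad_coframe) (simp add: D_dens_def w_def)

text \<open>Every vector in dimension three is a cross product, so \<open>F\<close> is a wedge product and the
  normalisation of the star on wedge products applies. The sign is the one in \<open>** = -1\<close>.\<close>

lemma star2_F:
  assumes "x \<in> U"
  shows "v \<bullet> star2 B c x (F_curv B c x) = - (\<phi> x \<bullet> (P x *v v))"
proof -
  have "\<exists>p q. p \<times> q = \<phi> x"
  proof (cases "\<phi> x = 0")
    case True
    then show ?thesis by (intro exI[of _ 0]) simp
  next
    case False
    then obtain p where p: "p \<bullet> \<phi> x = 0" "p \<bullet> p = 1" by (rule exists_unit_orthogonal)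
    have "p \<times> (\<phi> x \<times> p) = \<phi> x" by (simp add: Lagrange p)
    then show ?thesis by blast
  qed
  then obtain p q where pq: "p \<times> q = \<phi> x" by blast
  define \<alpha> where "\<alpha> = flat B c x (E x *v q)"
  have q: "P x *v sharp B c x \<alpha> = q" by (simp add: \<alpha>_def sharp_flat PE assms)
  have "F_curv B c x = wedge (flat B c x (E x *v p)) \<alpha>"
    by (simp add: vec_eq_iff wedge_def \<alpha>_def flat_P PE F_curv_eq F_eq assms area_def pq[symmetric]
        inner_cross_cross)
  moreover have "invertible (conf B c x)"
    using positive_minors(3)[OF conf_symmetric[OF assms] conf_positive[OF assms]]
    by (simp add: invertible_det_nz)
  ultimately have "star2 B c x (F_curv B c x) = (E x *v p) v* star1 B c x \<alpha>"
    by (simp add: star2_wedge)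
  then have "v \<bullet> star2 B c x (F_curv B c x) = q \<bullet> (p \<times> (P x *v v))"
    using star1_interior[of "E x *v p" B c x \<alpha> v] by (simp add: inner_commute orf_P q PE assms)
  then show ?thesis
    unfolding pq[symmetric] by (simp add: coords3 algebra_simps)
qed

text \<open>
  In the frame, \<open>- r(X) \<triangle> Y + r(Y) \<triangle> X\<close> is the cross product with \<open>r(Y) \<times> X - r(X) \<times> Y\<close>. For the
  three parts of \<open>r\<close> this is computed by \<open>symmetric_area_map\<close>, by skew-symmetry, and by the Jacobi
  identity.
\<close>

lemma curv_parts_coframe:
  assumes "x \<in> U"
  shows "curv_parts B c x r0 s \<longleftrightarrow> curvature_parts x (transpose (E x) ** r0 ** E x) s"
proof -
  define Q where "Q = transpose (E x) ** r0 ** E x"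
  have EPm: "E x ** P x = mat 1" and PEm: "P x ** E x = mat 1"
    using EP[OF assms] PE[OF assms] by (auto simp: matrix_eq matrix_vector_mul_assoc[symmetric])
  have tPE: "transpose (P x) ** transpose (E x) = mat 1"
    unfolding matrix_transpose_mul[symmetric] EPm by (rule transpose_mat)
  have r0: "r0 = transpose (P x) ** Q ** P x"
  proof -
    have "transpose (P x) ** Q ** P x = (transpose (P x) ** transpose (E x)) ** r0 ** (E x ** P x)"
      by (simp add: Q_def matrix_mul_assoc)
    then show ?thesis by (simp add: tPE EPm)
  qed
  have sym: "transpose r0 = r0 \<longleftrightarrow> transpose Q = Q"
  proof
    show "transpose r0 = r0 \<Longrightarrow> transpose Q = Q"
      by (simp add: Q_def matrix_transpose_mul matrix_mul_assoc)
    assume "transpose Q = Q"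
    then show "transpose r0 = r0"
      by (subst (1 2) r0) (simp add: matrix_transpose_mul matrix_mul_assoc)
  qed
  have Ginv: "matrix_inv (G x) = E x ** transpose (E x)"
  proof -
    have "matrix_inv (G x) *v v = (E x ** transpose (E x)) *v v" for v
    proof -
      have "G x *v ((E x ** transpose (E x)) *v v) = (transpose (P x) ** (P x ** E x) ** transpose (E x)) *v v"
        by (simp add: P_conf[OF assms, symmetric] matrix_vector_mul_assoc matrix_mul_assoc)
      then have "G x *v ((E x ** transpose (E x)) *v v) = v" by (simp add: PEm tPE)
      then have "matrix_inv (G x) *v v = matrix_inv (G x) *v (G x *v ((E x ** transpose (E x)) *v v))" by simp
      then show ?thesis by (simp only: G_inv[OF assms])
    qed
    then show ?thesis by (simp add: matrix_eq)
  qed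
  have tr: "trace (endo B c x r0) = trace Q"
  proof -
    have "trace (endo B c x r0) = trace (E x ** (transpose (E x) ** transpose r0))"
      by (simp add: endo_def Ginv matrix_mul_assoc)
    also have "\<dots> = trace (transpose Q)"
      by (subst trace_mul_sym) (simp add: Q_def matrix_transpose_mul matrix_mul_assoc)
    also have "\<dots> = trace Q" by (simp add: trace_def transpose_def)
    finally show ?thesis .
  qed
  have main: "(\<forall>i j Y. R_curv B c x i j *v Y = - tri B c x (axis i 1 v* r) (axis j 1) Y + tri B c x (axis j 1 v* r) (axis i 1) Y)
      \<longleftrightarrow> (\<forall>i j. \<Omega> x i j = Q *v area x i j - (s / 6) *\<^sub>R area x i j + (1/2) *\<^sub>R (\<phi> x \<times> area x i j))"
    if Q: "transpose Q = Q" "trace Q = 0" and r: "r = r0 + (s / 12) *\<^sub>R conf B c x - (1/2) *\<^sub>R F_curv B c x" for r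
  proof -
    define \<rho> where "\<rho> i = P x *v sharp B c x (axis i 1 v* r)" for i
    have rho: "\<rho> i = Q *v \<theta> i x + (s / 12) *\<^sub>R \<theta> i x - (1/2) *\<^sub>R (\<phi> x \<times> \<theta> i x)" for i
    proof (rule coframe_eqI[OF assms])
      fix m
      have "(axis i 1 v* r) $ m = r $ i $ m"
        by (simp add: vector_matrix_mult_def axis_def if_distrib if_distribR cong: if_cong)
      moreover have "r0 $ i $ m = (Q *v \<theta> i x) \<bullet> \<theta> m x"
      proof -
        have "r0 $ i $ m = transpose r0 $ m $ i" by (simp add: transpose_def)
        also have "\<dots> = axis m 1 \<bullet> (r0 *v axis i 1)"
          using sym Q(1) by (simp add: matrix_vector_mult_basis column_def inner_axis')
        also have "\<dots> = (P x *v axis m 1) \<bullet> (Q *v (P x *v axis i 1))"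
          by (subst r0) (simp add: matrix_vector_mul_assoc[symmetric] inner_vector_matrix)
        finally show ?thesis by (simp add: \<theta>_def inner_commute)
      qed
      moreover have "G x $ i $ m = \<theta> i x \<bullet> \<theta> m x"
        unfolding \<theta>_def inner_P[OF assms] by (simp add: matrix_vector_mult_basis column_def inner_axis')
      moreover have "F_curv B c x $ i $ m = (\<phi> x \<times> \<theta> i x) \<bullet> \<theta> m x"
        using cross_triple[of "\<phi> x" "\<theta> i x" "\<theta> m x"]
        by (simp add: F_curv_eq[OF assms] F_eq[OF assms] area_def inner_commute)
      ultimately show "\<rho> i \<bullet> \<theta> m x = (Q *v \<theta> i x + (s / 12) *\<^sub>R \<theta> i x - (1/2) *\<^sub>R (\<phi> x \<times> \<theta> i x)) \<bullet> \<theta> m x"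
        by (simp add: \<rho>_def sharp_coframe[OF assms] r inner_add inner_diff)
    qed
    have N: "\<rho> j \<times> \<theta> i x - \<rho> i \<times> \<theta> j x
        = Q *v area x i j - (s / 6) *\<^sub>R area x i j + (1/2) *\<^sub>R (\<phi> x \<times> area x i j)" for i j
    proof -
      have "(Q *v \<theta> i x) \<times> \<theta> j x + \<theta> i x \<times> (Q *v \<theta> j x) = - (Q *v area x i j)"
        unfolding symmetric_area_map by (simp add: Q area_def)
      then have 1: "(Q *v \<theta> j x) \<times> \<theta> i x - (Q *v \<theta> i x) \<times> \<theta> j x = Q *v area x i j"
        using cross_skew[of "\<theta> i x" "Q *v \<theta> j x"] by (simp add: algebra_simps eq_neg_iff_add_eq_0)
      have 2: "(\<phi> x \<times> \<theta> i x) \<times> \<theta> j x - (\<phi> x \<times> \<theta> j x) \<times> \<theta> i x = \<phi> x \<times> area x i j"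
        by (simp add: area_def cross_cross Lagrange inner_commute)
      have 3: "\<theta> j x \<times> \<theta> i x = - area x i j" by (simp add: area_def cross_skew[of "\<theta> j x"])
      have "\<rho> j \<times> \<theta> i x - \<rho> i \<times> \<theta> j x
        = ((Q *v \<theta> j x) \<times> \<theta> i x - (Q *v \<theta> i x) \<times> \<theta> j x)
        + (s / 12) *\<^sub>R (\<theta> j x \<times> \<theta> i x) - (s / 12) *\<^sub>R area x i j
        + (1/2) *\<^sub>R ((\<phi> x \<times> \<theta> i x) \<times> \<theta> j x - (\<phi> x \<times> \<theta> j x) \<times> \<theta> i x)"
        unfolding rho area_def
        by (simp add: cross_add_left Cross3.left_diff_distrib cross_mult_left algebra_simps)
      then show ?thesis unfolding 1 2 3 by (simp add: scaleR_add_left[symmetric] algebra_simps)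
    qed
    have eq: "R_curv B c x i j *v Y = - tri B c x (axis i 1 v* r) (axis j 1) Y + tri B c x (axis j 1 v* r) (axis i 1) Y
      \<longleftrightarrow> (\<Omega> x i j - (\<rho> j \<times> \<theta> i x - \<rho> i \<times> \<theta> j x)) \<times> (P x *v Y) = 0" for i j Y
    proof -
      have tri: "P x *v tri B c x (axis i 1 v* r) (axis j 1) Y
          = (\<rho> i \<bullet> (P x *v Y)) *\<^sub>R \<theta> j x - (\<theta> j x \<bullet> (P x *v Y)) *\<^sub>R \<rho> i" for i j
        by (simp add: tri_def matrix_vector_mult_diff_distrib matrix_vector_mult_scaleR cinner_P[OF assms]
            \<rho>_def inner_sharp[OF assms] \<theta>_def)
      have "R_curv B c x i j *v Y = - tri B c x (axis i 1 v* r) (axis j 1) Y + tri B c x (axis j 1 v* r) (axis i 1) Y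
        \<longleftrightarrow> P x *v (R_curv B c x i j *v Y)
          = P x *v (tri B c x (axis j 1 v* r) (axis i 1) Y - tri B c x (axis i 1 v* r) (axis j 1) Y)"
        by (simp add: P_inj[OF assms])
      also have "\<dots> \<longleftrightarrow> \<Omega> x i j \<times> (P x *v Y) = (\<rho> j \<times> \<theta> i x - \<rho> i \<times> \<theta> j x) \<times> (P x *v Y)"
        unfolding matrix_vector_mult_diff_distrib tri \<Omega>_R_curv[OF assms, symmetric]
        by (simp add: Cross3.left_diff_distrib cross_cross algebra_simps)
      finally show ?thesis by (simp add: Cross3.left_diff_distrib)
    qed
    have "(\<forall>Y. R_curv B c x i j *v Y = - tri B c x (axis i 1 v* r) (axis j 1) Y + tri B c x (axis j 1 v* r) (axis i 1) Y)
      \<longleftrightarrow> \<Omega> x i j = Q *v area x i j - (s / 6) *\<^sub>R area x i j + (1/2) *\<^sub>R (\<phi> x \<times> area x i j)" for i j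
    proof
      assume "\<forall>Y. R_curv B c x i j *v Y = - tri B c x (axis i 1 v* r) (axis j 1) Y + tri B c x (axis j 1 v* r) (axis i 1) Y"
      then have "(\<Omega> x i j - (\<rho> j \<times> \<theta> i x - \<rho> i \<times> \<theta> j x)) \<times> (P x *v (E x *v y)) = 0" for y
        unfolding eq by blast
      then have "\<Omega> x i j - (\<rho> j \<times> \<theta> i x - \<rho> i \<times> \<theta> j x) = 0"
        unfolding PE[OF assms] by (rule cross_all_eq_0)
      then show "\<Omega> x i j = Q *v area x i j - (s / 6) *\<^sub>R area x i j + (1/2) *\<^sub>R (\<phi> x \<times> area x i j)"
        unfolding N by (rule right_minus_eq[THEN iffD1])
    next
      assume "\<Omega> x i j = Q *v area x i j - (s / 6) *\<^sub>R area x i j + (1/2) *\<^sub>R (\<phi> x \<times> area x i j)"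
      then show "\<forall>Y. R_curv B c x i j *v Y = - tri B c x (axis i 1 v* r) (axis j 1) Y + tri B c x (axis j 1 v* r) (axis i 1) Y"
        unfolding eq by (simp add: N)
    qed
    then show ?thesis by blast
  qed
  show ?thesis
    unfolding curv_parts_def curvature_parts_def Let_def tr sym Q_def[symmetric]
    using main[OF _ _ refl] by blast
qed

text \<open>Existence and uniqueness of the decomposition, so that the definite descriptions of \<open>scal\<close> and
  \<open>r0_curv\<close> denote its parts.\<close>

lemma scal_r0_curv:
  assumes "x \<in> U"
  obtains Q where "curvature_parts x Q (scal B c x)" "r0_curv B c x = 0 \<longleftrightarrow> Q = 0"
proof -
  obtain Q s where Q: "curvature_parts x Q s" using curvature_parts_exists[OF assms] by blast
  define r0 where "r0 = transpose (P x) ** Q ** P x"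
  have PEm: "P x ** E x = mat 1"
    using PE[OF assms] by (auto simp: matrix_eq matrix_vector_mul_assoc[symmetric])
  have EPm: "E x ** P x = mat 1"
    using EP[OF assms] by (auto simp: matrix_eq matrix_vector_mul_assoc[symmetric])
  have tEP: "transpose (E x) ** transpose (P x) = mat 1"
    unfolding matrix_transpose_mul[symmetric] PEm by (rule transpose_mat)
  have tPE: "transpose (P x) ** transpose (E x) = mat 1"
    unfolding matrix_transpose_mul[symmetric] EPm by (rule transpose_mat)
  have conj_r0: "transpose (E x) ** r0 ** E x = Q"
  proof -
    have "transpose (E x) ** r0 ** E x = (transpose (E x) ** transpose (P x)) ** Q ** (P x ** E x)"
      by (simp add: r0_def matrix_mul_assoc)
    then show ?thesis by (simp add: tEP PEm)
  qed
  have ex: "curv_parts B c x r0 s" unfolding curv_parts_coframe[OF assms] conj_r0 by (rule Q)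
  have uniq: "r0' = r0 \<and> s' = s" if "curv_parts B c x r0' s'" for r0' s'
  proof -
    have Qs: "transpose (E x) ** r0' ** E x = Q \<and> s' = s"
      using curvature_parts_unique[OF assms _ Q] that curv_parts_coframe[OF assms] by blast
    have "transpose (P x) ** (transpose (E x) ** r0' ** E x) ** P x
        = (transpose (P x) ** transpose (E x)) ** r0' ** (E x ** P x)" by (simp only: matrix_mul_assoc)
    then have "transpose (P x) ** Q ** P x = r0'"
      unfolding conjunct1[OF Qs] tPE EPm by simp
    then show ?thesis using Qs by (simp add: r0_def)
  qed
  have "scal B c x = s" unfolding scal_def using ex uniq by (intro the_equality) blast+
  moreover have "r0_curv B c x = r0" unfolding r0_curv_def using ex uniq by (intro the_equality) blast+
  moreover have "r0 = 0 \<longleftrightarrow> Q = 0"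
    using conj_r0 by (auto simp: r0_def matrix_matrix_mult_def vec_eq_iff)
  ultimately show thesis using Q that by simp
qed

end


section \<open>The monopole equations in a chart\<close>

locale weyl_congruence = weyl_chart B c
  for B :: "'b::{t2_space,second_countable_topology} weyl_data" and c +
  fixes X :: "('b, real^3) field" and \<tau> \<kappa> :: "('b, real) field"
  assumes cong: "congruence B X"
    and div_section: "density_section B (-1) \<tau>" and twist_section: "density_section B (-1) \<kappa>"
    and div_twist: "div_twist_eq B X \<tau> \<kappa>"
begin

definition V :: "real^3 \<Rightarrow> real^3" where "V x = P x *v X c x"

lemma smooth_X: "smooth_on U (X c)"
  using cong chart by (simp add: congruence_def vector_section_def smooth_field_def)

lemma star_vec_P: "x \<in> U \<Longrightarrow> star_vec B X c x $ i $ j = V x \<bullet> area x i j"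
  by (simp add: star_vec_def star1_P sharp_flat V_def)

lemma D_vec_coframe:
  assumes "x \<in> U"
  shows "pd i V x + a i x \<times> V x
    = \<tau> c x *\<^sub>R (\<theta> i x - (V x \<bullet> \<theta> i x) *\<^sub>R V x) + \<kappa> c x *\<^sub>R (V x \<times> \<theta> i x)"
proof -
  have X: "X c differentiable (at x)" using smooth_on_differentiable[OF smooth_X assms] .
  have "pd i V x + a i x \<times> V x = P x *v (D_vec B (-1) X c x *v axis i 1)"
  proof -
    have "D_vec B (-1) X c x *v axis i 1 = pd i (X c) x + A x i *v X c x"
      by (simp add: D_vec_def matrix_vector_mult_basis column_def vec_eq_iff)
    then show ?thesis
      unfolding V_def[abs_def]
      by (simp add: pd_matrix_vector diff_P[OF assms] X a_cross_P[OF assms] matrix_vector_right_distrib)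
  qed
  also have "D_vec B (-1) X c x = \<tau> c x *\<^sub>R (mat 1 - tensor_sq B X c x)
      + \<kappa> c x *\<^sub>R endo B c x (star_vec B X c x)"
    using div_twist chart assms by (simp add: div_twist_eq_def)
  also have "P x *v ((\<tau> c x *\<^sub>R (mat 1 - tensor_sq B X c x)
      + \<kappa> c x *\<^sub>R endo B c x (star_vec B X c x)) *v axis i 1)
    = \<tau> c x *\<^sub>R (\<theta> i x - P x *v (tensor_sq B X c x *v axis i 1))
      + \<kappa> c x *\<^sub>R (P x *v (endo B c x (star_vec B X c x) *v axis i 1))"
    by (simp add: matrix_vector_mult_add_rdistrib matrix_vector_mult_diff_rdistrib \<theta>_def
        scaleR_matrix_vector_assoc[symmetric] matrix_vector_right_distrib matrix_vector_mult_diff_distrib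
        matrix_vector_mult_scaleR)
  also have "tensor_sq B X c x *v axis i 1 = (V x \<bullet> \<theta> i x) *\<^sub>R X c x"
    by (simp add: matrix_vector_mult_basis column_def tensor_sq_def flat_P[OF assms] V_def vec_eq_iff)
  also have "P x *v (endo B c x (star_vec B X c x) *v axis i 1) = V x \<times> \<theta> i x"
  proof (rule coframe_eqI[OF assms])
    fix j
    have "endo B c x (star_vec B X c x) *v axis i 1
        = sharp B c x (transpose (star_vec B X c x) *v axis i 1)"
      by (simp only: endo_def sharp_def matrix_vector_mul_assoc)
    then have "(P x *v (endo B c x (star_vec B X c x) *v axis i 1)) \<bullet> \<theta> j x
        = (transpose (star_vec B X c x) *v axis i 1) $ j"
      by (simp only: sharp_coframe[OF assms])
    also have "\<dots> = star_vec B X c x $ i $ j"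
      unfolding matrix_vector_mult_basis by (simp add: column_def transpose_def)
    also have "\<dots> = (V x \<times> \<theta> i x) \<bullet> \<theta> j x"
      using cross_triple[of "V x" "\<theta> i x" "\<theta> j x"] by (simp add: star_vec_P[OF assms] area_def inner_commute)
    finally show "(P x *v (endo B c x (star_vec B X c x) *v axis i 1)) \<bullet> \<theta> j x = (V x \<times> \<theta> i x) \<bullet> \<theta> j x" .
  qed
  finally show ?thesis by (simp add: matrix_vector_mult_scaleR flip: V_def)
qed

sublocale coframe_congruence U \<theta> a w V "\<tau> c" "\<kappa> c"
proof
  show "smooth_on U V"
    unfolding V_def[abs_def] by (intro smooth_on_matrix_vector smooth_P smooth_X open_U)
  show "smooth_on U (\<tau> c)" "smooth_on U (\<kappa> c)"
    using div_section twist_section chart by (simp_all add: density_section_def smooth_field_def)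
  show "V x \<bullet> V x = 1" if "x \<in> U" for x
  proof -
    have "cinner B c x (X c x) (X c x) = 1" using cong chart that by (simp add: congruence_def)
    then show ?thesis by (simp add: cinner_P[OF that] V_def)
  qed
qed (rule D_vec_coframe)

lemma one_form_coframe: "y \<in> U \<Longrightarrow> one_form B s X c y $ j = s c y * (V y \<bullet> \<theta> j y)"
  by (simp add: one_form_def flat_P V_def)

lemma smooth_one_form:
  assumes "smooth_on U (s c)"
  shows "smooth_on U (one_form B s X c)"
  unfolding one_form_def[abs_def] flat_def
  by (intro smooth_on_scaleR smooth_on_matrix_vector smooth_conf smooth_X assms open_U)

lemma ext_d_one_form_coframe:
  assumes "x \<in> U" "smooth_on U (s c)"
  shows "ext_d (one_form B s X c) x $ i $ j
    = pd i (\<lambda>y. s c y * (V y \<bullet> \<theta> j y)) x - pd j (\<lambda>y. s c y * (V y \<bullet> \<theta> i y)) x"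
proof -
  have "pd i (one_form B s X c) x $ j = pd i (\<lambda>y. s c y * (V y \<bullet> \<theta> j y)) x" for i j
    unfolding pd_nth[OF smooth_on_differentiable[OF smooth_one_form[of s, OF assms(2)] assms(1)], symmetric]
    by (rule pd_cong_open[OF open_U assms(1) one_form_coframe])
  then show ?thesis by (simp add: ext_d_def)
qed

lemma monopole1_rhs_coframe:
  assumes "x \<in> U"
  shows "monopole1_rhs B X \<tau> \<kappa> c x $ i $ j
    = - (1/2) * ((\<phi> x \<times> V x) \<bullet> area x i j) - (scal B c x / 6) * (V x \<bullet> area x i j)
      - ((\<tau> c x)\<^sup>2 + (\<kappa> c x)\<^sup>2) * (V x \<bullet> area x i j) + ext_d (one_form B \<kappa> X c) x $ i $ j"
  using assms by (simp add: monopole1_rhs_def star1_P contract_F star_vec_P V_def)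

lemma monopole1_iff:
  assumes "x \<in> U"
  shows "star1 B c x (D_dens B (-1) \<tau> c x) = monopole1_rhs B X \<tau> \<kappa> c x
    \<longleftrightarrow> div_defect x (scal B c x) = 0 \<and> monopole_defect x = 0"
proof -
  obtain Q where "curvature_parts x Q (scal B c x)" using scal_r0_curv[OF assms] .
  then have "V x \<bullet> monopole_defect x = 0" by (rule curvature_congruence[OF assms])
  from monopole1_area[OF assms this, of "scal B c x"] show ?thesis
    by (simp add: vec_eq_iff[of "star1 B c x _"] vec_eq_iff[of "star1 B c x _ $ _"] monopole1_rhs_coframe[OF assms]
        star1_P[OF assms] grad_D_dens[OF assms] ext_d_one_form_coframe[of x \<kappa>, OF assms smooth_\<kappa>])
qed

lemma monopole2_iff:
  assumes "x \<in> U"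
  shows "star1 B c x (D_dens B (-1) \<kappa> c x) = monopole2_rhs B X \<tau> c x \<longleftrightarrow> monopole_defect x = 0"
  using monopole2_area[OF assms]
  by (simp add: vec_eq_iff[of "star1 B c x _"] vec_eq_iff[of "star1 B c x _ $ _"] monopole2_rhs_def F_curv_eq[OF assms]
      star1_P[OF assms] grad_D_dens[OF assms] ext_d_one_form_coframe[of x \<tau>, OF assms smooth_\<tau>])

lemma einstein_iff:
  assumes "x \<in> U"
  shows "r0_curv B c x = 0 \<longleftrightarrow> div_defect x (scal B c x) = 0 \<and> monopole_defect x = 0"
proof -
  obtain Q where "curvature_parts x Q (scal B c x)" "r0_curv B c x = 0 \<longleftrightarrow> Q = 0"
    using scal_r0_curv[OF assms] .
  then show ?thesis using curvature_congruence(2)[OF assms] by simp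
qed

lemma divergence_equation:
  assumes "x \<in> U"
  shows "X c x \<bullet> D_dens B (-1) \<tau> c x + (\<tau> c x)\<^sup>2 - (\<kappa> c x)\<^sup>2 + 1/6 * scal B c x = div_defect x (scal B c x)"
proof -
  have "X c x \<bullet> D_dens B (-1) \<tau> c x = V x \<bullet> grad (\<tau> c) x"
    using inner_sharp[OF assms, of "D_dens B (-1) \<tau> c x" "X c x"]
    by (simp add: grad_D_dens[OF assms] V_def inner_commute)
  then show ?thesis by (simp add: div_defect_def)
qed

lemma twist_equation:
  assumes "x \<in> U"
  shows "X c x \<bullet> D_dens B (-1) \<kappa> c x + 2 * \<tau> c x * \<kappa> c x + 1/2 * (X c x \<bullet> star2 B c x (F_curv B c x)) = 0"
proof -
  obtain Q where "curvature_parts x Q (scal B c x)" using scal_r0_curv[OF assms] .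
  then have "V x \<bullet> monopole_defect x = 0" by (rule curvature_congruence[OF assms])
  moreover have "X c x \<bullet> D_dens B (-1) \<kappa> c x = V x \<bullet> grad (\<kappa> c) x"
    using inner_sharp[OF assms, of "D_dens B (-1) \<kappa> c x" "X c x"]
    by (simp add: grad_D_dens[OF assms] V_def inner_commute)
  ultimately show ?thesis
    using star2_F[OF assms, of "X c x"]
    by (simp add: monopole_defect_def inner_add inner_diff dot_cross_self unit[OF assms] V_def[symmetric] inner_commute)
qed

text \<open>The scalar curvature enters the right hand side through its pointwise definition. It is smooth
  because the vanishing of the divergence defect expresses it through \<open>\<tau>\<close>, \<open>\<kappa>\<close> and the gradient of
  \<open>\<tau>\<close>.\<close>

lemma monopole1_rhs_closed:
  assumes x: "x \<in> U" and ew: "\<And>y. y \<in> U \<Longrightarrow> div_defect y (scal B c y) = 0 \<and> monopole_defect y = 0"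
  shows "monopole1_rhs B X \<tau> \<kappa> c differentiable (at x)"
    and "transpose (monopole1_rhs B X \<tau> \<kappa> c x) = - monopole1_rhs B X \<tau> \<kappa> c x"
    and "pd i (monopole1_rhs B X \<tau> \<kappa> c) x $ j $ k + pd j (monopole1_rhs B X \<tau> \<kappa> c) x $ k $ i
      + pd k (monopole1_rhs B X \<tau> \<kappa> c) x $ i $ j = 0"
proof -
  let ?\<omega> = "monopole1_rhs B X \<tau> \<kappa> c"
  define s where "s y = 6 * ((\<kappa> c y)\<^sup>2 - (\<tau> c y)\<^sup>2 - V y \<bullet> grad (\<tau> c) y)" for y
  define q where "q y = - (1/2) *\<^sub>R (\<phi> y \<times> V y) - (s y / 6 + (\<tau> c y)\<^sup>2 + (\<kappa> c y)\<^sup>2) *\<^sub>R V y" for y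
  define M where "M y = (\<chi> j k. q y \<bullet> area y j k)" for y
  have s: "s y = scal B c y" if "y \<in> U" for y
    using ew[OF that] by (simp add: s_def div_defect_def)
  have sms: "smooth_on U s"
    unfolding s_def power2_eq_square
    by (intro smooth_on_mult smooth_on_diff smooth_on_inner smooth_on_const smooth_grad smooth_\<tau>
        smooth_\<kappa> smooth_V open_U)
  have smq: "smooth_on U q"
    unfolding q_def power2_eq_square divide_inverse
    by (intro smooth_on_diff smooth_on_add smooth_on_scaleR smooth_on_mult smooth_on_cross3
        smooth_on_const smooth_V smooth_\<tau> smooth_\<kappa> smooth_\<phi> sms open_U)
  have "smooth_on U (\<lambda>y. q y \<bullet> area y j k)" for j k
    unfolding area_def by (intro smooth_on_inner smooth_on_cross3 smq smooth_coframe open_U)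
  then have "smooth_on U (\<lambda>y. M y $ j $ k)" for j k by (simp add: M_def)
  then have smM: "smooth_on U M" by (intro smooth_on_vec[OF open_U])
  let ?d = "ext_d (one_form B \<kappa> X c)"
  have d: "?d differentiable (at x)"
    and dd: "pd i ?d x $ j $ k + pd j ?d x $ k $ i + pd k ?d x $ i $ j = 0" for i j k
    using ext_d_closed[OF open_U x smooth_one_form[of \<kappa>, OF smooth_\<kappa>]] .
  have M: "M differentiable (at x)" using smooth_on_differentiable[OF smM x] .
  have \<omega>: "?\<omega> y = M y + ?d y" if "y \<in> U" for y
    by (simp add: vec_eq_iff[of "_ :: real^3^3"] vec_eq_iff[of "_ :: real^3"] monopole1_rhs_coframe[OF that] M_def q_def
        s[OF that] inner_diff algebra_simps)
  show "?\<omega> differentiable (at x)"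
    by (rule differentiable_cong_open[OF open_U x \<omega>]) (use M d in auto)
  have skew: "M x $ k $ j = - M x $ j $ k" for j k
    by (subst (1) M_def, subst area_skew) (simp add: M_def)
  have "transpose (M x + ?d x) $ j $ k = (- (M x + ?d x)) $ j $ k" for j k
    using skew[of k j] by (simp add: transpose_def ext_d_def)
  then show "transpose (?\<omega> x) = - ?\<omega> x"
    unfolding \<omega>[OF x] vec_eq_iff by blast
  have pd: "pd l ?\<omega> x = pd l M x + pd l ?d x" for l
    by (rule trans[OF pd_cong_open[OF open_U x \<omega>] pd_add[OF M d]])
  have pM: "pd l M x $ m $ n = pd l (\<lambda>y. q y \<bullet> area y m n) x" for l m n
    unfolding pd_entry[OF M] by (simp add: M_def)
  have "curvature_parts y 0 (s y)" if y: "y \<in> U" for y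
  proof -
    obtain Q where "curvature_parts y Q (scal B c y)" using scal_r0_curv[OF y] .
    moreover from this have "Q = 0" using curvature_congruence(2)[OF y] ew[OF y] by simp
    ultimately show ?thesis by (simp add: s[OF y])
  qed
  from monopole1_closed[OF x sms this, of i j k] dd[of i j k]
  show "pd i ?\<omega> x $ j $ k + pd j ?\<omega> x $ k $ i + pd k ?\<omega> x $ i $ j = 0"
    unfolding pd vector_add_component pM q_def by linarith
qed

lemma monopole2_rhs_closed:
  assumes x: "x \<in> U"
  shows "monopole2_rhs B X \<tau> c differentiable (at x)"
    and "transpose (monopole2_rhs B X \<tau> c x) = - monopole2_rhs B X \<tau> c x"
    and "pd i (monopole2_rhs B X \<tau> c) x $ j $ k + pd j (monopole2_rhs B X \<tau> c) x $ k $ i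
      + pd k (monopole2_rhs B X \<tau> c) x $ i $ j = 0"
proof -
  let ?d = "ext_d (one_form B \<tau> X c)" and ?F = "ext_d (weyl B c)"
  have \<omega>: "monopole2_rhs B X \<tau> c = (\<lambda>y. (1/2) *\<^sub>R ?F y - ?d y)"
    by (rule ext) (simp add: monopole2_rhs_def F_curv_def)
  note d = ext_d_closed[OF open_U x smooth_one_form[of \<tau>, OF smooth_\<tau>]]
    and F = ext_d_closed[OF open_U x smooth_weyl_form]
  have hF: "(\<lambda>y. (1/2) *\<^sub>R ?F y) differentiable (at x)"
    by (rule differentiable_linear[OF bounded_linear_scaleR_right F(1)])
  show "monopole2_rhs B X \<tau> c differentiable (at x)"
    unfolding \<omega> using hF d(1) by (rule differentiable_diff)
  show "transpose (monopole2_rhs B X \<tau> c x) = - monopole2_rhs B X \<tau> c x"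
    unfolding \<omega> by (simp add: vec_eq_iff transpose_def ext_d_def algebra_simps)
  have pd: "pd l (monopole2_rhs B X \<tau> c) x = (1/2) *\<^sub>R pd l ?F x - pd l ?d x" for l
    unfolding \<omega> by (simp only: pd_diff[OF hF d(1)] pd_linear[OF bounded_linear_scaleR_right F(1)])
  show "pd i (monopole2_rhs B X \<tau> c) x $ j $ k + pd j (monopole2_rhs B X \<tau> c) x $ k $ i
      + pd k (monopole2_rhs B X \<tau> c) x $ i $ j = 0"
    using d(2)[of i j k] F(2)[of i j k] by (simp add: pd)
qed

end

section \<open>The Einstein-Weyl equation as special monopole equations\<close>

theorem theorem3p8:
  fixes B :: "'b::{t2_space,second_countable_topology} weyl_data"
    and X :: "('b, real^3) field"
    and \<tau> \<kappa> :: "('b, real) field"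
  assumes "oriented_weyl_space B"
    and "congruence B X" and "geodesic B X" and "shear_free B X"
    and "density_section B (-1) \<tau>" and "density_section B (-1) \<kappa>"
    and "div_twist_eq B X \<tau> \<kappa>"
  shows "(einstein_weyl B \<longleftrightarrow> monopole1 B X \<tau> \<kappa> \<and> monopole2 B X \<tau> \<kappa>)
    \<and> (monopole1 B X \<tau> \<kappa> \<and> monopole2 B X \<tau> \<kappa> \<longrightarrow>
         closed_2form B (monopole1_rhs B X \<tau> \<kappa>) \<and> closed_2form B (monopole2_rhs B X \<tau>))
    \<and> (monopole1 B X \<tau> \<kappa> \<and> monopole2 B X \<tau> \<kappa> \<longleftrightarrow>
         (\<forall>a\<in>charts B. \<forall>x\<in>coords a.
            X a x \<bullet> D_dens B (-1) \<tau> a x + (\<tau> a x)\<^sup>2 - (\<kappa> a x)\<^sup>2 + 1/6 * scal B a x = 0)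
         \<and> monopole2 B X \<tau> \<kappa>)
    \<and> (monopole1 B X \<tau> \<kappa> \<and> monopole2 B X \<tau> \<kappa> \<longleftrightarrow>
         (\<forall>a\<in>charts B. \<forall>x\<in>coords a.
            X a x \<bullet> D_dens B (-1) \<kappa> a x + 2 * \<tau> a x * \<kappa> a x
              + 1/2 * (X a x \<bullet> star2 B a x (F_curv B a x)) = 0)
         \<and> monopole1 B X \<tau> \<kappa>)"
proof -
  have loc: "weyl_congruence B c X \<tau> \<kappa>" if "c \<in> charts B" for c
    using assms that by unfold_locales
  define div_defect where "div_defect c x = (X c x \<bullet> D_dens B (-1) \<tau> c x + (\<tau> c x)\<^sup>2 - (\<kappa> c x)\<^sup>2 + 1/6 * scal B c x)" for c x
  define monopole_defect where "monopole_defect c = coframe_congruence.monopole_defect (weyl_chart.\<theta> B c) (weyl_chart.w B c)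
    (weyl_congruence.V B c X) (\<tau> c) (\<kappa> c)" for c
  have div_defect: "div_defect c x = coframe_congruence.div_defect (weyl_chart.\<theta> B c) (weyl_chart.w B c)
    (weyl_congruence.V B c X) (\<tau> c) (\<kappa> c) x (scal B c x)" if "c \<in> charts B" "x \<in> coords c" for c x
    unfolding div_defect_def by (rule weyl_congruence.divergence_equation[OF loc[OF that(1)] that(2)])
  have ew: "einstein_weyl B \<longleftrightarrow> (\<forall>c\<in>charts B. \<forall>x\<in>coords c. div_defect c x = 0 \<and> monopole_defect c x = 0)"
    unfolding einstein_weyl_def monopole_defect_def using weyl_congruence.einstein_iff[OF loc] div_defect by simp
  have mono1: "monopole1 B X \<tau> \<kappa> \<longleftrightarrow> (\<forall>c\<in>charts B. \<forall>x\<in>coords c. div_defect c x = 0 \<and> monopole_defect c x = 0)"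
    unfolding monopole1_def monopole_defect_def using weyl_congruence.monopole1_iff[OF loc] div_defect by simp
  have mono2: "monopole2 B X \<tau> \<kappa> \<longleftrightarrow> (\<forall>c\<in>charts B. \<forall>x\<in>coords c. monopole_defect c x = 0)"
    unfolding monopole2_def monopole_defect_def using weyl_congruence.monopole2_iff[OF loc] by simp
  have closed1: "closed_2form B (monopole1_rhs B X \<tau> \<kappa>)" if "monopole1 B X \<tau> \<kappa>"
    unfolding closed_2form_def
    using weyl_congruence.monopole1_rhs_closed[OF loc] that[unfolded mono1] div_defect
    unfolding monopole_defect_def by simp
  have closed2: "closed_2form B (monopole2_rhs B X \<tau>)"
    unfolding closed_2form_def using weyl_congruence.monopole2_rhs_closed[OF loc] by simp
  have twist: "\<forall>a\<in>charts B. \<forall>x\<in>coords a. X a x \<bullet> D_dens B (-1) \<kappa> a x + 2 * \<tau> a x * \<kappa> a x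
      + 1/2 * (X a x \<bullet> star2 B a x (F_curv B a x)) = 0"
    using weyl_congruence.twist_equation[OF loc] by blast
  show ?thesis
    using ew mono1 mono2 closed1 closed2 twist unfolding div_defect_def by blast
qed

end
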